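(* Let $\Delta$ be a euclidean building and let $G$ be a strongly transitive type preserving subgroup of $\mathrm{Aut}(\Delta)$. Fix an apartment $F_0\subset\Delta$ and a sector $S_0\subset F_0$, and let $\omega_0$ be the boundary point of $\Delta$ represented by $S_0$. Let $B=\{g\in G: g\omega_0=\omega_0\}$ and $N=\{g\in G: gF_0=F_0\}$. Let $\Gamma$ be an I.C.C. subgroup of $B$, let $\Gamma_0=\Gamma\cap N$, and suppose that $\Gamma_0$ is abelian. Suppose also that $\Gamma_0\backslash F_0^0$ is finite, where $F_0^0$ is the vertex set of $F_0$. Then $VN(\Gamma_0)$ is a strongly singular masa of $VN(\Gamma)$.
   Context: A euclidean building is a building whose apartments are euclidean Coxeter complexes isometric to $\mathbb{R}^r$, equipped with its canonical metric consistent with the euclidean structure of the apartments. A sector is a simplicial cone of dimension $r$, with a special base vertex, lying in some apartment. Two sectors are equivalent if the Hausdorff distance between them is finite (equivalently, they contain a common subsector); the boundary of $\Delta$ is the set of equivalence classes of sectors, and automorphisms of $\Delta$ act on it. $G$ is strongly transitive if it acts transitively on the set of pairs $(C,F)$ where $F$ is an apartment of $\Delta$ and $C$ is a chamber contained in $F$. One has $B\cap N=\{g\in G: g\text{ acts on }F_0\text{ by translations}\}$. $\Gamma$ is regarded as a discrete group; I.C.C. means that every nonidentity element has an infinite conjugacy class. $VN(\Gamma)$ is the group von Neumann algebra generated by the left regular representation of $\Gamma$ on $\ell^2(\Gamma)$ (a type $\mathrm{II}_1$ factor when $\Gamma$ is I.C.C.); $VN(\Gamma_0)$ is identified with the von Neumann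 subalgebra generated by $\Gamma_0$. A masa is a maximal abelian self-adjoint subalgebra. For a type $\mathrm{II}_1$ factor $\mathcal{M}$ with faithful normal tracial state $tr$, put $\|x\|_2=(tr(x^*x))^{1/2}$, and for a linear map $\phi:\mathcal{M}\to\mathcal{M}$ put $\|\phi\|_{\infty,2}=\sup\{\|\phi(x)\|_2:\|x\|\le1\}$. For a von Neumann subalgebra $\mathcal{N}\subseteq\mathcal{M}$, $\mathbb{E}_{\mathcal{N}}$ is the unique trace preserving conditional expectation onto $\mathcal{N}$. A von Neumann subalgebra $\mathcal{A}\subseteq\mathcal{M}$ is strongly singular if $\|\mathbb{E}_{\mathcal{A}}-\mathbb{E}_{u\mathcal{A}u^*}\|_{\infty,2}\ge\|(I-\mathbb{E}_{\mathcal{A}})(u)\|_2$ for all unitaries $u\in\mathcal{M}$. *)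

theory Defs
  imports "HOL-Analysis.Analysis" "HOL-Algebra.Bij"
begin

section \<open>Euclidean Coxeter complexes\<close>

definition hyperplane :: "'e::euclidean_space set \<Rightarrow> bool" where
  "hyperplane h \<longleftrightarrow> (\<exists>a b. a \<noteq> 0 \<and> h = {x. a \<bullet> x = b})"

definition reflection :: "'e::euclidean_space set \<Rightarrow> 'e \<Rightarrow> 'e" where
  "reflection h x = 2 *\<^sub>R closest_point h x - x"

definition same_side :: "'e::euclidean_space set \<Rightarrow> 'e \<Rightarrow> 'e \<Rightarrow> bool" where
  "same_side h x y \<longleftrightarrow> (x \<in> h \<and> y \<in> h) \<or> closed_segment x y \<inter> h = {}"

definition open_cell :: "'e::euclidean_space set set \<Rightarrow> 'e \<Rightarrow> 'e set" where
  "open_cell H x = {y. \<forall>h\<in>H. same_side h x y}"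

definition coxeter_cells :: "'e::euclidean_space set set \<Rightarrow> 'e set set" where
  "coxeter_cells H = {closure (open_cell H x) |x. True}"

text \<open>
  A Euclidean reflection group \<open>W\<close> is given by its set \<open>H\<close> of walls, a locally finite family of
  hyperplanes which is stable under the reflections in its members; \<open>W\<close> is generated by these
  reflections. Bounded chambers say that \<open>W\<close> is essential and that all its irreducible
  factors are infinite, so that \<open>coxeter_cells H\<close> is the Coxeter complex of \<open>W\<close>, realised as a
  tessellation of the whole Euclidean space. The cells are simplices if \<open>W\<close> is irreducible and
  products of simplices in general.
\<close>
definition euclidean_arrangement :: "'e::euclidean_space set set \<Rightarrow> bool" where
  "euclidean_arrangement H \<longleftrightarrow>
     (\<forall>h\<in>H. hyperplane h) \<and>
     (\<forall>x r. finite {h \<in> H. h \<inter> cball x r \<noteq> {}}) \<and>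
     (\<forall>h\<in>H. \<forall>k\<in>H. reflection h ` k \<in> H) \<and>
     (\<forall>x. x \<notin> \<Union>H \<longrightarrow> bounded (open_cell H x))"

definition special_vertex :: "'e::euclidean_space set set \<Rightarrow> 'e \<Rightarrow> bool" where
  "special_vertex H x \<longleftrightarrow>
     {x} \<in> coxeter_cells H \<and> (\<forall>h\<in>H. \<exists>k\<in>H. x \<in> k \<and> (\<exists>t. k = (+) t ` h))"

definition model_sector :: "'e::euclidean_space set set \<Rightarrow> 'e set \<Rightarrow> bool" where
  "model_sector H K \<longleftrightarrow>
     (\<exists>x y. special_vertex H x \<and> (\<forall>h\<in>H. x \<in> h \<longrightarrow> y \<notin> h) \<and>
            K = closure (open_cell {h \<in> H. x \<in> h} y))"

section \<open>Euclidean buildings\<close>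

text \<open>
  A building is represented by its geometric realisation \<open>points\<close> with the canonical metric
  \<open>bdist\<close>. Simplices are closed cells, that is subsets of \<open>points\<close>, and apartments are
  subcomplexes, also given as subsets of \<open>points\<close>. The component \<open>walls\<close> is the model: the set of
  walls in the Euclidean space of the Coxeter group of the building.
\<close>
record ('p, 'n::finite) building =
  points :: "'p set"
  bdist :: "'p \<Rightarrow> 'p \<Rightarrow> real"
  cells :: "'p set set"
  apartments :: "'p set set"
  walls :: "(real ^ 'n) set set"

definition chart :: "('p, 'n::finite) building \<Rightarrow> 'p set \<Rightarrow> (real ^ 'n \<Rightarrow> 'p) \<Rightarrow> bool" where
  "chart \<Delta> F \<phi> \<longleftrightarrow>
     \<phi> ` UNIV = F \<and> (\<forall>x y. bdist \<Delta> (\<phi> x) (\<phi> y) = dist x y) \<and>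
     {A \<in> cells \<Delta>. A \<subseteq> F} = (`) \<phi> ` coxeter_cells (walls \<Delta>)"

definition apartment_iso :: "('p, 'n::finite) building \<Rightarrow> 'p set \<Rightarrow> 'p set \<Rightarrow> ('p \<Rightarrow> 'p) \<Rightarrow> bool" where
  "apartment_iso \<Delta> F F' \<psi> \<longleftrightarrow>
     bij_betw \<psi> F F' \<and> (\<forall>x\<in>F. \<forall>y\<in>F. bdist \<Delta> (\<psi> x) (\<psi> y) = bdist \<Delta> x y) \<and>
     (`) \<psi> ` {A \<in> cells \<Delta>. A \<subseteq> F} = {A \<in> cells \<Delta>. A \<subseteq> F'}"

text \<open>
  The usual building axioms. The set of apartments is part of the data and is not required to be
  the complete system of apartments. Thickness is not required.
\<close>
definition euclidean_building :: "('p, 'n::finite) building \<Rightarrow> bool" where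
  "euclidean_building \<Delta> \<longleftrightarrow>
     euclidean_arrangement (walls \<Delta>) \<and>
     Metric_space (points \<Delta>) (bdist \<Delta>) \<and>
     apartments \<Delta> \<noteq> {} \<and>
     points \<Delta> = \<Union>(apartments \<Delta>) \<and>
     (\<forall>F\<in>apartments \<Delta>. \<exists>\<phi>. chart \<Delta> F \<phi>) \<and>
     (\<forall>A\<in>cells \<Delta>. \<forall>B\<in>cells \<Delta>. \<exists>F\<in>apartments \<Delta>. A \<union> B \<subseteq> F) \<and>
     (\<forall>F\<in>apartments \<Delta>. \<forall>F'\<in>apartments \<Delta>. \<forall>A\<in>cells \<Delta>. \<forall>B\<in>cells \<Delta>.
        A \<union> B \<subseteq> F \<inter> F' \<longrightarrow> (\<exists>\<psi>. apartment_iso \<Delta> F F' \<psi> \<and> (\<forall>x\<in>A \<union> B. \<psi> x = x)))"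

definition vertices :: "('p, 'n::finite) building \<Rightarrow> 'p set" where
  "vertices \<Delta> = {v. {v} \<in> cells \<Delta>}"

definition chambers :: "('p, 'n::finite) building \<Rightarrow> 'p set set" where
  "chambers \<Delta> = {C \<in> cells \<Delta>. \<forall>D\<in>cells \<Delta>. C \<subseteq> D \<longrightarrow> D = C}"

text \<open>
  A type function: bijective from the vertices of each chamber onto a fixed set of types \<open>I\<close>. The
  condition on the set \<open>K\<close> of types of faces is automatic when the cells are simplices.
\<close>
definition labelling :: "('p, 'n::finite) building \<Rightarrow> ('p \<Rightarrow> nat) \<Rightarrow> bool" where
  "labelling \<Delta> \<tau> \<longleftrightarrow>
     (\<exists>I K. \<forall>C\<in>chambers \<Delta>.
        bij_betw \<tau> (vertices \<Delta> \<inter> C) I \<and>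
        {\<tau> ` (vertices \<Delta> \<inter> A) |A. A \<in> cells \<Delta> \<and> A \<subseteq> C} = K)"

text \<open>
  The group of automorphisms, acting on the geometric realisation. Being an isometry is no
  restriction on type-preserving simplicial automorphisms: these carry chambers isometrically onto
  chambers, and hence preserve the canonical metric.
\<close>
definition Aut :: "('p, 'n::finite) building \<Rightarrow> ('p \<Rightarrow> 'p) monoid" where
  "Aut \<Delta> = BijGroup (points \<Delta>)
     \<lparr>carrier := {g \<in> Bij (points \<Delta>).
        (\<forall>x\<in>points \<Delta>. \<forall>y\<in>points \<Delta>. bdist \<Delta> (g x) (g y) = bdist \<Delta> x y) \<and>
        (`) g ` cells \<Delta> = cells \<Delta>}\<rparr>"

definition type_preserving :: "('p, 'n::finite) building \<Rightarrow> ('p \<Rightarrow> 'p) set \<Rightarrow> bool" where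
  "type_preserving \<Delta> G \<longleftrightarrow> (\<exists>\<tau>. labelling \<Delta> \<tau> \<and> (\<forall>g\<in>G. \<forall>v\<in>vertices \<Delta>. \<tau> (g v) = \<tau> v))"

text \<open>The first conjunct says that \<open>G\<close> acts on the set of apartments.\<close>
definition strongly_transitive :: "('p, 'n::finite) building \<Rightarrow> ('p \<Rightarrow> 'p) set \<Rightarrow> bool" where
  "strongly_transitive \<Delta> G \<longleftrightarrow>
     (\<forall>g\<in>G. \<forall>F\<in>apartments \<Delta>. g ` F \<in> apartments \<Delta>) \<and>
     (\<forall>F\<in>apartments \<Delta>. \<forall>F'\<in>apartments \<Delta>. \<forall>C\<in>chambers \<Delta>. \<forall>C'\<in>chambers \<Delta>.
        C \<subseteq> F \<longrightarrow> C' \<subseteq> F' \<longrightarrow> (\<exists>g\<in>G. g ` C = C' \<and> g ` F = F'))"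

definition sector_in :: "('p, 'n::finite) building \<Rightarrow> 'p set \<Rightarrow> 'p set \<Rightarrow> bool" where
  "sector_in \<Delta> F S \<longleftrightarrow> (\<exists>\<phi> K. chart \<Delta> F \<phi> \<and> model_sector (walls \<Delta>) K \<and> S = \<phi> ` K)"

definition sectors :: "('p, 'n::finite) building \<Rightarrow> 'p set set" where
  "sectors \<Delta> = {S. \<exists>F\<in>apartments \<Delta>. sector_in \<Delta> F S}"

definition hausdorff_distance :: "('p, 'n::finite) building \<Rightarrow> 'p set \<Rightarrow> 'p set \<Rightarrow> ennreal" where
  "hausdorff_distance \<Delta> S T =
     max (SUP x\<in>S. INF y\<in>T. ennreal (bdist \<Delta> x y)) (SUP y\<in>T. INF x\<in>S. ennreal (bdist \<Delta> x y))"

definition boundary_point :: "('p, 'n::finite) building \<Rightarrow> 'p set \<Rightarrow> 'p set set" where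
  "boundary_point \<Delta> S = {T \<in> sectors \<Delta>. hausdorff_distance \<Delta> S T < \<infinity>}"

definition boundary_act :: "('p \<Rightarrow> 'p) \<Rightarrow> 'p set set \<Rightarrow> 'p set set" where
  "boundary_act g \<omega> = (`) g ` \<omega>"

definition icc :: "('g, 'b) monoid_scheme \<Rightarrow> bool" where
  "icc G \<longleftrightarrow> (\<forall>g\<in>carrier G. g \<noteq> \<one>\<^bsub>G\<^esub> \<longrightarrow>
     infinite {h \<otimes>\<^bsub>G\<^esub> g \<otimes>\<^bsub>G\<^esub> inv\<^bsub>G\<^esub> h |h. h \<in> carrier G})"

section \<open>Bounded operators on a complex \<open>\<ell>\<^sup>2\<close> space\<close>

text \<open>
  Elements of \<open>l2 I\<close> vanish outside the index set \<open>I\<close>, and operators on \<open>l2 I\<close> are extensional, so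
  that equality in HOL is equality of vectors and of operators.
\<close>
definition l2 :: "'a set \<Rightarrow> ('a \<Rightarrow> complex) set" where
  "l2 I = {f. (\<forall>x. x \<notin> I \<longrightarrow> f x = 0) \<and> (\<lambda>x. (cmod (f x))\<^sup>2) summable_on I}"

definition l2_inner :: "'a set \<Rightarrow> ('a \<Rightarrow> complex) \<Rightarrow> ('a \<Rightarrow> complex) \<Rightarrow> complex" where
  "l2_inner I f g = (\<Sum>\<^sub>\<infinity>x\<in>I. f x * cnj (g x))"

definition l2_norm :: "'a set \<Rightarrow> ('a \<Rightarrow> complex) \<Rightarrow> real" where
  "l2_norm I f = sqrt (\<Sum>\<^sub>\<infinity>x\<in>I. (cmod (f x))\<^sup>2)"

type_synonym 'a l2op = "('a \<Rightarrow> complex) \<Rightarrow> ('a \<Rightarrow> complex)"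

definition bounded_ops :: "'a set \<Rightarrow> 'a l2op set" where
  "bounded_ops I = {T \<in> l2 I \<rightarrow>\<^sub>E l2 I.
     (\<forall>f\<in>l2 I. \<forall>g\<in>l2 I. T (\<lambda>x. f x + g x) = (\<lambda>x. T f x + T g x)) \<and>
     (\<forall>c. \<forall>f\<in>l2 I. T (\<lambda>x. c * f x) = (\<lambda>x. c * T f x)) \<and>
     (\<exists>K. \<forall>f\<in>l2 I. l2_norm I (T f) \<le> K * l2_norm I f)}"

definition op_norm :: "'a set \<Rightarrow> 'a l2op \<Rightarrow> real" where
  "op_norm I T = (SUP f\<in>{f \<in> l2 I. l2_norm I f \<le> 1}. l2_norm I (T f))"

definition op_add :: "'a set \<Rightarrow> 'a l2op \<Rightarrow> 'a l2op \<Rightarrow> 'a l2op" where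
  "op_add I S T = (\<lambda>f\<in>l2 I. \<lambda>x. S f x + T f x)"

definition op_diff :: "'a set \<Rightarrow> 'a l2op \<Rightarrow> 'a l2op \<Rightarrow> 'a l2op" where
  "op_diff I S T = (\<lambda>f\<in>l2 I. \<lambda>x. S f x - T f x)"

definition op_scale :: "'a set \<Rightarrow> complex \<Rightarrow> 'a l2op \<Rightarrow> 'a l2op" where
  "op_scale I c T = (\<lambda>f\<in>l2 I. \<lambda>x. c * T f x)"

abbreviation op_mult :: "'a set \<Rightarrow> 'a l2op \<Rightarrow> 'a l2op \<Rightarrow> 'a l2op" where
  "op_mult I \<equiv> compose (l2 I)"

definition op_id :: "'a set \<Rightarrow> 'a l2op" where
  "op_id I = (\<lambda>f\<in>l2 I. f)"

definition op_adj :: "'a set \<Rightarrow> 'a l2op \<Rightarrow> 'a l2op" where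
  "op_adj I T =
     (THE S. S \<in> bounded_ops I \<and> (\<forall>f\<in>l2 I. \<forall>g\<in>l2 I. l2_inner I (T f) g = l2_inner I f (S g)))"

definition positive_op :: "'a set \<Rightarrow> 'a l2op \<Rightarrow> bool" where
  "positive_op I T \<longleftrightarrow>
     T \<in> bounded_ops I \<and> (\<forall>f\<in>l2 I. l2_inner I (T f) f \<in> \<real> \<and> 0 \<le> Re (l2_inner I (T f) f))"

definition unitary_op :: "'a set \<Rightarrow> 'a l2op \<Rightarrow> bool" where
  "unitary_op I u \<longleftrightarrow>
     u \<in> bounded_ops I \<and> op_mult I (op_adj I u) u = op_id I \<and> op_mult I u (op_adj I u) = op_id I"

section \<open>Von Neumann algebras\<close>

definition commutant :: "'a set \<Rightarrow> 'a l2op set \<Rightarrow> 'a l2op set" where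
  "commutant I M = {T \<in> bounded_ops I. \<forall>S\<in>M. op_mult I T S = op_mult I S T}"

definition von_neumann_algebra :: "'a set \<Rightarrow> 'a l2op set \<Rightarrow> bool" where
  "von_neumann_algebra I M \<longleftrightarrow>
     M \<subseteq> bounded_ops I \<and> (\<forall>T\<in>M. op_adj I T \<in> M) \<and> commutant I (commutant I M) = M"

definition vN_generated :: "'a set \<Rightarrow> 'a l2op set \<Rightarrow> 'a l2op set" where
  "vN_generated I S = \<Inter>{M. von_neumann_algebra I M \<and> S \<subseteq> M}"

definition left_regular :: "('g, 'b) monoid_scheme \<Rightarrow> 'g \<Rightarrow> 'g l2op" where
  "left_regular G g =
     (\<lambda>f\<in>l2 (carrier G). \<lambda>h. if h \<in> carrier G then f (inv\<^bsub>G\<^esub> g \<otimes>\<^bsub>G\<^esub> h) else 0)"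

text \<open>
  For a subgroup \<open>K\<close> of \<open>G\<close>, the group von Neumann algebra of \<open>K\<close> as a subalgebra of that of \<open>G\<close>,
  acting on \<open>l2 (carrier G)\<close>. The group von Neumann algebra of \<open>G\<close> itself is the case
  \<open>K = carrier G\<close>.
\<close>
definition VN :: "('g, 'b) monoid_scheme \<Rightarrow> 'g set \<Rightarrow> 'g l2op set" where
  "VN G K = vN_generated (carrier G) (left_regular G ` K)"

definition delta :: "'a \<Rightarrow> 'a \<Rightarrow> complex" where
  "delta a = (\<lambda>x. if x = a then 1 else 0)"

text \<open>
  The canonical faithful normal tracial state of a group von Neumann algebra; it is the only one
  when the algebra is a factor of type \<open>II\<^sub>1\<close>.
\<close>
definition group_trace :: "('g, 'b) monoid_scheme \<Rightarrow> 'g l2op \<Rightarrow> complex" where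
  "group_trace G T = l2_inner (carrier G) (T (delta \<one>\<^bsub>G\<^esub>)) (delta \<one>\<^bsub>G\<^esub>)"

definition star_subalgebra :: "'a set \<Rightarrow> 'a l2op set \<Rightarrow> bool" where
  "star_subalgebra I A \<longleftrightarrow>
     A \<noteq> {} \<and> A \<subseteq> bounded_ops I \<and>
     (\<forall>S\<in>A. \<forall>T\<in>A. op_add I S T \<in> A \<and> op_mult I S T \<in> A) \<and>
     (\<forall>T\<in>A. \<forall>c. op_scale I c T \<in> A) \<and>
     (\<forall>T\<in>A. op_adj I T \<in> A)"

definition abelian_ops :: "'a set \<Rightarrow> 'a l2op set \<Rightarrow> bool" where
  "abelian_ops I A \<longleftrightarrow> (\<forall>S\<in>A. \<forall>T\<in>A. op_mult I S T = op_mult I T S)"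

definition masa :: "'a set \<Rightarrow> 'a l2op set \<Rightarrow> 'a l2op set \<Rightarrow> bool" where
  "masa I M A \<longleftrightarrow>
     star_subalgebra I A \<and> abelian_ops I A \<and> A \<subseteq> M \<and>
     (\<forall>A'. star_subalgebra I A' \<and> abelian_ops I A' \<and> A' \<subseteq> M \<and> A \<subseteq> A' \<longrightarrow> A' = A)"

definition norm2 :: "'a set \<Rightarrow> ('a l2op \<Rightarrow> complex) \<Rightarrow> 'a l2op \<Rightarrow> real" where
  "norm2 I tr T = sqrt (Re (tr (op_mult I (op_adj I T) T)))"

definition norm_inf_2 ::
  "'a set \<Rightarrow> 'a l2op set \<Rightarrow> ('a l2op \<Rightarrow> complex) \<Rightarrow> ('a l2op \<Rightarrow> 'a l2op) \<Rightarrow> ereal" where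
  "norm_inf_2 I M tr \<phi> = (SUP T\<in>{T \<in> M. op_norm I T \<le> 1}. ereal (norm2 I tr (\<phi> T)))"

definition trace_preserving_expectation ::
  "'a set \<Rightarrow> 'a l2op set \<Rightarrow> ('a l2op \<Rightarrow> complex) \<Rightarrow> 'a l2op set \<Rightarrow> ('a l2op \<Rightarrow> 'a l2op) \<Rightarrow> bool" where
  "trace_preserving_expectation I M tr N E \<longleftrightarrow>
     E \<in> M \<rightarrow>\<^sub>E N \<and>
     (\<forall>S\<in>M. \<forall>T\<in>M. E (op_add I S T) = op_add I (E S) (E T)) \<and>
     (\<forall>c. \<forall>T\<in>M. E (op_scale I c T) = op_scale I c (E T)) \<and>
     (\<forall>T\<in>M. positive_op I T \<longrightarrow> positive_op I (E T)) \<and>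
     (\<forall>T\<in>N. E T = T) \<and>
     (\<forall>R\<in>N. \<forall>S\<in>N. \<forall>T\<in>M. E (op_mult I R (op_mult I T S)) = op_mult I R (op_mult I (E T) S)) \<and>
     (\<forall>T\<in>M. tr (E T) = tr T)"

definition cond_expectation ::
  "'a set \<Rightarrow> 'a l2op set \<Rightarrow> ('a l2op \<Rightarrow> complex) \<Rightarrow> 'a l2op set \<Rightarrow> 'a l2op \<Rightarrow> 'a l2op" where
  "cond_expectation I M tr N = (THE E. trace_preserving_expectation I M tr N E)"

definition conjugate_ops :: "'a set \<Rightarrow> 'a l2op \<Rightarrow> 'a l2op set \<Rightarrow> 'a l2op set" where
  "conjugate_ops I u A = (\<lambda>a. op_mult I u (op_mult I a (op_adj I u))) ` A"

definition strongly_singular ::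
  "'a set \<Rightarrow> 'a l2op set \<Rightarrow> ('a l2op \<Rightarrow> complex) \<Rightarrow> 'a l2op set \<Rightarrow> bool" where
  "strongly_singular I M tr A \<longleftrightarrow>
     von_neumann_algebra I A \<and> A \<subseteq> M \<and>
     (\<forall>u\<in>M. unitary_op I u \<longrightarrow>
        norm_inf_2 I M tr
          (\<lambda>x. op_diff I (cond_expectation I M tr A x)
                          (cond_expectation I M tr (conjugate_ops I u A) x))
        \<ge> ereal (norm2 I tr (op_diff I u (cond_expectation I M tr A u))))"

end

theory Submission
  imports Defs "HOL-Algebra.Coset"
begin

text \<open>
  Write \<open>A = VN \<Gamma>\<^sub>0\<close> and \<open>M = VN \<Gamma>\<close>. The theorem is reduced to a combinatorial criterion, and the
  criterion is proved geometrically.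

  The criterion says that for every finite set \<open>X \<subseteq> \<Gamma> - \<Gamma>\<^sub>0\<close> some \<open>k \<in> \<Gamma>\<^sub>0\<close> satisfies \<open>x k y \<notin> \<Gamma>\<^sub>0\<close> for
  all \<open>x, y \<in> X\<close>. Operators in \<open>VN K\<close> are left convolutions by functions supported on \<open>K\<close>
  (\<open>VN_iff\<close>), and the conditional expectation \<open>E\<close> onto \<open>A\<close> cuts off the coefficients outside
  \<open>\<Gamma>\<^sub>0\<close>. For a unitary \<open>u\<close> in \<open>M\<close>, the left translation by \<open>k \<in> \<Gamma>\<^sub>0\<close> is fixed by \<open>E\<close>, and its
  distance to its expectation onto \<open>u A u\<^sup>*\<close> is the distance of \<open>w = u\<^sup>* k u\<close> to \<open>E w\<close>. Both \<open>u\<close> and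
  \<open>w\<close> have norm \<open>1\<close> in \<open>\<parallel>\<cdot>\<parallel>\<^sub>2\<close>, so strong singularity amounts to making \<open>\<parallel>E w\<parallel>\<^sub>2\<close> at most \<open>\<parallel>E u\<parallel>\<^sub>2\<close> up to a small
  error. The coefficients of \<open>u\<close> and \<open>u\<^sup>*\<close> are nearly supported on finite sets, so the criterion
  provides a \<open>k\<close> for which the part of \<open>u\<close> off \<open>\<Gamma>\<^sub>0\<close> contributes little to \<open>E w\<close>
  (\<open>translation_asymptotics\<close>). The criterion also shows that the \<open>\<Gamma>\<^sub>0\<close>-conjugacy
  classes off \<open>\<Gamma>\<^sub>0\<close> are infinite, so that operators in \<open>M\<close> commuting with \<open>A\<close> lie in \<open>A\<close>
  (\<open>relative_commutant_VN\<close>).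

  For the criterion (\<open>separating_element\<close>), note that \<open>x k y\<close> preserves \<open>F\<^sub>0\<close> only if \<open>k\<close> maps \<open>y F\<^sub>0\<close>
  to \<open>x\<^sup>-\<^sup>1 F\<^sub>0\<close>. An element of \<open>\<Gamma>\<close> fixes the boundary point, so it moves \<open>S\<^sub>0\<close> to a sector at
  finite Hausdorff distance; hence every \<open>x\<^sup>-\<^sup>1 F\<^sub>0\<close> contains all points deep inside \<open>S\<^sub>0\<close>
  (\<open>centre_in_close_apartment\<close>). For \<open>y \<notin> \<Gamma>\<^sub>0\<close> the apartment \<open>y F\<^sub>0\<close> misses a point of \<open>F\<^sub>0\<close>. As \<open>\<Gamma>\<^sub>0\<close> is
  cocompact on \<open>F\<^sub>0\<close>, some \<open>k\<close> carries these finitely many points into the deep part of \<open>S\<^sub>0\<close>, and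
  then \<open>k y F\<^sub>0 = x\<^sup>-\<^sup>1 F\<^sub>0\<close> is impossible.

  That an apartment \<open>F'\<close> staying close to a large ball of an apartment \<open>F\<close> contains its centre \<open>p\<close> is a
  topological fact. The retraction of the building onto \<open>F\<close> centred at a chamber around \<open>p\<close> does not increase
  distances and preserves the distance to \<open>p\<close>. Composed with a continuous map from the ball to \<open>F'\<close> that
  moves points by a bounded amount, it has \<open>p\<close> in its image by Brouwer's theorem; a point of \<open>F'\<close> that is
  retracted to \<open>p\<close> has distance \<open>0\<close> to \<open>p\<close>.
\<close>

section \<open>The Hilbert space of square summable functions\<close>

definition cutoff :: "'a set \<Rightarrow> ('a \<Rightarrow> complex) \<Rightarrow> 'a \<Rightarrow> complex" where
  "cutoff A f = (\<lambda>x. if x \<in> A then f x else 0)"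

lemma l2_bounded_sums:
  assumes "\<And>x. x \<notin> I \<Longrightarrow> f x = 0"
    and "\<And>F. finite F \<Longrightarrow> F \<subseteq> I \<Longrightarrow> (\<Sum>x\<in>F. (cmod (f x))\<^sup>2) \<le> C\<^sup>2" and "0 \<le> C"
  shows "f \<in> l2 I" "l2_norm I f \<le> C"
proof -
  have s: "(\<lambda>x. (cmod (f x))\<^sup>2) summable_on I"
    by (rule nonneg_bdd_above_summable_on) (use assms(2) in \<open>auto simp: bdd_above_def\<close>)
  then show "f \<in> l2 I"
    using assms(1) by (simp add: l2_def)
  have "(\<Sum>\<^sub>\<infinity>x\<in>I. (cmod (f x))\<^sup>2) \<le> C\<^sup>2"
    by (rule infsum_le_finite_sums[OF s]) (use assms(2) in auto)
  then show "l2_norm I f \<le> C"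
    unfolding l2_norm_def using assms(3) by (intro real_le_lsqrt) auto
qed

lemma l2_outside: "f \<in> l2 I \<Longrightarrow> x \<notin> I \<Longrightarrow> f x = 0"
  by (simp add: l2_def)

lemma l2_norm_nonneg [simp]: "0 \<le> l2_norm I f"
  by (simp add: l2_norm_def infsum_nonneg)

lemma l2_norm_square: "(l2_norm I f)\<^sup>2 = (\<Sum>\<^sub>\<infinity>x\<in>I. (cmod (f x))\<^sup>2)"
  by (simp add: l2_norm_def infsum_nonneg)

lemma l2_norm_square_has_sum:
  "f \<in> l2 I \<Longrightarrow> ((\<lambda>x. (cmod (f x))\<^sup>2) has_sum (l2_norm I f)\<^sup>2) I"
  by (simp add: l2_norm_square l2_def)

lemma sum_le_l2_norm:
  assumes "f \<in> l2 I" "finite F" "F \<subseteq> I"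
  shows "(\<Sum>x\<in>F. (cmod (f x))\<^sup>2) \<le> (l2_norm I f)\<^sup>2"
  unfolding l2_norm_square
  by (rule finite_sum_le_infsum) (use assms in \<open>auto simp: l2_def\<close>)

lemma L2_set_le_l2_norm:
  assumes "f \<in> l2 I" "finite F" "F \<subseteq> I"
  shows "L2_set (\<lambda>x. cmod (f x)) F \<le> l2_norm I f"
  unfolding L2_set_def using sum_le_l2_norm[OF assms] by (simp add: real_le_lsqrt sum_nonneg)

lemma cmod_le_l2_norm:
  assumes "f \<in> l2 I"
  shows "cmod (f x) \<le> l2_norm I f"
proof (cases "x \<in> I")
  case True
  then show ?thesis
    using L2_set_le_l2_norm[OF assms, of "{x}"] by (simp add: L2_set_def)
qed (simp add: l2_outside[OF assms])

lemma l2_dominated: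
  assumes "g \<in> l2 I" "\<And>x. x \<notin> I \<Longrightarrow> f x = 0" "\<And>x. x \<in> I \<Longrightarrow> cmod (f x) \<le> cmod (g x)"
  shows "f \<in> l2 I" "l2_norm I f \<le> l2_norm I g"
proof -
  have "(\<Sum>x\<in>F. (cmod (f x))\<^sup>2) \<le> (l2_norm I g)\<^sup>2" if "finite F" "F \<subseteq> I" for F
    by (rule order_trans[OF sum_mono sum_le_l2_norm[OF assms(1) that]])
      (use assms(3) that in \<open>auto intro!: power_mono\<close>)
  then show "f \<in> l2 I" "l2_norm I f \<le> l2_norm I g"
    using l2_bounded_sums[of I f "l2_norm I g"] assms(2) by auto
qed

lemma l2_cutoff [simp]: "f \<in> l2 I \<Longrightarrow> cutoff A f \<in> l2 I"
  by (rule l2_dominated(1)[of f]) (auto simp: cutoff_def l2_outside)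

lemma l2_norm_cutoff: "f \<in> l2 I \<Longrightarrow> l2_norm I (cutoff A f) \<le> l2_norm I f"
  by (rule l2_dominated(2)[of f]) (auto simp: cutoff_def l2_outside)

lemma l2_finite_support:
  assumes "finite F" "F \<subseteq> I" "\<And>x. x \<notin> F \<Longrightarrow> f x = 0"
  shows "f \<in> l2 I" "(l2_norm I f)\<^sup>2 = (\<Sum>x\<in>F. (cmod (f x))\<^sup>2)"
proof -
  have h: "((\<lambda>x. (cmod (f x))\<^sup>2) has_sum (\<Sum>x\<in>F. (cmod (f x))\<^sup>2)) I"
    by (rule has_sum_finite_neutralI) (use assms in auto)
  then show "f \<in> l2 I"
    using assms(2,3) by (auto simp: l2_def summable_on_def)
  show "(l2_norm I f)\<^sup>2 = (\<Sum>x\<in>F. (cmod (f x))\<^sup>2)"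
    unfolding l2_norm_square using h by (rule infsumI)
qed

lemma l2_delta [simp]: "a \<in> I \<Longrightarrow> delta a \<in> l2 I"
  by (rule l2_finite_support[of "{a}"]) (auto simp: delta_def)

lemma l2_norm_delta [simp]: "a \<in> I \<Longrightarrow> l2_norm I (delta a) = 1"
proof -
  assume "a \<in> I"
  then have "(l2_norm I (delta a))\<^sup>2 = 1"
    using l2_finite_support(2)[of "{a}" I "delta a"] by (auto simp: delta_def)
  then show ?thesis
    using l2_norm_nonneg[of I "delta a"] by (auto simp: power2_eq_1_iff simp del: l2_norm_nonneg)
qed

text \<open>Both facts follow from Minkowski's inequality for finite sums, applied to all finite
  partial sums.\<close>
lemma
  assumes f: "f \<in> l2 I" and g: "g \<in> l2 I"
  shows l2_add: "(\<lambda>x. f x + g x) \<in> l2 I"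
    and l2_norm_triangle: "l2_norm I (\<lambda>x. f x + g x) \<le> l2_norm I f + l2_norm I g"
proof -
  have "(\<Sum>x\<in>F. (cmod (f x + g x))\<^sup>2) \<le> (l2_norm I f + l2_norm I g)\<^sup>2"
    if F: "finite F" "F \<subseteq> I" for F
  proof -
    have "L2_set (\<lambda>x. cmod (f x + g x)) F \<le> L2_set (\<lambda>x. cmod (f x) + cmod (g x)) F"
      by (rule L2_set_mono) (auto simp: norm_triangle_ineq)
    also have "\<dots> \<le> L2_set (\<lambda>x. cmod (f x)) F + L2_set (\<lambda>x. cmod (g x)) F"
      by (rule L2_set_triangle_ineq)
    also have "\<dots> \<le> l2_norm I f + l2_norm I g"
      using L2_set_le_l2_norm[OF f F] L2_set_le_l2_norm[OF g F] by simp
    finally show ?thesis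
      unfolding L2_set_def by (simp add: sqrt_le_D)
  qed
  then show "(\<lambda>x. f x + g x) \<in> l2 I" "l2_norm I (\<lambda>x. f x + g x) \<le> l2_norm I f + l2_norm I g"
    using l2_bounded_sums[of I "\<lambda>x. f x + g x" "l2_norm I f + l2_norm I g"] l2_outside[OF f] l2_outside[OF g]
    by auto
qed

lemma
  assumes f: "f \<in> l2 I"
  shows l2_scale: "(\<lambda>x. c * f x) \<in> l2 I"
    and l2_norm_scale: "l2_norm I (\<lambda>x. c * f x) = cmod c * l2_norm I f"
proof -
  show "(\<lambda>x. c * f x) \<in> l2 I"
    using f by (auto simp: l2_def norm_mult power_mult_distrib intro!: summable_on_cmult_right)
  show "l2_norm I (\<lambda>x. c * f x) = cmod c * l2_norm I f"
    using f by (simp add: l2_norm_def l2_def norm_mult power_mult_distrib infsum_cmult_right real_sqrt_mult)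
qed

lemma l2_zero [simp]: "(\<lambda>_. 0) \<in> l2 I"
  by (simp add: l2_def)

lemma l2_norm_zero [simp]: "l2_norm I (\<lambda>_. 0) = 0"
  by (simp add: l2_norm_def)

lemma l2_diff: "f \<in> l2 I \<Longrightarrow> g \<in> l2 I \<Longrightarrow> (\<lambda>x. f x - g x) \<in> l2 I"
  using l2_add[of f I "\<lambda>x. - 1 * g x"] l2_scale[of g I "-1"] by simp

lemma l2_sum:
  "(\<And>i. i \<in> J \<Longrightarrow> f i \<in> l2 I) \<Longrightarrow> (\<lambda>x. \<Sum>i\<in>J. f i x) \<in> l2 I"
  by (induction J rule: infinite_finite_induct) (auto intro: l2_add)

lemma l2_norm_sum_le:
  assumes "\<And>i. i \<in> J \<Longrightarrow> f i \<in> l2 I"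
  shows "l2_norm I (\<lambda>x. \<Sum>i\<in>J. f i x) \<le> (\<Sum>i\<in>J. l2_norm I (f i))"
  using assms
proof (induction J rule: infinite_finite_induct)
  case (insert i J)
  then have "l2_norm I (\<lambda>x. f i x + (\<Sum>i\<in>J. f i x)) \<le> l2_norm I (f i) + l2_norm I (\<lambda>x. \<Sum>i\<in>J. f i x)"
    by (intro l2_norm_triangle l2_sum) auto
  then show ?case
    using insert by fastforce
qed simp_all

subsection \<open>The inner product\<close>

lemma
  assumes f: "f \<in> l2 I" and g: "g \<in> l2 I"
  shows l2_inner_abs_summable: "(\<lambda>x. norm (f x * cnj (g x))) summable_on I"
    and l2_Cauchy_Schwarz: "cmod (l2_inner I f g) \<le> l2_norm I f * l2_norm I g"
proof -
  have le: "(\<Sum>x\<in>F. cmod (f x * cnj (g x))) \<le> l2_norm I f * l2_norm I g"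
    if F: "finite F" "F \<subseteq> I" for F
  proof -
    have "(\<Sum>x\<in>F. cmod (f x * cnj (g x))) = (\<Sum>x\<in>F. \<bar>cmod (f x)\<bar> * \<bar>cmod (g x)\<bar>)"
      by (simp add: norm_mult)
    also have "\<dots> \<le> L2_set (\<lambda>x. cmod (f x)) F * L2_set (\<lambda>x. cmod (g x)) F"
      by (rule L2_set_mult_ineq)
    also have "\<dots> \<le> l2_norm I f * l2_norm I g"
      using L2_set_le_l2_norm[OF f F] L2_set_le_l2_norm[OF g F] by (simp add: mult_mono)
    finally show ?thesis .
  qed
  show s: "(\<lambda>x. norm (f x * cnj (g x))) summable_on I"
    by (rule nonneg_bdd_above_summable_on) (use le in \<open>auto simp: bdd_above_def\<close>)
  have "cmod (l2_inner I f g) \<le> (\<Sum>\<^sub>\<infinity>x\<in>I. cmod (f x * cnj (g x)))"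
    unfolding l2_inner_def by (rule norm_infsum_bound[OF s])
  also have "\<dots> \<le> l2_norm I f * l2_norm I g"
    by (rule infsum_le_finite_sums[OF s]) (use le in auto)
  finally show "cmod (l2_inner I f g) \<le> l2_norm I f * l2_norm I g" .
qed

lemma l2_inner_has_sum:
  "f \<in> l2 I \<Longrightarrow> g \<in> l2 I \<Longrightarrow> ((\<lambda>x. f x * cnj (g x)) has_sum l2_inner I f g) I"
  unfolding l2_inner_def by (simp add: abs_summable_summable l2_inner_abs_summable)

lemma l2_inner_commute: "l2_inner I f g = cnj (l2_inner I g f)"
proof -
  have "cnj (l2_inner I g f) = (\<Sum>\<^sub>\<infinity>x\<in>I. cnj (g x * cnj (f x)))"
    unfolding l2_inner_def by (rule infsum_cnj[symmetric])
  then show ?thesis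
    by (simp add: l2_inner_def mult.commute)
qed

lemma l2_inner_add_left:
  assumes "f \<in> l2 I" "g \<in> l2 I" "h \<in> l2 I"
  shows "l2_inner I (\<lambda>x. f x + g x) h = l2_inner I f h + l2_inner I g h"
  unfolding l2_inner_def
  by (subst infsum_add[symmetric])
    (use assms in \<open>auto simp: distrib_right abs_summable_summable l2_inner_abs_summable\<close>)

lemma l2_inner_scale_left: "l2_inner I (\<lambda>x. c * f x) h = c * l2_inner I f h"
  unfolding l2_inner_def mult.assoc by (rule infsum_cmult_right')

lemma l2_inner_add_right:
  assumes "f \<in> l2 I" "g \<in> l2 I" "h \<in> l2 I"
  shows "l2_inner I h (\<lambda>x. f x + g x) = l2_inner I h f + l2_inner I h g"
  unfolding l2_inner_commute[of I h "\<lambda>x. f x + g x"] l2_inner_commute[of I h f] l2_inner_commute[of I h g]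
  using assms by (simp add: l2_inner_add_left)

lemma l2_inner_scale_right: "l2_inner I h (\<lambda>x. c * f x) = cnj c * l2_inner I h f"
  unfolding l2_inner_commute[of I h "\<lambda>x. c * f x"] l2_inner_commute[of I h f]
  by (simp add: l2_inner_scale_left)

lemma l2_inner_self:
  assumes "f \<in> l2 I"
  shows "l2_inner I f f = of_real ((l2_norm I f)\<^sup>2)"
proof (rule has_sum_unique[OF l2_inner_has_sum[OF assms assms]])
  have "((\<lambda>x. of_real ((cmod (f x))\<^sup>2)) has_sum complex_of_real ((l2_norm I f)\<^sup>2)) I"
    by (rule has_sum_of_real) (rule l2_norm_square_has_sum[OF assms])
  then show "((\<lambda>x. f x * cnj (f x)) has_sum complex_of_real ((l2_norm I f)\<^sup>2)) I"
    by (simp add: complex_norm_square del: of_real_power)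
qed

lemma l2_inner_delta:
  assumes "a \<in> I"
  shows "l2_inner I f (delta a) = f a"
  unfolding l2_inner_def
  by (rule infsumI, rule has_sum_finite_neutralI[of "{a}"]) (use assms in \<open>auto simp: delta_def\<close>)

lemma l2_norm_cutoff_split:
  assumes "f \<in> l2 I"
  shows "(l2_norm I f)\<^sup>2 = (l2_norm I (cutoff A f))\<^sup>2 + (l2_norm I (\<lambda>x. f x - cutoff A f x))\<^sup>2"
proof -
  have "((\<lambda>x. (cmod (cutoff A f x))\<^sup>2 + (cmod (f x - cutoff A f x))\<^sup>2) has_sum
     (l2_norm I (cutoff A f))\<^sup>2 + (l2_norm I (\<lambda>x. f x - cutoff A f x))\<^sup>2) I"
    by (intro has_sum_add l2_norm_square_has_sum l2_cutoff l2_diff assms)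
  moreover have "(\<lambda>x. (cmod (cutoff A f x))\<^sup>2 + (cmod (f x - cutoff A f x))\<^sup>2) = (\<lambda>x. (cmod (f x))\<^sup>2)"
    by (auto simp: cutoff_def fun_eq_iff)
  ultimately show ?thesis
    using has_sum_unique[OF l2_norm_square_has_sum[OF assms]] by simp
qed

lemma l2_approx_finite:
  assumes "f \<in> l2 I" "0 < e"
  obtains F where "finite F" "F \<subseteq> I" "l2_norm I (\<lambda>x. f x - cutoff F f x) < e"
proof -
  obtain F where F: "finite F" "F \<subseteq> I" "dist (\<Sum>x\<in>F. (cmod (f x))\<^sup>2) ((l2_norm I f)\<^sup>2) \<le> e\<^sup>2 / 2"
    using has_sum_finite_approximation[OF l2_norm_square_has_sum[OF assms(1)], of "e\<^sup>2/2"] assms(2)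
    by auto
  have "(l2_norm I (cutoff F f))\<^sup>2 = (\<Sum>x\<in>F. (cmod (f x))\<^sup>2)"
    using l2_finite_support(2)[OF F(1,2), of "cutoff F f"] by (simp add: cutoff_def)
  then have "(l2_norm I (\<lambda>x. f x - cutoff F f x))\<^sup>2 \<le> e\<^sup>2 / 2"
    using l2_norm_cutoff_split[OF assms(1), of F] F(3) by (simp add: dist_real_def)
  also have "\<dots> < e\<^sup>2"
    using assms(2) by simp
  finally show thesis
    using that[OF F(1,2)] assms(2) by (simp add: power_less_imp_less_base)
qed

subsection \<open>The Riesz representation theorem\<close>

text \<open>The representing vector has to be \<open>v h = cnj (\<phi> (delta h))\<close>. Testing \<open>\<phi>\<close> on the truncations
  of \<open>v\<close> itself shows that \<open>v\<close> is square summable; both sides agree on finitely supported vectors,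
  which are dense.\<close>
lemma l2_Riesz:
  assumes add: "\<And>f g. f \<in> l2 I \<Longrightarrow> g \<in> l2 I \<Longrightarrow> \<phi> (\<lambda>x. f x + g x) = \<phi> f + \<phi> g"
    and scale: "\<And>c f. f \<in> l2 I \<Longrightarrow> \<phi> (\<lambda>x. c * f x) = c * \<phi> f"
    and bound: "\<And>f. f \<in> l2 I \<Longrightarrow> cmod (\<phi> f) \<le> C * l2_norm I f"
  defines "v \<equiv> (\<lambda>h. if h \<in> I then cnj (\<phi> (delta h)) else 0)"
  shows "v \<in> l2 I" "l2_norm I v \<le> \<bar>C\<bar>" "\<And>f. f \<in> l2 I \<Longrightarrow> \<phi> f = l2_inner I f v"
proof -
  have zero: "\<phi> (\<lambda>_. 0) = 0"
    using scale[of "\<lambda>_. 0" 0] by simp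
  have fin: "\<phi> (\<lambda>x. \<Sum>h\<in>F. c h * delta h x) = (\<Sum>h\<in>F. c h * \<phi> (delta h))"
    if "finite F" "F \<subseteq> I" for F c
    using that
  proof (induction F)
    case (insert a F)
    then have "(\<lambda>x. \<Sum>h\<in>F. c h * delta h x) \<in> l2 I" "(\<lambda>x. c a * delta a x) \<in> l2 I"
      by (auto intro!: l2_sum l2_scale)
    then show ?case
      using insert by (simp add: add scale)
  qed (simp add: zero)
  have cutoff_sum: "cutoff F f = (\<lambda>x. \<Sum>h\<in>F. f h * delta h x)" if "finite F" for F f
    using that by (auto simp: cutoff_def delta_def fun_eq_iff sum.delta if_distrib cong: if_cong)
  have le: "(\<Sum>x\<in>F. (cmod (v x))\<^sup>2) \<le> \<bar>C\<bar>\<^sup>2" if F: "finite F" "F \<subseteq> I" for F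
  proof -
    define s where "s = (\<Sum>x\<in>F. (cmod (v x))\<^sup>2)"
    have n: "cutoff F v \<in> l2 I" "(l2_norm I (cutoff F v))\<^sup>2 = s"
      using l2_finite_support[OF F, of "cutoff F v"] by (auto simp: cutoff_def s_def)
    have "\<phi> (cutoff F v) = (\<Sum>h\<in>F. v h * \<phi> (delta h))"
      using fin[OF F] cutoff_sum[OF F(1)] by simp
    also have "\<dots> = (\<Sum>h\<in>F. of_real ((cmod (v h))\<^sup>2))"
      by (rule sum.cong) (use F in \<open>auto simp: v_def complex_norm_square mult.commute simp del: of_real_power\<close>)
    finally have "\<phi> (cutoff F v) = of_real s"
      by (simp add: s_def)
    moreover have "0 \<le> s"
      by (simp add: s_def sum_nonneg)
    ultimately have "s \<le> C * l2_norm I (cutoff F v)"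
      using bound[OF n(1)] by simp
    also have "\<dots> \<le> \<bar>C\<bar> * l2_norm I (cutoff F v)"
      by (simp add: mult_right_mono)
    finally have "l2_norm I (cutoff F v) * l2_norm I (cutoff F v) \<le> \<bar>C\<bar> * l2_norm I (cutoff F v)"
      using n(2) by (simp add: power2_eq_square)
    then have "l2_norm I (cutoff F v) \<le> \<bar>C\<bar>"
      using l2_norm_nonneg[of I "cutoff F v"] by (auto simp: mult_le_cancel_right)
    then show ?thesis
      using n(2) power_mono[of "l2_norm I (cutoff F v)" "\<bar>C\<bar>" 2] by (simp add: s_def)
  qed
  show v: "v \<in> l2 I" "l2_norm I v \<le> \<bar>C\<bar>"
    using l2_bounded_sums[of I v "\<bar>C\<bar>"] le by (auto simp: v_def)
  show "\<phi> f = l2_inner I f v" if f: "f \<in> l2 I" for f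
  proof (rule ccontr)
    assume "\<phi> f \<noteq> l2_inner I f v"
    define e where "e = cmod (\<phi> f - l2_inner I f v)"
    define D where "D = \<bar>C\<bar> + l2_norm I v + 1"
    have "0 < e" "0 < D"
      using \<open>\<phi> f \<noteq> l2_inner I f v\<close> by (auto simp: e_def D_def add_nonneg_pos)
    then obtain F where F: "finite F" "F \<subseteq> I" "l2_norm I (\<lambda>x. f x - cutoff F f x) < e / D"
      using l2_approx_finite[OF f, of "e / D"] by auto
    define r where "r = (\<lambda>x. f x - cutoff F f x)"
    have r: "r \<in> l2 I"
      unfolding r_def by (intro l2_diff l2_cutoff f)
    have split: "f = (\<lambda>x. r x + cutoff F f x)"
      by (rule ext) (simp add: r_def)
    have "\<phi> (cutoff F f) = (\<Sum>h\<in>F. f h * \<phi> (delta h))"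
      using fin[OF F(1,2)] cutoff_sum[OF F(1)] by simp
    moreover have "l2_inner I (cutoff F f) v = (\<Sum>h\<in>F. f h * \<phi> (delta h))"
      unfolding l2_inner_def
      by (rule infsumI, rule has_sum_finite_neutralI[of F]) (use F in \<open>auto simp: cutoff_def v_def intro!: sum.cong\<close>)
    moreover have "\<phi> f = \<phi> r + \<phi> (cutoff F f)"
      by (subst split) (rule add[OF r l2_cutoff[OF f]])
    moreover have "l2_inner I f v = l2_inner I r v + l2_inner I (cutoff F f) v"
      by (subst split) (rule l2_inner_add_left[OF r l2_cutoff[OF f] v(1)])
    ultimately have "\<phi> f - l2_inner I f v = \<phi> r - l2_inner I r v"
      by simp
    then have "e \<le> cmod (\<phi> r) + cmod (l2_inner I r v)"
      unfolding e_def by (simp add: norm_triangle_ineq4)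
    also have "\<dots> \<le> C * l2_norm I r + l2_norm I r * l2_norm I v"
      using bound[OF r] l2_Cauchy_Schwarz[OF r v(1)] by simp
    also have "\<dots> \<le> D * l2_norm I r"
    proof -
      have "C * l2_norm I r \<le> \<bar>C\<bar> * l2_norm I r"
        by (simp add: mult_right_mono)
      then show ?thesis
        using mult_nonneg_nonneg[OF l2_norm_nonneg[of I r] l2_norm_nonneg[of I v]] l2_norm_nonneg[of I r]
        unfolding D_def distrib_right by (simp add: mult.commute del: l2_norm_nonneg)
    qed
    also have "\<dots> < e"
      using F(3) \<open>0 < D\<close> by (simp add: r_def field_simps)
    finally show False
      by simp
  qed
qed

section \<open>Bounded operators and adjoints\<close>

lemma bounded_opsI:
  assumes "\<And>f. f \<in> l2 I \<Longrightarrow> T f \<in> l2 I" "\<And>f. f \<notin> l2 I \<Longrightarrow> T f = undefined"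
    and "\<And>f g. f \<in> l2 I \<Longrightarrow> g \<in> l2 I \<Longrightarrow> T (\<lambda>x. f x + g x) = (\<lambda>x. T f x + T g x)"
    and "\<And>c f. f \<in> l2 I \<Longrightarrow> T (\<lambda>x. c * f x) = (\<lambda>x. c * T f x)"
    and "\<And>f. f \<in> l2 I \<Longrightarrow> l2_norm I (T f) \<le> C * l2_norm I f"
  shows "T \<in> bounded_ops I"
proof -
  have "\<exists>C. \<forall>f\<in>l2 I. l2_norm I (T f) \<le> C * l2_norm I f"
    using assms(5) by blast
  then show ?thesis
    unfolding bounded_ops_def using assms(1-4) by (simp add: PiE_I)
qed

context
  fixes I :: "'a set" and T :: "'a l2op"
  assumes T: "T \<in> bounded_ops I"
begin

lemma bounded_op_closed: "f \<in> l2 I \<Longrightarrow> T f \<in> l2 I"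
  using T by (auto simp: bounded_ops_def)

lemma bounded_op_outside: "f \<in> l2 I \<Longrightarrow> x \<notin> I \<Longrightarrow> T f x = 0"
  by (rule l2_outside[OF bounded_op_closed])

lemma bounded_op_undefined: "f \<notin> l2 I \<Longrightarrow> T f = undefined"
  using T by (auto simp: bounded_ops_def)

lemma bounded_op_add: "f \<in> l2 I \<Longrightarrow> g \<in> l2 I \<Longrightarrow> T (\<lambda>x. f x + g x) = (\<lambda>x. T f x + T g x)"
  using T by (auto simp: bounded_ops_def)

lemma bounded_op_scale: "f \<in> l2 I \<Longrightarrow> T (\<lambda>x. c * f x) = (\<lambda>x. c * T f x)"
  using T by (auto simp: bounded_ops_def)

lemma bounded_op_zero: "T (\<lambda>_. 0) = (\<lambda>_. 0)"
  using bounded_op_scale[OF l2_zero, of 0] by simp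

lemma bounded_op_sum:
  assumes "\<And>i. i \<in> J \<Longrightarrow> f i \<in> l2 I"
  shows "T (\<lambda>x. \<Sum>i\<in>J. f i x) = (\<lambda>x. \<Sum>i\<in>J. T (f i) x)"
  using assms
  by (induction J rule: infinite_finite_induct) (simp_all add: bounded_op_zero bounded_op_add l2_sum)

lemma bounded_op_bound:
  obtains C where "0 \<le> C" "\<And>f. f \<in> l2 I \<Longrightarrow> l2_norm I (T f) \<le> C * l2_norm I f"
proof -
  obtain C where C: "\<forall>f\<in>l2 I. l2_norm I (T f) \<le> C * l2_norm I f"
    using T by (auto simp: bounded_ops_def)
  show thesis
  proof (rule that[of "\<bar>C\<bar>"])
    fix f assume "f \<in> l2 I"
    then have "l2_norm I (T f) \<le> C * l2_norm I f"
      using C by blast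
    also have "\<dots> \<le> \<bar>C\<bar> * l2_norm I f"
      by (simp add: mult_right_mono)
    finally show "l2_norm I (T f) \<le> \<bar>C\<bar> * l2_norm I f" .
  qed simp
qed

text \<open>Evaluation of \<open>T f\<close> at \<open>g\<close> is a bounded functional of \<open>f\<close>, so it is given by its Riesz
  vector. In other words, \<open>T\<close> acts as the matrix with entry \<open>T (delta h) g\<close> in row \<open>g\<close> and
  column \<open>h\<close>.\<close>
lemma bounded_op_matrix:
  assumes "f \<in> l2 I" "g \<in> I"
  shows "((\<lambda>h. f h * T (delta h) g) has_sum T f g) I"
proof -
  obtain C where C: "0 \<le> C" "\<And>f. f \<in> l2 I \<Longrightarrow> l2_norm I (T f) \<le> C * l2_norm I f"
    using bounded_op_bound by blast
  define v where "v = (\<lambda>h. if h \<in> I then cnj (T (delta h) g) else 0)"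
  have b: "cmod (T f g) \<le> C * l2_norm I f" if "f \<in> l2 I" for f
    using cmod_le_l2_norm[OF bounded_op_closed[OF that]] C(2)[OF that] by (rule order_trans)
  have "v \<in> l2 I" "T f g = l2_inner I f v"
    unfolding v_def
    by (rule l2_Riesz(1)[where C = C and \<phi> = "\<lambda>f. T f g"], simp_all add: bounded_op_add bounded_op_scale b)
      (rule l2_Riesz(3)[where C = C and \<phi> = "\<lambda>f. T f g"], simp_all add: bounded_op_add bounded_op_scale b assms(1))
  then have "((\<lambda>h. f h * cnj (v h)) has_sum T f g) I"
    using l2_inner_has_sum[OF assms(1), of v] by simp
  then show ?thesis
    by (rule has_sum_cong[THEN iffD1, rotated]) (simp add: v_def)
qed

lemma bounded_op_adjoint_exists:
  "\<exists>S. S \<in> bounded_ops I \<and> (\<forall>f\<in>l2 I. \<forall>g\<in>l2 I. l2_inner I (T f) g = l2_inner I f (S g))"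
proof -
  obtain C where C: "0 \<le> C" "\<And>f. f \<in> l2 I \<Longrightarrow> l2_norm I (T f) \<le> C * l2_norm I f"
    using bounded_op_bound by blast
  define S where
    "S = (\<lambda>g\<in>l2 I. \<lambda>h. if h \<in> I then cnj (l2_inner I (T (delta h)) g) else 0)"
  have b: "cmod (l2_inner I (T f) g) \<le> (C * l2_norm I g) * l2_norm I f"
    if "f \<in> l2 I" "g \<in> l2 I" for f g
  proof -
    have "cmod (l2_inner I (T f) g) \<le> l2_norm I (T f) * l2_norm I g"
      by (rule l2_Cauchy_Schwarz[OF bounded_op_closed[OF that(1)] that(2)])
    also have "\<dots> \<le> (C * l2_norm I f) * l2_norm I g"
      by (rule mult_right_mono[OF C(2)[OF that(1)]]) simp
    finally show ?thesis
      by (simp add: mult_ac)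
  qed
  have *: "S g \<in> l2 I" "l2_norm I (S g) \<le> \<bar>C * l2_norm I g\<bar>"
    "\<And>f. f \<in> l2 I \<Longrightarrow> l2_inner I (T f) g = l2_inner I f (S g)" if g: "g \<in> l2 I" for g
  proof -
    have S: "S g = (\<lambda>h. if h \<in> I then cnj (l2_inner I (T (delta h)) g) else 0)"
      using g by (simp add: S_def)
    note Riesz = l2_Riesz[where \<phi> = "\<lambda>f. l2_inner I (T f) g" and C = "C * l2_norm I g" and I = I,
        folded S]
    show "S g \<in> l2 I" "l2_norm I (S g) \<le> \<bar>C * l2_norm I g\<bar>"
      "\<And>f. f \<in> l2 I \<Longrightarrow> l2_inner I (T f) g = l2_inner I f (S g)"
      by (rule Riesz(1) Riesz(2) Riesz(3);
          simp add: bounded_op_add bounded_op_scale bounded_op_closed l2_inner_add_left l2_inner_scale_left g b)+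
  qed
  have "S \<in> bounded_ops I"
  proof (rule bounded_opsI[where C = C])
    show "l2_norm I (S f) \<le> C * l2_norm I f" if "f \<in> l2 I" for f
      using *(2)[OF that] C(1) by (simp add: abs_of_nonneg)
    show "S (\<lambda>x. f x + g x) = (\<lambda>x. S f x + S g x)" if "f \<in> l2 I" "g \<in> l2 I" for f g
      using that by (auto simp: S_def l2_add l2_inner_add_right bounded_op_closed)
    show "S (\<lambda>x. c * f x) = (\<lambda>x. c * S f x)" if "f \<in> l2 I" for c f
      using that by (auto simp: S_def l2_scale l2_inner_scale_right)
  qed (use *(1) in \<open>auto simp: S_def\<close>)
  then show ?thesis
    using *(3) by blast
qed

end

lemma bounded_op_ext:
  assumes "S \<in> bounded_ops I" "T \<in> bounded_ops I" "\<And>f. f \<in> l2 I \<Longrightarrow> S f = T f"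
  shows "S = T"
proof
  fix f
  show "S f = T f"
    by (cases "f \<in> l2 I") (simp_all add: assms(3) bounded_op_undefined[OF assms(1)] bounded_op_undefined[OF assms(2)])
qed

lemma bounded_op_eq_delta:
  assumes S: "S \<in> bounded_ops I" and T: "T \<in> bounded_ops I"
    and eq: "\<And>h. h \<in> I \<Longrightarrow> S (delta h) = T (delta h)"
  shows "S = T"
proof (rule bounded_op_ext[OF S T], rule ext)
  fix f g
  assume f: "f \<in> l2 I"
  show "S f g = T f g"
  proof (cases "g \<in> I")
    case True
    have "((\<lambda>h. f h * S (delta h) g) has_sum T f g) I"
      using bounded_op_matrix[OF T f True] by (rule has_sum_cong[THEN iffD1, rotated]) (simp add: eq)
    then show ?thesis
      using bounded_op_matrix[OF S f True] has_sum_unique by blast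
  next
    case False
    then show ?thesis
      using bounded_op_closed[OF S f] bounded_op_closed[OF T f] by (simp add: l2_outside)
  qed
qed

lemma l2_eq_inner:
  assumes "f \<in> l2 I" "g \<in> l2 I" "\<And>h. h \<in> l2 I \<Longrightarrow> l2_inner I h f = l2_inner I h g"
  shows "f = g"
proof
  fix x
  show "f x = g x"
  proof (cases "x \<in> I")
    case True
    then have "cnj (l2_inner I (delta x) f) = cnj (l2_inner I (delta x) g)"
      using assms(3)[of "delta x"] by simp
    then show ?thesis
      using True unfolding l2_inner_commute[symmetric] by (simp add: l2_inner_delta)
  qed (use assms in \<open>simp add: l2_outside\<close>)
qed

lemma op_adj_unique:
  assumes S: "S \<in> bounded_ops I"
    and eq: "\<And>f g. f \<in> l2 I \<Longrightarrow> g \<in> l2 I \<Longrightarrow> l2_inner I (T f) g = l2_inner I f (S g)"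
  shows "op_adj I T = S"
  unfolding op_adj_def
proof (rule the_equality)
  fix R
  assume R: "R \<in> bounded_ops I \<and> (\<forall>f\<in>l2 I. \<forall>g\<in>l2 I. l2_inner I (T f) g = l2_inner I f (R g))"
  then have Rb: "R \<in> bounded_ops I"
    by simp
  have Re: "l2_inner I (T f) g = l2_inner I f (R g)" if "f \<in> l2 I" "g \<in> l2 I" for f g
    using R that by simp
  show "R = S"
  proof (rule bounded_op_ext[OF Rb S])
    fix g
    assume g: "g \<in> l2 I"
    show "R g = S g"
    proof (rule l2_eq_inner[OF bounded_op_closed[OF Rb g] bounded_op_closed[OF S g]])
      fix h
      assume h: "h \<in> l2 I"
      show "l2_inner I h (R g) = l2_inner I h (S g)"
        using Re[OF h g] eq[OF h g] by simp
    qed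
  qed
qed (use assms in simp)

lemma
  assumes "T \<in> bounded_ops I"
  shows op_adj_bounded: "op_adj I T \<in> bounded_ops I"
    and op_adj_inner: "f \<in> l2 I \<Longrightarrow> g \<in> l2 I \<Longrightarrow> l2_inner I (T f) g = l2_inner I f (op_adj I T g)"
proof -
  obtain S where S: "S \<in> bounded_ops I"
      "\<forall>f\<in>l2 I. \<forall>g\<in>l2 I. l2_inner I (T f) g = l2_inner I f (S g)"
    using bounded_op_adjoint_exists[OF assms] by blast
  then have "op_adj I T = S"
    by (intro op_adj_unique) auto
  then show "op_adj I T \<in> bounded_ops I"
    "f \<in> l2 I \<Longrightarrow> g \<in> l2 I \<Longrightarrow> l2_inner I (T f) g = l2_inner I f (op_adj I T g)"
    using S by auto
qed

lemma op_adj_inner':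
  assumes "T \<in> bounded_ops I" "f \<in> l2 I" "g \<in> l2 I"
  shows "l2_inner I (op_adj I T f) g = l2_inner I f (T g)"
  unfolding l2_inner_commute[of I f] l2_inner_commute[of I "op_adj I T f"]
  using op_adj_inner[OF assms(1,3,2)] by simp

lemma op_adj_matrix:
  assumes "T \<in> bounded_ops I" "g \<in> I" "h \<in> I"
  shows "op_adj I T (delta h) g = cnj (T (delta g) h)"
  using op_adj_inner'[OF assms(1), of "delta h" "delta g"] assms(2,3)
  by (simp add: l2_inner_delta l2_inner_commute[of I "delta h" "T (delta g)"])

lemma op_adj_op_adj [simp]: "T \<in> bounded_ops I \<Longrightarrow> op_adj I (op_adj I T) = T"
  by (rule op_adj_unique) (simp_all add: op_adj_inner')

lemma op_mult_apply [simp]: "f \<in> l2 I \<Longrightarrow> op_mult I S T f = S (T f)"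
  by (simp add: compose_def)

lemma op_mult_undefined: "f \<notin> l2 I \<Longrightarrow> op_mult I S T f = undefined"
  by (simp add: compose_def)

lemma op_id_apply [simp]: "f \<in> l2 I \<Longrightarrow> op_id I f = f"
  by (simp add: op_id_def)

lemma op_id_bounded [simp]: "op_id I \<in> bounded_ops I"
  by (rule bounded_opsI[where C = 1]) (auto simp: op_id_def l2_add l2_scale)

lemma op_mult_bounded:
  assumes S: "S \<in> bounded_ops I" and T: "T \<in> bounded_ops I"
  shows "op_mult I S T \<in> bounded_ops I"
proof -
  obtain C where C: "0 \<le> C" "\<And>f. f \<in> l2 I \<Longrightarrow> l2_norm I (S f) \<le> C * l2_norm I f"
    using bounded_op_bound[OF S] by blast
  obtain D where D: "0 \<le> D" "\<And>f. f \<in> l2 I \<Longrightarrow> l2_norm I (T f) \<le> D * l2_norm I f"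
    using bounded_op_bound[OF T] by blast
  have le: "l2_norm I (S (T f)) \<le> (C * D) * l2_norm I f" if "f \<in> l2 I" for f
  proof -
    have "l2_norm I (S (T f)) \<le> C * l2_norm I (T f)"
      by (rule C(2)[OF bounded_op_closed[OF T that]])
    also have "\<dots> \<le> C * (D * l2_norm I f)"
      by (rule mult_left_mono[OF D(2)[OF that] C(1)])
    finally show ?thesis
      by (simp add: mult.assoc)
  qed
  show ?thesis
    by (rule bounded_opsI[where C = "C * D"])
      (use le in \<open>auto simp: op_mult_undefined bounded_op_closed[OF S] bounded_op_closed[OF T]
        bounded_op_add[OF S] bounded_op_add[OF T] bounded_op_scale[OF S] bounded_op_scale[OF T]
        l2_add l2_scale\<close>)
qed

lemma op_add_bounded:
  assumes S: "S \<in> bounded_ops I" and T: "T \<in> bounded_ops I"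
  shows "op_add I S T \<in> bounded_ops I"
proof -
  obtain C where C: "\<And>f. f \<in> l2 I \<Longrightarrow> l2_norm I (S f) \<le> C * l2_norm I f"
    using bounded_op_bound[OF S] by blast
  obtain D where D: "\<And>f. f \<in> l2 I \<Longrightarrow> l2_norm I (T f) \<le> D * l2_norm I f"
    using bounded_op_bound[OF T] by blast
  have le: "l2_norm I (\<lambda>x. S f x + T f x) \<le> (C + D) * l2_norm I f" if "f \<in> l2 I" for f
    using l2_norm_triangle[OF bounded_op_closed[OF S that] bounded_op_closed[OF T that]] C[OF that] D[OF that]
    by (simp add: distrib_right)
  show ?thesis
    by (rule bounded_opsI[where C = "C + D"])
      (use le in \<open>auto simp: op_add_def bounded_op_closed[OF S] bounded_op_closed[OF T]
        bounded_op_add[OF S] bounded_op_add[OF T] bounded_op_scale[OF S] bounded_op_scale[OF T]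
        l2_add l2_scale distrib_left\<close>)
qed

lemma op_scale_bounded:
  assumes T: "T \<in> bounded_ops I"
  shows "op_scale I c T \<in> bounded_ops I"
proof -
  obtain D where D: "\<And>f. f \<in> l2 I \<Longrightarrow> l2_norm I (T f) \<le> D * l2_norm I f"
    using bounded_op_bound[OF T] by blast
  have le: "l2_norm I (\<lambda>x. c * T f x) \<le> (cmod c * D) * l2_norm I f" if "f \<in> l2 I" for f
    using mult_left_mono[OF D[OF that] norm_ge_zero[of c]] l2_norm_scale[OF bounded_op_closed[OF T that]]
    by (simp add: mult.assoc)
  show ?thesis
    by (rule bounded_opsI[where C = "cmod c * D"])
      (use le in \<open>auto simp: op_scale_def bounded_op_closed[OF T]
        bounded_op_add[OF T] bounded_op_scale[OF T] l2_add l2_scale distrib_left\<close>)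
qed

lemma op_add_apply [simp]: "f \<in> l2 I \<Longrightarrow> op_add I S T f = (\<lambda>x. S f x + T f x)"
  by (simp add: op_add_def)

lemma op_diff_apply [simp]: "f \<in> l2 I \<Longrightarrow> op_diff I S T f = (\<lambda>x. S f x - T f x)"
  by (simp add: op_diff_def)

lemma op_scale_apply [simp]: "f \<in> l2 I \<Longrightarrow> op_scale I c T f = (\<lambda>x. c * T f x)"
  by (simp add: op_scale_def)

lemma op_diff_eq: "op_diff I S T = op_add I S (op_scale I (-1) T)"
  by (auto simp: op_diff_def op_add_def op_scale_def fun_eq_iff)

lemma op_adj_mult:
  assumes "S \<in> bounded_ops I" "T \<in> bounded_ops I"
  shows "op_adj I (op_mult I S T) = op_mult I (op_adj I T) (op_adj I S)"
  by (rule op_adj_unique)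
    (use assms in \<open>simp_all add: op_mult_bounded op_adj_bounded bounded_op_closed op_adj_inner[symmetric]\<close>)

lemma op_mult_assoc:
  assumes "T \<in> bounded_ops I"
  shows "op_mult I (op_mult I R S) T = op_mult I R (op_mult I S T)"
  using assms by (auto simp: compose_def fun_eq_iff bounded_op_closed)

lemma op_mult_id_left: "T \<in> bounded_ops I \<Longrightarrow> op_mult I (op_id I) T = T"
  by (rule bounded_op_ext[where I = I]) (simp_all add: op_mult_bounded bounded_op_closed)

lemma op_mult_id_right: "T \<in> bounded_ops I \<Longrightarrow> op_mult I T (op_id I) = T"
  by (rule bounded_op_ext[where I = I]) (simp_all add: op_mult_bounded)

lemma unitary_op_isometric:
  assumes "unitary_op I u" "f \<in> l2 I"
  shows "l2_norm I (u f) = l2_norm I f"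
proof -
  have u: "u \<in> bounded_ops I" "op_mult I (op_adj I u) u = op_id I"
    using assms(1) by (auto simp: unitary_op_def)
  have "op_adj I u (u f) = f"
    using fun_cong[OF u(2), of f] assms(2) by simp
  then have "l2_inner I (u f) (u f) = l2_inner I f f"
    using op_adj_inner[OF u(1) assms(2) bounded_op_closed[OF u(1) assms(2)]] by simp
  then have "(l2_norm I (u f))\<^sup>2 = (l2_norm I f)\<^sup>2"
    using u(1) assms(2) by (simp add: l2_inner_self bounded_op_closed del: of_real_power)
  then show ?thesis
    by (simp add: power2_eq_iff_nonneg)
qed

lemma unitary_op_adj: "unitary_op I u \<Longrightarrow> unitary_op I (op_adj I u)"
  by (simp add: unitary_op_def op_adj_bounded)

section \<open>Commutants\<close>

lemma commutant_bounded: "commutant I M \<subseteq> bounded_ops I"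
  by (auto simp: commutant_def)

lemma commutant_commutes: "T \<in> commutant I M \<Longrightarrow> S \<in> M \<Longrightarrow> op_mult I T S = op_mult I S T"
  by (auto simp: commutant_def)

lemma commutant_antimono: "M \<subseteq> M' \<Longrightarrow> commutant I M' \<subseteq> commutant I M"
  by (auto simp: commutant_def)

lemma double_commutant: "M \<subseteq> bounded_ops I \<Longrightarrow> M \<subseteq> commutant I (commutant I M)"
  by (auto simp: commutant_def)

lemma triple_commutant:
  "M \<subseteq> bounded_ops I \<Longrightarrow> commutant I (commutant I (commutant I M)) = commutant I M"
  by (intro equalityI commutant_antimono double_commutant commutant_bounded)

lemma op_id_commutant: "M \<subseteq> bounded_ops I \<Longrightarrow> op_id I \<in> commutant I M"
  by (auto simp: commutant_def op_mult_id_left op_mult_id_right)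

lemma op_adj_commutant:
  assumes "M \<subseteq> bounded_ops I" "\<And>S. S \<in> M \<Longrightarrow> op_adj I S \<in> M" "T \<in> commutant I M"
  shows "op_adj I T \<in> commutant I M"
  unfolding commutant_def
proof (intro CollectI conjI ballI)
  fix S
  assume "S \<in> M"
  have T: "T \<in> bounded_ops I"
    using assms(3) by (simp add: commutant_def)
  have S: "S \<in> bounded_ops I" "op_adj I S \<in> bounded_ops I"
    using \<open>S \<in> M\<close> assms(1) by (auto simp: op_adj_bounded)
  have "op_adj I (op_mult I T (op_adj I S)) = op_adj I (op_mult I (op_adj I S) T)"
    using commutant_commutes[OF assms(3) assms(2)[OF \<open>S \<in> M\<close>]] by simp
  then show "op_mult I (op_adj I T) S = op_mult I S (op_adj I T)"
    using S T by (simp add: op_adj_mult)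
qed (use assms(3) in \<open>simp add: commutant_def op_adj_bounded\<close>)

lemma star_subalgebra_commutant:
  assumes M: "M \<subseteq> bounded_ops I" and adj: "\<And>S. S \<in> M \<Longrightarrow> op_adj I S \<in> M"
  shows "star_subalgebra I (commutant I M)"
  unfolding star_subalgebra_def
proof (intro conjI ballI allI)
  show "commutant I M \<noteq> {}"
    using op_id_commutant[OF M] by blast
  show "commutant I M \<subseteq> bounded_ops I"
    by (rule commutant_bounded)
  fix S
  assume S: "S \<in> commutant I M"
  then have Sb: "S \<in> bounded_ops I"
    by (simp add: commutant_def)
  show "op_adj I S \<in> commutant I M"
    by (rule op_adj_commutant[OF M adj S])
  have comm: "A (R f) = R (A f)" if "A \<in> commutant I M" "R \<in> M" "f \<in> l2 I" for A R f
    using fun_cong[OF commutant_commutes[OF that(1,2)], of f] that(3) by simp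
  show "op_scale I c S \<in> commutant I M" for c
    unfolding commutant_def
  proof (intro CollectI conjI ballI)
    fix R
    assume R: "R \<in> M"
    then have Rb: "R \<in> bounded_ops I"
      using M by blast
    show "op_mult I (op_scale I c S) R = op_mult I R (op_scale I c S)"
      by (rule bounded_op_ext[where I = I])
        (use Sb Rb in \<open>simp_all add: op_mult_bounded op_scale_bounded bounded_op_closed
          bounded_op_scale[OF Rb] comm[OF S R]\<close>)
  qed (simp add: Sb op_scale_bounded)
  fix T
  assume T: "T \<in> commutant I M"
  then have Tb: "T \<in> bounded_ops I"
    by (simp add: commutant_def)
  show "op_add I S T \<in> commutant I M"
    unfolding commutant_def
  proof (intro CollectI conjI ballI)
    fix R
    assume R: "R \<in> M"
    then have Rb: "R \<in> bounded_ops I"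
      using M by blast
    show "op_mult I (op_add I S T) R = op_mult I R (op_add I S T)"
      by (rule bounded_op_ext[where I = I])
        (use Sb Tb Rb in \<open>simp_all add: op_mult_bounded op_add_bounded bounded_op_closed
          bounded_op_add[OF Rb] comm[OF S R] comm[OF T R]\<close>)
  qed (simp add: Sb Tb op_add_bounded)
  show "op_mult I S T \<in> commutant I M"
    unfolding commutant_def
  proof (intro CollectI conjI ballI)
    fix R
    assume R: "R \<in> M"
    then have Rb: "R \<in> bounded_ops I"
      using M by blast
    show "op_mult I (op_mult I S T) R = op_mult I R (op_mult I S T)"
      by (rule bounded_op_ext[where I = I])
        (use Sb Tb Rb in \<open>simp_all add: op_mult_bounded bounded_op_closed comm[OF S R] comm[OF T R]\<close>)
  qed (simp add: Sb Tb op_mult_bounded)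
qed

lemma star_subalgebraD:
  assumes "star_subalgebra I A"
  shows "A \<subseteq> bounded_ops I" "\<And>S T. S \<in> A \<Longrightarrow> T \<in> A \<Longrightarrow> op_add I S T \<in> A"
    "\<And>S T. S \<in> A \<Longrightarrow> T \<in> A \<Longrightarrow> op_mult I S T \<in> A"
    "\<And>c T. T \<in> A \<Longrightarrow> op_scale I c T \<in> A" "\<And>T. T \<in> A \<Longrightarrow> op_adj I T \<in> A"
  using assms by (auto simp: star_subalgebra_def)

lemma star_subalgebra_diff:
  "star_subalgebra I A \<Longrightarrow> S \<in> A \<Longrightarrow> T \<in> A \<Longrightarrow> op_diff I S T \<in> A"
  by (simp add: op_diff_eq star_subalgebraD)

text \<open>The von Neumann algebra generated by a self-adjoint set is its double commutant: the double
  commutant is a von Neumann algebra, and it is monotone.\<close>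
lemma vN_generated_eq:
  assumes S: "S \<subseteq> bounded_ops I" and adj: "\<And>T. T \<in> S \<Longrightarrow> op_adj I T \<in> S"
  shows "vN_generated I S = commutant I (commutant I S)"
    and "von_neumann_algebra I (commutant I (commutant I S))"
proof -
  have adj': "op_adj I T \<in> commutant I S" if "T \<in> commutant I S" for T
    by (rule op_adj_commutant[OF S adj that])
  show vN: "von_neumann_algebra I (commutant I (commutant I S))"
    unfolding von_neumann_algebra_def
    by (intro conjI ballI commutant_bounded op_adj_commutant[OF commutant_bounded adj']
        triple_commutant[OF commutant_bounded])
  have "commutant I (commutant I S) \<subseteq> M" if M: "von_neumann_algebra I M" "S \<subseteq> M" for M
  proof -
    have "commutant I (commutant I S) \<subseteq> commutant I (commutant I M)"
      by (intro commutant_antimono M(2))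
    then show ?thesis
      using M(1) by (simp add: von_neumann_algebra_def)
  qed
  then show "vN_generated I S = commutant I (commutant I S)"
    unfolding vN_generated_def using vN double_commutant[OF S]
    by (intro equalityI Inter_lower Inter_greatest) auto
qed

section \<open>Group von Neumann algebras\<close>

lemma
  assumes p: "bij_betw p I I"
  defines "T \<equiv> (\<lambda>f\<in>l2 I. \<lambda>x. if x \<in> I then f (p x) else 0)"
  shows permutation_op_bounded: "T \<in> bounded_ops I"
    and permutation_op_isometric: "f \<in> l2 I \<Longrightarrow> l2_norm I (T f) = l2_norm I f"
proof -
  have h: "((\<lambda>x. (cmod (T f x))\<^sup>2) has_sum (l2_norm I f)\<^sup>2) I" if f: "f \<in> l2 I" for f
  proof -
    have "((\<lambda>x. (cmod (f (p x)))\<^sup>2) has_sum (l2_norm I f)\<^sup>2) I"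
      using has_sum_reindex_bij_betw[OF p, of "\<lambda>y. (cmod (f y))\<^sup>2"] l2_norm_square_has_sum[OF f] by simp
    then show ?thesis
      by (rule has_sum_cong[THEN iffD1, rotated]) (simp add: T_def f)
  qed
  have T: "T f \<in> l2 I" if f: "f \<in> l2 I" for f
    using h[OF f] f by (auto simp: l2_def T_def summable_on_def)
  have n: "l2_norm I (T f) = l2_norm I f" if f: "f \<in> l2 I" for f
    using has_sum_unique[OF h[OF f] l2_norm_square_has_sum[OF T[OF f]]] by (simp add: power2_eq_iff_nonneg)
  then show "f \<in> l2 I \<Longrightarrow> l2_norm I (T f) = l2_norm I f" .
  show "T \<in> bounded_ops I"
    by (rule bounded_opsI[where C = 1]) (use T n in \<open>auto simp: T_def l2_add l2_scale\<close>)
qed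

definition l2_projection :: "'a set \<Rightarrow> 'a set \<Rightarrow> 'a l2op" where
  "l2_projection I A = (\<lambda>f\<in>l2 I. cutoff A f)"

lemma cutoff_add: "cutoff A (\<lambda>x. f x + g x) = (\<lambda>x. cutoff A f x + cutoff A g x)"
  by (auto simp: cutoff_def)

lemma cutoff_scale: "cutoff A (\<lambda>x. c * f x) = (\<lambda>x. c * cutoff A f x)"
  by (auto simp: cutoff_def)

lemma l2_projection_bounded: "l2_projection I A \<in> bounded_ops I"
  by (rule bounded_opsI[where C = 1])
    (auto simp: l2_projection_def l2_norm_cutoff cutoff_add cutoff_scale l2_add l2_scale)

definition right_regular :: "('g, 'b) monoid_scheme \<Rightarrow> 'g \<Rightarrow> 'g l2op" where
  "right_regular G k =
     (\<lambda>f\<in>l2 (carrier G). \<lambda>h. if h \<in> carrier G then f (h \<otimes>\<^bsub>G\<^esub> k) else 0)"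

context group
begin

lemma bij_left_mult: "g \<in> carrier G \<Longrightarrow> bij_betw (\<lambda>h. g \<otimes> h) (carrier G) (carrier G)"
  by (rule bij_betw_byWitness[where f' = "\<lambda>h. inv g \<otimes> h"]) (auto simp: m_assoc[symmetric])

lemma bij_right_mult: "k \<in> carrier G \<Longrightarrow> bij_betw (\<lambda>h. h \<otimes> k) (carrier G) (carrier G)"
  by (rule bij_betw_byWitness[where f' = "\<lambda>h. h \<otimes> inv k"]) (auto simp: m_assoc)

lemma bij_inv: "bij_betw (\<lambda>h. inv h) (carrier G) (carrier G)"
  by (rule bij_betw_byWitness[where f' = "\<lambda>h. inv h"]) auto

lemma left_regular_bounded [simp]: "g \<in> carrier G \<Longrightarrow> left_regular G g \<in> bounded_ops (carrier G)"
  unfolding left_regular_def by (rule permutation_op_bounded) (simp add: bij_left_mult)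

lemma left_regular_isometric:
  "g \<in> carrier G \<Longrightarrow> f \<in> l2 (carrier G) \<Longrightarrow>
    l2_norm (carrier G) (left_regular G g f) = l2_norm (carrier G) f"
  unfolding left_regular_def by (rule permutation_op_isometric) (simp_all add: bij_left_mult)

lemma right_regular_bounded: "k \<in> carrier G \<Longrightarrow> right_regular G k \<in> bounded_ops (carrier G)"
  unfolding right_regular_def by (rule permutation_op_bounded) (simp add: bij_right_mult)

lemma left_regular_apply:
  "f \<in> l2 (carrier G) \<Longrightarrow> h \<in> carrier G \<Longrightarrow> left_regular G g f h = f (inv g \<otimes> h)"
  by (simp add: left_regular_def)

lemma right_regular_apply:
  "f \<in> l2 (carrier G) \<Longrightarrow> h \<in> carrier G \<Longrightarrow> right_regular G k f h = f (h \<otimes> k)"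
  by (simp add: right_regular_def)

lemma left_regular_delta:
  assumes "g \<in> carrier G" "x \<in> carrier G"
  shows "left_regular G g (delta x) = delta (g \<otimes> x)"
proof
  fix y
  have "inv g \<otimes> y = x \<longleftrightarrow> y = g \<otimes> x" if "y \<in> carrier G"
    using inv_solve_left[of x g y] assms that by auto
  then show "left_regular G g (delta x) y = delta (g \<otimes> x) y"
    using assms by (cases "y \<in> carrier G") (auto simp: left_regular_def, auto simp: delta_def)
qed

lemma op_adj_left_regular:
  assumes g: "g \<in> carrier G"
  shows "op_adj (carrier G) (left_regular G g) = left_regular G (inv g)"
proof (rule bounded_op_eq_delta[where I = "carrier G"])
  fix h
  assume h: "h \<in> carrier G"
  have "op_adj (carrier G) (left_regular G g) (delta h) x = left_regular G (inv g) (delta h) x" for x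
  proof (cases "x \<in> carrier G")
    case True
    have "(h = g \<otimes> x) = (x = inv g \<otimes> h)"
      using inv_solve_left[OF True g h] by blast
    then show ?thesis
      using g h True by (simp add: op_adj_matrix left_regular_delta) (simp add: delta_def)
  next
    case False
    then show ?thesis
      using bounded_op_outside[of "op_adj (carrier G) (left_regular G g)" "carrier G" "delta h" x]
        bounded_op_outside[of "left_regular G (inv g)" "carrier G" "delta h" x] g h
      by (simp add: op_adj_bounded)
  qed
  then show "op_adj (carrier G) (left_regular G g) (delta h) = left_regular G (inv g) (delta h)" ..
qed (use g in \<open>simp_all add: op_adj_bounded\<close>)

lemma VN_double_commutant:
  assumes K: "subgroup K G"
  shows "VN G K = commutant (carrier G) (commutant (carrier G) (left_regular G ` K))"
    and "von_neumann_algebra (carrier G) (VN G K)"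
proof -
  have sub: "left_regular G ` K \<subseteq> bounded_ops (carrier G)"
    using subgroup.mem_carrier[OF K] by auto
  have adj: "op_adj (carrier G) T \<in> left_regular G ` K" if "T \<in> left_regular G ` K" for T
    using that subgroup.mem_carrier[OF K] subgroup.m_inv_closed[OF K] by (auto simp: op_adj_left_regular)
  show "VN G K = commutant (carrier G) (commutant (carrier G) (left_regular G ` K))"
    unfolding VN_def by (rule vN_generated_eq(1)[OF sub adj])
  then show "von_neumann_algebra (carrier G) (VN G K)"
    using vN_generated_eq(2)[OF sub adj] by simp
qed

lemma left_regular_VN:
  assumes K: "subgroup K G" and k: "k \<in> K"
  shows "left_regular G k \<in> VN G K"
proof -
  have "left_regular G ` K \<subseteq> bounded_ops (carrier G)"
    using subgroup.mem_carrier[OF K] by auto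
  then show ?thesis
    using double_commutant[of "left_regular G ` K"] k by (auto simp: VN_double_commutant(1)[OF K])
qed

lemma star_subalgebra_VN:
  assumes K: "subgroup K G"
  shows "star_subalgebra (carrier G) (VN G K)"
  unfolding VN_double_commutant(1)[OF K]
proof (rule star_subalgebra_commutant[OF commutant_bounded])
  fix S
  assume S: "S \<in> commutant (carrier G) (left_regular G ` K)"
  show "op_adj (carrier G) S \<in> commutant (carrier G) (left_regular G ` K)"
  proof (rule op_adj_commutant[OF _ _ S])
    show "left_regular G ` K \<subseteq> bounded_ops (carrier G)"
      using subgroup.mem_carrier[OF K] by auto
    show "\<And>S. S \<in> left_regular G ` K \<Longrightarrow> op_adj (carrier G) S \<in> left_regular G ` K"
      using subgroup.mem_carrier[OF K] subgroup.m_inv_closed[OF K] by (auto simp: op_adj_left_regular)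
  qed
qed

lemma right_regular_commutant:
  assumes "K \<subseteq> carrier G" "k \<in> carrier G"
  shows "right_regular G k \<in> commutant (carrier G) (left_regular G ` K)"
  unfolding commutant_def
proof (intro CollectI conjI ballI)
  fix S
  assume "S \<in> left_regular G ` K"
  then obtain g where g: "g \<in> carrier G" and S: "S = left_regular G g"
    using assms(1) by auto
  show "op_mult (carrier G) (right_regular G k) S = op_mult (carrier G) S (right_regular G k)"
    unfolding S
  proof (rule bounded_op_ext[where I = "carrier G"])
    fix f
    assume f: "f \<in> l2 (carrier G)"
    have "right_regular G k (left_regular G g f) x = left_regular G g (right_regular G k f) x" for x
      using bounded_op_closed[OF left_regular_bounded[OF g] f]
        bounded_op_closed[OF right_regular_bounded[OF assms(2)] f] f g assms(2)
      by (cases "x \<in> carrier G")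
        (simp_all add: left_regular_apply right_regular_apply m_assoc l2_outside
          bounded_op_outside[OF left_regular_bounded[OF g]] bounded_op_outside[OF right_regular_bounded[OF assms(2)]])
    then show "op_mult (carrier G) (right_regular G k) (left_regular G g) f =
        op_mult (carrier G) (left_regular G g) (right_regular G k) f"
      using f by auto
  qed (simp_all add: op_mult_bounded right_regular_bounded assms(2) g)
qed (simp add: right_regular_bounded assms(2))

lemma l2_projection_commutant:
  assumes K: "subgroup K G"
  shows "l2_projection (carrier G) K \<in> commutant (carrier G) (left_regular G ` K)"
  unfolding commutant_def
proof (intro CollectI conjI ballI)
  fix S
  assume "S \<in> left_regular G ` K"
  then obtain g where g: "g \<in> K" "g \<in> carrier G" and S: "S = left_regular G g"
    using subgroup.mem_carrier[OF K] by auto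
  show "op_mult (carrier G) (l2_projection (carrier G) K) S =
      op_mult (carrier G) S (l2_projection (carrier G) K)"
    unfolding S
  proof (rule bounded_op_ext[where I = "carrier G"])
    fix f
    assume f: "f \<in> l2 (carrier G)"
    have "inv g \<otimes> x \<in> K \<longleftrightarrow> x \<in> K" if "x \<in> carrier G" for x
    proof
      assume "inv g \<otimes> x \<in> K"
      then have "g \<otimes> (inv g \<otimes> x) \<in> K"
        by (rule subgroup.m_closed[OF K g(1)])
      then show "x \<in> K"
        using g that by (simp add: m_assoc[symmetric])
    qed (simp add: K g subgroup.m_closed subgroup.m_inv_closed)
    then have "cutoff K (left_regular G g f) x = left_regular G g (cutoff K f) x" for x
      using bounded_op_closed[OF left_regular_bounded[OF g(2)] f] f g subgroup.mem_carrier[OF K, of x]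
      by (cases "x \<in> carrier G")
        (simp_all add: cutoff_def[of K "left_regular G g f"] left_regular_apply bounded_op_outside[OF left_regular_bounded[OF g(2)]],
         simp_all add: cutoff_def)
    then show "op_mult (carrier G) (l2_projection (carrier G) K) (left_regular G g) f =
        op_mult (carrier G) (left_regular G g) (l2_projection (carrier G) K) f"
      using f bounded_op_closed[OF left_regular_bounded[OF g(2)] f] by (auto simp: l2_projection_def)
  qed (simp_all add: op_mult_bounded l2_projection_bounded g)
qed (simp add: l2_projection_bounded)

text \<open>The commutation theorem for group algebras. Operators in \<open>VN G K\<close> commute with right
  translations and with the projection onto \<open>l2 K\<close>, so they are left convolutions by functions
  supported on \<open>K\<close>. Conversely, let \<open>T\<close> be such a convolution and let \<open>S\<close> commute with the
  left translations by \<open>K\<close>. The two matrix products of \<open>T\<close> with \<open>S\<close> are sums over \<open>\<gamma> \<in> K\<close>, and they agree term by term.\<close>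
lemma VN_iff:
  assumes K: "subgroup K G"
  shows "T \<in> VN G K \<longleftrightarrow> T \<in> bounded_ops (carrier G) \<and>
    (\<forall>g\<in>carrier G. \<forall>h\<in>carrier G. T (delta h) g = T (delta \<one>) (g \<otimes> inv h)) \<and>
    (\<forall>g. g \<notin> K \<longrightarrow> T (delta \<one>) g = 0)"
proof (intro iffI conjI ballI allI impI)
  assume TV: "T \<in> VN G K"
  then have comm: "op_mult (carrier G) T S = op_mult (carrier G) S T"
    if "S \<in> commutant (carrier G) (left_regular G ` K)" for S
    using that unfolding VN_double_commutant(1)[OF K] by (rule commutant_commutes)
  show T: "T \<in> bounded_ops (carrier G)"
    using TV unfolding VN_double_commutant(1)[OF K] by (simp add: commutant_def)
  show "T (delta h) g = T (delta \<one>) (g \<otimes> inv h)" if g: "g \<in> carrier G" and h: "h \<in> carrier G" for g h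
  proof -
    have R: "right_regular G (inv h) (delta \<one>) = delta h"
    proof
      fix x
      show "right_regular G (inv h) (delta \<one>) x = delta h x"
      proof (cases "x \<in> carrier G")
        case True
        have "x \<otimes> inv h = \<one> \<longleftrightarrow> x = h"
          using right_cancel[of "inv h" x h] h True by simp
        then show ?thesis
          using h True by (simp add: right_regular_apply) (simp add: delta_def)
      next
        case False
        then show ?thesis
          using h by (auto simp: right_regular_def delta_def[of h])
      qed
    qed
    have "T (delta h) = right_regular G (inv h) (T (delta \<one>))"
      using fun_cong[OF comm[OF right_regular_commutant[of K "inv h"]], of "delta \<one>"] h subgroup.subset[OF K] R
      by simp
    then show ?thesis
      using bounded_op_closed[OF T] g by (simp add: right_regular_apply)
  qed
  show "T (delta \<one>) g = 0" if "g \<notin> K" for g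
  proof -
    have "cutoff K (delta \<one>) = delta \<one>"
      using subgroup.one_closed[OF K] by (auto simp: cutoff_def delta_def)
    moreover have "T (cutoff K (delta \<one>)) = cutoff K (T (delta \<one>))"
      using fun_cong[OF comm[OF l2_projection_commutant[OF K]], of "delta \<one>"]
        bounded_op_closed[OF T, of "delta \<one>"]
      by (simp add: l2_projection_def)
    ultimately have "T (delta \<one>) = cutoff K (T (delta \<one>))"
      by (rule subst[where P = "\<lambda>v. T v = cutoff K (T (delta \<one>))"])
    then have "T (delta \<one>) g = cutoff K (T (delta \<one>)) g"
      by (rule fun_cong)
    then show ?thesis
      using that by (simp add: cutoff_def)
  qed
next
  assume a: "T \<in> bounded_ops (carrier G) \<and>
    (\<forall>g\<in>carrier G. \<forall>h\<in>carrier G. T (delta h) g = T (delta \<one>) (g \<otimes> inv h)) \<and>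
    (\<forall>g. g \<notin> K \<longrightarrow> T (delta \<one>) g = 0)"
  then have T: "T \<in> bounded_ops (carrier G)"
    and col: "\<And>g h. g \<in> carrier G \<Longrightarrow> h \<in> carrier G \<Longrightarrow> T (delta h) g = T (delta \<one>) (g \<otimes> inv h)"
    and supp: "\<And>g. g \<notin> K \<Longrightarrow> T (delta \<one>) g = 0"
    by blast+
  show "T \<in> VN G K"
    unfolding VN_double_commutant(1)[OF K] commutant_def[of _ "commutant (carrier G) (left_regular G ` K)"]
  proof (intro CollectI conjI ballI T)
    fix S
    assume SC: "S \<in> commutant (carrier G) (left_regular G ` K)"
    then have S: "S \<in> bounded_ops (carrier G)"
      by (simp add: commutant_def)
    show "op_mult (carrier G) T S = op_mult (carrier G) S T"
    proof (rule bounded_op_eq_delta[where I = "carrier G"])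
      fix k
      assume k: "k \<in> carrier G"
      have "T (S (delta k)) g = S (T (delta k)) g" for g
      proof (cases "g \<in> carrier G")
        case g: True
        have bij: "bij_betw (\<lambda>c. inv c \<otimes> g) (carrier G) (carrier G)"
          using bij_betw_trans[OF bij_inv bij_right_mult[OF g]] by (simp add: o_def)
        define p where "p = (\<lambda>c. S (delta k) (inv c \<otimes> g) * T (delta (inv c \<otimes> g)) g)"
        define q where "q = (\<lambda>c. T (delta k) (c \<otimes> k) * S (delta (c \<otimes> k)) g)"
        have "((\<lambda>h. S (delta k) h * T (delta h) g) has_sum T (S (delta k)) g) (carrier G)"
          by (rule bounded_op_matrix[OF T bounded_op_closed[OF S] g]) (simp add: k)
        then have p: "(p has_sum T (S (delta k)) g) (carrier G)"
          unfolding p_def by (subst has_sum_reindex_bij_betw[OF bij])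
        have "((\<lambda>h. T (delta k) h * S (delta h) g) has_sum S (T (delta k)) g) (carrier G)"
          by (rule bounded_op_matrix[OF S bounded_op_closed[OF T] g]) (simp add: k)
        then have q: "(q has_sum S (T (delta k)) g) (carrier G)"
          unfolding q_def by (subst has_sum_reindex_bij_betw[OF bij_right_mult[OF k]])
        have "p c = q c" if c: "c \<in> carrier G" for c
        proof -
          have "T (delta (inv c \<otimes> g)) g = T (delta \<one>) c"
            using c g col[of g "inv c \<otimes> g"] by (simp add: inv_mult_group m_assoc[symmetric])
          moreover have "T (delta k) (c \<otimes> k) = T (delta \<one>) c"
            using c k col[of "c \<otimes> k" k] by (simp add: m_assoc)
          moreover have "S (delta (c \<otimes> k)) g = S (delta k) (inv c \<otimes> g)" if "c \<in> K"
          proof -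
            have "S (left_regular G c (delta k)) = left_regular G c (S (delta k))"
              using fun_cong[OF commutant_commutes[OF SC imageI[OF that, of "left_regular G"]], of "delta k"] k by simp
            then show ?thesis
              using c k g bounded_op_closed[OF S, of "delta k"] by (simp add: left_regular_delta left_regular_apply)
          qed
          ultimately show ?thesis
            unfolding p_def q_def using supp[of c] by (cases "c \<in> K") auto
        qed
        then have "(q has_sum T (S (delta k)) g) (carrier G)"
          using p by (rule has_sum_cong[THEN iffD1])
        then show ?thesis
          using q by (rule has_sum_unique)
      next
        case False
        then show ?thesis
          using k S T by (simp add: bounded_op_outside bounded_op_closed)
      qed
      then show "op_mult (carrier G) T S (delta k) = op_mult (carrier G) S T (delta k)"
        using k by auto
    qed (simp_all add: op_mult_bounded S T)
  qed
qed

end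

section \<open>Conditional expectations\<close>

text \<open>The compression of \<open>T\<close> to the blocks on which the labelling \<open>p\<close> of the index set is
  constant.\<close>
definition block_diagonal :: "'a set \<Rightarrow> ('a \<Rightarrow> 'b) \<Rightarrow> 'a l2op \<Rightarrow> 'a l2op" where
  "block_diagonal I p T =
     (\<lambda>f\<in>l2 I. \<lambda>g. if g \<in> I then T (cutoff {x. p x = p g} f) g else 0)"

lemma sum_l2_norm_blocks:
  assumes "f \<in> l2 I" "finite D"
  shows "(\<Sum>c\<in>D. (l2_norm I (cutoff {x. p x = c} f))\<^sup>2) \<le> (l2_norm I f)\<^sup>2"
  using assms(2,1)
proof (induction D arbitrary: f)
  case (insert c D)
  have r: "(\<lambda>x. f x - cutoff {x. p x = c} f x) \<in> l2 I"
    by (intro l2_diff l2_cutoff insert.prems)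
  have "cutoff {x. p x = d} (\<lambda>x. f x - cutoff {x. p x = c} f x) = cutoff {x. p x = d} f" if "d \<in> D" for d
    using that insert.hyps(2) by (auto simp: cutoff_def fun_eq_iff)
  then have "(\<Sum>d\<in>D. (l2_norm I (cutoff {x. p x = d} f))\<^sup>2) \<le> (l2_norm I (\<lambda>x. f x - cutoff {x. p x = c} f x))\<^sup>2"
    using insert.IH[OF r] by simp
  then show ?case
    using insert.hyps l2_norm_cutoff_split[OF insert.prems, of "{x. p x = c}"] by simp
qed simp

text \<open>The restrictions of a vector to the blocks are orthogonal, and so are their images under the
  compression; so the bound for \<open>T\<close> is inherited by Pythagoras.\<close>
lemma block_diagonal_bounded:
  assumes T: "T \<in> bounded_ops I"
  shows "block_diagonal I p T \<in> bounded_ops I"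
proof -
  obtain C where C: "0 \<le> C" "\<And>f. f \<in> l2 I \<Longrightarrow> l2_norm I (T f) \<le> C * l2_norm I f"
    using bounded_op_bound[OF T] by blast
  have le: "(\<Sum>g\<in>F. (cmod (T (cutoff {x. p x = p g} f) g))\<^sup>2) \<le> (C * l2_norm I f)\<^sup>2"
    if f: "f \<in> l2 I" and F: "finite F" "F \<subseteq> I" for f F
  proof -
    have block: "(\<Sum>g\<in>{g \<in> F. p g = c}. (cmod (T (cutoff {x. p x = p g} f) g))\<^sup>2)
        \<le> C\<^sup>2 * (l2_norm I (cutoff {x. p x = c} f))\<^sup>2" for c
    proof -
      let ?f = "cutoff {x. p x = c} f"
      have "(\<Sum>g\<in>{g \<in> F. p g = c}. (cmod (T (cutoff {x. p x = p g} f) g))\<^sup>2)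
          = (\<Sum>g\<in>{g \<in> F. p g = c}. (cmod (T ?f g))\<^sup>2)"
        by (rule sum.cong) auto
      also have "\<dots> \<le> (l2_norm I (T ?f))\<^sup>2"
        by (rule sum_le_l2_norm) (use f F bounded_op_closed[OF T] in auto)
      also have "\<dots> \<le> (C * l2_norm I ?f)\<^sup>2"
        using C(2)[of ?f] f by (intro power_mono) auto
      finally show ?thesis
        by (simp add: power_mult_distrib)
    qed
    have "(\<Sum>g\<in>F. (cmod (T (cutoff {x. p x = p g} f) g))\<^sup>2)
        = (\<Sum>c\<in>p ` F. \<Sum>g\<in>{g \<in> F. p g = c}. (cmod (T (cutoff {x. p x = p g} f) g))\<^sup>2)"
      by (rule sum.image_gen[OF F(1)])
    also have "\<dots> \<le> (\<Sum>c\<in>p ` F. C\<^sup>2 * (l2_norm I (cutoff {x. p x = c} f))\<^sup>2)"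
      by (rule sum_mono[OF block])
    also have "\<dots> \<le> C\<^sup>2 * (l2_norm I f)\<^sup>2"
      unfolding sum_distrib_left[symmetric]
      by (rule mult_left_mono[OF sum_l2_norm_blocks]) (use f F in auto)
    finally show ?thesis
      by (simp add: power_mult_distrib)
  qed
  have b: "block_diagonal I p T f \<in> l2 I" "l2_norm I (block_diagonal I p T f) \<le> C * l2_norm I f"
    if f: "f \<in> l2 I" for f
  proof -
    have "(\<Sum>g\<in>F. (cmod (block_diagonal I p T f g))\<^sup>2) \<le> (C * l2_norm I f)\<^sup>2"
      if F: "finite F" "F \<subseteq> I" for F
    proof -
      have "(\<Sum>g\<in>F. (cmod (block_diagonal I p T f g))\<^sup>2) = (\<Sum>g\<in>F. (cmod (T (cutoff {x. p x = p g} f) g))\<^sup>2)"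
        by (rule sum.cong) (use f F in \<open>auto simp: block_diagonal_def\<close>)
      then show ?thesis
        using le[OF f F] by simp
    qed
    moreover have "block_diagonal I p T f x = 0" if "x \<notin> I" for x
      using f that by (simp add: block_diagonal_def)
    ultimately show "block_diagonal I p T f \<in> l2 I" "l2_norm I (block_diagonal I p T f) \<le> C * l2_norm I f"
      using l2_bounded_sums[of I "block_diagonal I p T f" "C * l2_norm I f"] C(1) by auto
  qed
  show ?thesis
  proof (rule bounded_opsI[where C = C])
    show "block_diagonal I p T (\<lambda>x. f x + g x) = (\<lambda>x. block_diagonal I p T f x + block_diagonal I p T g x)"
      if "f \<in> l2 I" "g \<in> l2 I" for f g
      using that by (auto simp: block_diagonal_def l2_add cutoff_add bounded_op_add[OF T])
    show "block_diagonal I p T (\<lambda>x. c * f x) = (\<lambda>x. c * block_diagonal I p T f x)" if "f \<in> l2 I" for c f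
      using that by (auto simp: block_diagonal_def l2_scale cutoff_scale bounded_op_scale[OF T])
    show "block_diagonal I p T f = undefined" if "f \<notin> l2 I" for f
      using that by (simp add: block_diagonal_def)
  qed (use b in auto)
qed

text \<open>The quadratic form of the compression is the sum over the blocks of the quadratic forms of
  \<open>T\<close> at the restrictions of the vector.\<close>
lemma block_diagonal_positive:
  assumes "positive_op I T"
  shows "positive_op I (block_diagonal I p T)"
  unfolding positive_op_def
proof (intro conjI ballI)
  have T: "T \<in> bounded_ops I"
    using assms by (simp add: positive_op_def)
  show E: "block_diagonal I p T \<in> bounded_ops I"
    by (rule block_diagonal_bounded[OF T])
  fix f
  assume f: "f \<in> l2 I"
  define a where "a = (\<lambda>x. block_diagonal I p T f x * cnj (f x))"
  define B where "B = (\<lambda>c. {x \<in> I. p x = c})"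
  have bij: "bij_betw snd (Sigma (p ` I) B) I"
    by (rule bij_betw_byWitness[where f' = "\<lambda>x. (p x, x)"]) (auto simp: B_def)
  have "a summable_on I"
    unfolding a_def using l2_inner_has_sum[OF bounded_op_closed[OF E f] f] by (auto simp: summable_on_def)
  then have s: "(\<lambda>cx. a (snd cx)) summable_on Sigma (p ` I) B"
    by (subst summable_on_reindex_bij_betw[OF bij])
  have block: "0 \<le> infsum a (B c)" for c
  proof -
    let ?f = "cutoff {x. p x = c} f"
    have "infsum a (B c) = l2_inner I (T ?f) ?f"
      unfolding l2_inner_def
      by (rule infsum_cong_neutral) (auto simp: B_def a_def block_diagonal_def f cutoff_def)
    moreover have "l2_inner I (T ?f) ?f \<in> \<real>" "0 \<le> Re (l2_inner I (T ?f) ?f)"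
      using assms f by (simp_all add: positive_op_def)
    ultimately show ?thesis
      by (simp add: less_eq_complex_def complex_is_Real_iff)
  qed
  have "l2_inner I (block_diagonal I p T f) f = infsum a I"
    by (simp add: l2_inner_def a_def)
  also have "\<dots> = (\<Sum>\<^sub>\<infinity>cx\<in>Sigma (p ` I) B. a (snd cx))"
    by (rule infsum_reindex_bij_betw[OF bij, symmetric])
  also have "\<dots> = (\<Sum>\<^sub>\<infinity>c\<in>p ` I. infsum a (B c))"
    using infsum_Sigma_banach[OF s] by simp
  finally have eq: "l2_inner I (block_diagonal I p T f) f = (\<Sum>\<^sub>\<infinity>c\<in>p ` I. infsum a (B c))" .
  have "0 \<le> (\<Sum>\<^sub>\<infinity>c\<in>p ` I. infsum a (B c))"
  proof (cases "(\<lambda>c. infsum a (B c)) summable_on p ` I")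
    case True
    then show ?thesis
      by (rule infsum_nonneg_complex[OF _ block])
  qed (simp add: infsum_not_exists)
  then show "l2_inner I (block_diagonal I p T f) f \<in> \<real>" "0 \<le> Re (l2_inner I (block_diagonal I p T f) f)"
    unfolding eq by (simp_all add: less_eq_complex_def complex_is_Real_iff)
qed

context group
begin

lemma r_coset_eq_iff:
  assumes "subgroup K G" "g \<in> carrier G" "h \<in> carrier G"
  shows "K #> h = K #> g \<longleftrightarrow> g \<otimes> inv h \<in> K"
proof
  assume "K #> h = K #> g"
  then have "K #> (g \<otimes> inv h) = K"
    using coset_mult_inv2[of K g h] assms subgroup.subset by blast
  then show "g \<otimes> inv h \<in> K"
    using coset_join1[of K "g \<otimes> inv h"] assms by auto
next
  assume "g \<otimes> inv h \<in> K"
  then have "K #> (g \<otimes> inv h) = K"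
    using coset_join2[of "g \<otimes> inv h" K] assms by auto
  then show "K #> h = K #> g"
    using coset_mult_inv1[of K g h] assms subgroup.subset by blast
qed

lemma VN_bounded: "subgroup K G \<Longrightarrow> T \<in> VN G K \<Longrightarrow> T \<in> bounded_ops (carrier G)"
  by (simp add: VN_iff)

lemma VN_support: "subgroup K G \<Longrightarrow> T \<in> VN G K \<Longrightarrow> g \<notin> K \<Longrightarrow> T (delta \<one>) g = 0"
  by (simp add: VN_iff)

lemma VN_matrix:
  "subgroup K G \<Longrightarrow> T \<in> VN G K \<Longrightarrow> g \<in> carrier G \<Longrightarrow> h \<in> carrier G \<Longrightarrow>
    T (delta h) g = T (delta \<one>) (g \<otimes> inv h)"
  by (simp only: VN_iff)

lemma VN_subset:
  assumes "subgroup K G"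
  shows "VN G K \<subseteq> VN G (carrier G)"
proof
  fix T
  assume T: "T \<in> VN G K"
  have "T (delta \<one>) g = 0" if "g \<notin> carrier G" for g
    using VN_support[OF assms T, of g] subgroup.subset[OF assms] that by blast
  then show "T \<in> VN G (carrier G)"
    using T unfolding VN_iff[OF subgroup_self] VN_iff[OF assms] by blast
qed

text \<open>The columns of the matrix are translates of the column of \<open>\<one>\<close>, so \<open>delta \<one>\<close> is a separating
  vector.\<close>
lemma VN_separating:
  assumes S: "S \<in> VN G (carrier G)" and T: "T \<in> VN G (carrier G)" and eq: "S (delta \<one>) = T (delta \<one>)"
  shows "S = T"
proof (rule bounded_op_eq_delta)
  fix h
  assume h: "h \<in> carrier G"
  show "S (delta h) = T (delta h)"
  proof
    fix g
    show "S (delta h) g = T (delta h) g"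
      using VN_matrix[OF subgroup_self S, of g h] VN_matrix[OF subgroup_self T, of g h] eq h
        bounded_op_outside[OF VN_bounded[OF subgroup_self S], of "delta h" g]
        bounded_op_outside[OF VN_bounded[OF subgroup_self T], of "delta h" g]
      by (cases "g \<in> carrier G") simp_all
  qed
qed (use S T VN_bounded[OF subgroup_self] in auto)

lemma VN_apply:
  assumes "T \<in> VN G (carrier G)" "f \<in> l2 (carrier G)" "g \<in> carrier G"
  shows "((\<lambda>h. f h * T (delta \<one>) (g \<otimes> inv h)) has_sum T f g) (carrier G)"
  using bounded_op_matrix[OF VN_bounded[OF subgroup_self assms(1)] assms(2,3)]
  by (rule has_sum_cong[THEN iffD1, rotated])
    (simp add: VN_matrix[OF subgroup_self assms(1) assms(3), symmetric])

lemma group_trace_eq: "group_trace G T = T (delta \<one>) \<one>"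
  by (simp add: group_trace_def l2_inner_delta)

lemma group_trace_commute:
  assumes S: "S \<in> VN G (carrier G)" and T: "T \<in> VN G (carrier G)"
  shows "group_trace G (op_mult (carrier G) S T) = group_trace G (op_mult (carrier G) T S)"
proof -
  have d: "R (delta \<one>) \<in> l2 (carrier G)" if "R \<in> VN G (carrier G)" for R
    using bounded_op_closed[OF VN_bounded[OF subgroup_self that]] by simp
  have 1: "((\<lambda>h. T (delta \<one>) h * S (delta \<one>) (inv h)) has_sum S (T (delta \<one>)) \<one>) (carrier G)"
    using VN_apply[OF S d[OF T] one_closed] by (rule has_sum_cong[THEN iffD1, rotated]) simp
  have "((\<lambda>h. S (delta \<one>) h * T (delta \<one>) (inv h)) has_sum T (S (delta \<one>)) \<one>) (carrier G)"
    using VN_apply[OF T d[OF S] one_closed] by (rule has_sum_cong[THEN iffD1, rotated]) simp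
  then have "((\<lambda>h. S (delta \<one>) (inv h) * T (delta \<one>) (inv (inv h))) has_sum T (S (delta \<one>)) \<one>) (carrier G)"
    by (subst has_sum_reindex_bij_betw[OF bij_inv])
  then have "((\<lambda>h. T (delta \<one>) h * S (delta \<one>) (inv h)) has_sum T (S (delta \<one>)) \<one>) (carrier G)"
    by (rule has_sum_cong[THEN iffD1, rotated]) simp
  then show ?thesis
    using 1 by (simp add: group_trace_eq has_sum_unique)
qed

lemma norm2_group_trace:
  assumes "T \<in> bounded_ops (carrier G)"
  shows "norm2 (carrier G) (group_trace G) T = l2_norm (carrier G) (T (delta \<one>))"
proof -
  have "group_trace G (op_mult (carrier G) (op_adj (carrier G) T) T)
      = l2_inner (carrier G) (T (delta \<one>)) (T (delta \<one>))"
    using op_adj_inner'[OF assms bounded_op_closed[OF assms], of "delta \<one>" "delta \<one>"]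
    by (simp add: group_trace_def)
  then show ?thesis
    using bounded_op_closed[OF assms, of "delta \<one>"] by (simp add: norm2_def l2_inner_self del: of_real_power)
qed

text \<open>For the blocks given by the right cosets of \<open>K\<close>, compression keeps the matrix entries in row
  \<open>g\<close> and column \<open>h\<close> with \<open>g \<otimes> inv h \<in> K\<close>, so it cuts off the coefficients outside \<open>K\<close>.
  Boundedness and positivity are visible from the block form, but not from the coefficients.\<close>
definition group_expectation :: "'a set \<Rightarrow> 'a l2op \<Rightarrow> 'a l2op" where
  "group_expectation K = (\<lambda>T\<in>VN G (carrier G). block_diagonal (carrier G) (\<lambda>g. K #> g) T)"

lemma group_expectation_apply:
  assumes K: "subgroup K G" and T: "T \<in> VN G (carrier G)" and f: "f \<in> l2 (carrier G)" "\<And>x. x \<notin> K \<Longrightarrow> f x = 0"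
  shows "group_expectation K T f = cutoff K (T f)"
proof
  fix g
  show "group_expectation K T f g = cutoff K (T f) g"
  proof (cases "g \<in> carrier G")
    case True
    have coset: "K #> x = K #> g \<longleftrightarrow> g \<in> K" if "x \<in> K" for x
    proof -
      have x: "x \<in> carrier G" "K #> x = K"
        using subgroup.mem_carrier[OF K that] coset_join2[OF _ K that] by auto
      show ?thesis
        using x(2) coset_join1[OF _ True K] coset_join2[OF True K] by auto
    qed
    have "cutoff {x. K #> x = K #> g} f = (if g \<in> K then f else (\<lambda>_. 0))"
      using f(2) coset by (auto simp: cutoff_def fun_eq_iff)
    then show ?thesis
      using True f(1) T bounded_op_zero[OF VN_bounded[OF subgroup_self T]]
      by (simp add: group_expectation_def block_diagonal_def) (simp add: cutoff_def)
  next
    case False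
    then show ?thesis
      using subgroup.subset[OF K] f(1) T by (auto simp: group_expectation_def block_diagonal_def cutoff_def)
  qed
qed

lemma group_expectation_one:
  assumes K: "subgroup K G" and T: "T \<in> VN G (carrier G)"
  shows "group_expectation K T (delta \<one>) = cutoff K (T (delta \<one>))"
  by (rule group_expectation_apply[OF K T l2_delta])
    (use subgroup.one_closed[OF K] in \<open>auto simp: delta_def\<close>)

lemma group_expectation_VN:
  assumes K: "subgroup K G" and T: "T \<in> VN G (carrier G)"
  shows "group_expectation K T \<in> VN G K"
  unfolding VN_iff[OF K]
proof (intro conjI ballI allI impI)
  show "group_expectation K T \<in> bounded_ops (carrier G)"
    using T VN_bounded[OF subgroup_self T] by (simp add: group_expectation_def block_diagonal_bounded)
  show "group_expectation K T (delta \<one>) g = 0" if "g \<notin> K" for g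
    using that by (simp add: group_expectation_one[OF K T] cutoff_def)
  show "group_expectation K T (delta h) g = group_expectation K T (delta \<one>) (g \<otimes> inv h)"
    if g: "g \<in> carrier G" and h: "h \<in> carrier G" for g h
  proof -
    have "cutoff {x. K #> x = K #> g} (delta h) = (if g \<otimes> inv h \<in> K then delta h else (\<lambda>_. 0))"
      using r_coset_eq_iff[OF K g h] by (auto simp: cutoff_def delta_def fun_eq_iff)
    then have "group_expectation K T (delta h) g = (if g \<otimes> inv h \<in> K then T (delta h) g else 0)"
      using g h T bounded_op_zero[OF VN_bounded[OF subgroup_self T]]
      by (simp add: group_expectation_def block_diagonal_def)
    then show ?thesis
      using VN_matrix[OF subgroup_self T g h] by (simp add: group_expectation_one[OF K T] cutoff_def)
  qed
qed

lemma cutoff_VN: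
  assumes K: "subgroup K G" and R: "R \<in> VN G K" and f: "f \<in> l2 (carrier G)"
  shows "cutoff K (R f) = R (cutoff K f)"
proof -
  have "op_mult (carrier G) R (l2_projection (carrier G) K) = op_mult (carrier G) (l2_projection (carrier G) K) R"
    using R l2_projection_commutant[OF K] unfolding VN_double_commutant(1)[OF K] by (rule commutant_commutes)
  from fun_cong[OF this, of f] show ?thesis
    using f bounded_op_closed[OF VN_bounded[OF K R] f] by (simp add: l2_projection_def)
qed

lemma trace_preserving_group_expectation:
  assumes K: "subgroup K G"
  shows "trace_preserving_expectation (carrier G) (VN G (carrier G)) (group_trace G) (VN G K) (group_expectation K)"
  unfolding trace_preserving_expectation_def
proof (intro conjI ballI allI impI)
  let ?I = "carrier G" and ?M = "VN G (carrier G)" and ?E = "group_expectation K"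
  note M = star_subalgebraD[OF star_subalgebra_VN[OF subgroup_self]]
  note N = star_subalgebraD[OF star_subalgebra_VN[OF K]]
  note EM = group_expectation_VN[OF K, THEN subsetD[OF VN_subset[OF K]]]
  note NM = subsetD[OF VN_subset[OF K]]
  have d: "T (delta \<one>) \<in> l2 ?I" if "T \<in> ?M" for T
    using bounded_op_closed[OF VN_bounded[OF subgroup_self that]] by simp
  show "?E \<in> ?M \<rightarrow>\<^sub>E VN G K"
    using group_expectation_VN[OF K] by (auto simp: group_expectation_def)
  show "?E (op_add ?I S T) = op_add ?I (?E S) (?E T)" if "S \<in> ?M" "T \<in> ?M" for S T
    by (rule VN_separating) (use that in \<open>simp_all add: EM M(2) group_expectation_one[OF K] cutoff_add\<close>)
  show "?E (op_scale ?I c T) = op_scale ?I c (?E T)" if "T \<in> ?M" for c T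
    by (rule VN_separating) (use that in \<open>simp_all add: EM M(4) group_expectation_one[OF K] cutoff_scale\<close>)
  show "positive_op ?I (?E T)" if "T \<in> ?M" "positive_op ?I T" for T
    using that by (simp add: group_expectation_def block_diagonal_positive)
  show "?E T = T" if T: "T \<in> VN G K" for T
  proof (rule VN_separating)
    show "?E T (delta \<one>) = T (delta \<one>)"
      using VN_support[OF K T] by (auto simp: group_expectation_one[OF K NM[OF T]] cutoff_def)
  qed (use T EM NM in auto)
  show "?E (op_mult ?I R (op_mult ?I T S)) = op_mult ?I R (op_mult ?I (?E T) S)"
    if R: "R \<in> VN G K" and S: "S \<in> VN G K" and T: "T \<in> ?M" for R S T
  proof (rule VN_separating)
    have "?E T (S (delta \<one>)) = cutoff K (T (S (delta \<one>)))"
      by (rule group_expectation_apply[OF K T d[OF NM[OF S]]]) (rule VN_support[OF K S])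
    moreover have "T (S (delta \<one>)) \<in> l2 ?I"
      by (rule bounded_op_closed[OF VN_bounded[OF subgroup_self T] d[OF NM[OF S]]])
    ultimately show "?E (op_mult ?I R (op_mult ?I T S)) (delta \<one>) = op_mult ?I R (op_mult ?I (?E T) S) (delta \<one>)"
      using R S T by (simp add: group_expectation_one[OF K] M(3) NM cutoff_VN[OF K R])
  qed (use R S T in \<open>simp_all add: EM NM M(3)\<close>)
  show "group_trace G (?E T) = group_trace G T" if "T \<in> ?M" for T
    using subgroup.one_closed[OF K] by (simp add: group_trace_eq group_expectation_one[OF K that] cutoff_def)
qed

text \<open>The Fourier coefficient of an operator at \<open>k\<close> is a trace: that of its product with the left
  translation by \<open>inv k\<close>. So a trace preserving bimodule map is determined by its range.\<close>
lemma trace_preserving_expectation_unique: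
  assumes K: "subgroup K G"
    and E: "trace_preserving_expectation (carrier G) (VN G (carrier G)) (group_trace G) (VN G K) E"
  shows "E = group_expectation K"
proof (rule extensionalityI[where A = "VN G (carrier G)"])
  let ?I = "carrier G" and ?M = "VN G (carrier G)"
  note NM = subsetD[OF VN_subset[OF K]]
  have EV: "E \<in> ?M \<rightarrow>\<^sub>E VN G K"
    and bimod: "\<And>R S T. R \<in> VN G K \<Longrightarrow> S \<in> VN G K \<Longrightarrow> T \<in> ?M \<Longrightarrow>
      E (op_mult ?I R (op_mult ?I T S)) = op_mult ?I R (op_mult ?I (E T) S)"
    and tr: "\<And>T. T \<in> ?M \<Longrightarrow> group_trace G (E T) = group_trace G T"
    using E by (auto simp: trace_preserving_expectation_def)
  show "E \<in> extensional ?M" "group_expectation K \<in> extensional ?M"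
    using EV by (auto simp: group_expectation_def PiE_def)
  fix T
  assume T: "T \<in> ?M"
  have ET: "E T \<in> VN G K"
    using EV T by auto
  have id: "op_id ?I \<in> VN G K"
    unfolding VN_double_commutant(1)[OF K] by (rule op_id_commutant[OF commutant_bounded])
  have coeff: "group_trace G (op_mult ?I (left_regular G (inv k)) S) = S (delta \<one>) k"
    if "S \<in> ?M" "k \<in> carrier G" for S k
    using that bounded_op_closed[OF VN_bounded[OF subgroup_self that(1)], of "delta \<one>"]
    by (simp add: group_trace_eq left_regular_apply)
  have "E T (delta \<one>) k = T (delta \<one>) k" if k: "k \<in> K" for k
  proof -
    have kc: "k \<in> carrier G" and L: "left_regular G (inv k) \<in> VN G K"
      using subgroup.mem_carrier[OF K k] left_regular_VN[OF K subgroup.m_inv_closed[OF K k]] by auto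
    have "op_mult ?I (left_regular G (inv k)) (E T) = E (op_mult ?I (left_regular G (inv k)) T)"
      using bimod[OF L id T] VN_bounded[OF subgroup_self T] VN_bounded[OF K ET] by (simp add: op_mult_id_right)
    then have "E T (delta \<one>) k = group_trace G (E (op_mult ?I (left_regular G (inv k)) T))"
      using coeff[OF NM[OF ET] kc] by simp
    also have "\<dots> = group_trace G (op_mult ?I (left_regular G (inv k)) T)"
      using star_subalgebraD(3)[OF star_subalgebra_VN[OF subgroup_self] NM[OF L] T] by (rule tr)
    finally show ?thesis
      using coeff[OF T kc] by simp
  qed
  then have "E T (delta \<one>) = cutoff K (T (delta \<one>))"
    using VN_support[OF K ET] by (auto simp: cutoff_def)
  then show "E T = group_expectation K T"
    by (intro VN_separating NM ET group_expectation_VN[OF K] T) (simp add: group_expectation_one[OF K T])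
qed

lemma cond_expectation_VN:
  assumes "subgroup K G"
  shows "cond_expectation (carrier G) (VN G (carrier G)) (group_trace G) (VN G K) = group_expectation K"
  unfolding cond_expectation_def
  by (rule the_equality[where P = "trace_preserving_expectation (carrier G) (VN G (carrier G)) (group_trace G) (VN G K)"])
    (rule trace_preserving_group_expectation[OF assms], rule trace_preserving_expectation_unique[OF assms])

end

section \<open>Conjugation by a unitary\<close>

definition op_conj :: "'a set \<Rightarrow> 'a l2op \<Rightarrow> 'a l2op \<Rightarrow> 'a l2op" where
  "op_conj I u T = op_mult I u (op_mult I T (op_adj I u))"

lemma conjugate_ops_eq: "conjugate_ops I u A = op_conj I u ` A"
  by (simp add: conjugate_ops_def op_conj_def)

context
  fixes I :: "'a set" and u :: "'a l2op"
  assumes u: "unitary_op I u"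
begin

lemma unitary_bounded: "u \<in> bounded_ops I" and unitary_adj_bounded: "op_adj I u \<in> bounded_ops I"
  using u by (auto simp: unitary_op_def op_adj_bounded)

lemma unitary_adj_cancel:
  assumes f: "f \<in> l2 I"
  shows "op_adj I u (u f) = f" "u (op_adj I u f) = f"
proof -
  have "op_mult I (op_adj I u) u f = op_id I f" "op_mult I u (op_adj I u) f = op_id I f"
    using u by (simp_all add: unitary_op_def)
  then show "op_adj I u (u f) = f" "u (op_adj I u f) = f"
    using f by simp_all
qed

lemma op_conj_apply: "f \<in> l2 I \<Longrightarrow> op_conj I u T f = u (T (op_adj I u f))"
  using bounded_op_closed[OF unitary_adj_bounded] by (simp add: op_conj_def)

lemma op_conj_bounded: "T \<in> bounded_ops I \<Longrightarrow> op_conj I u T \<in> bounded_ops I"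
  by (simp add: op_conj_def op_mult_bounded unitary_bounded unitary_adj_bounded)

lemma op_conj_inverse:
  assumes T: "T \<in> bounded_ops I"
  shows "op_conj I u (op_conj I (op_adj I u) T) = T" "op_conj I (op_adj I u) (op_conj I u T) = T"
proof -
  have cl: "R f \<in> l2 I" if "R \<in> bounded_ops I" "f \<in> l2 I" for R f
    using that by (rule bounded_op_closed)
  show "op_conj I u (op_conj I (op_adj I u) T) = T"
    by (rule bounded_op_ext[where I = I])
      (use T in \<open>simp_all add: op_conj_def op_mult_bounded unitary_bounded unitary_adj_bounded
        unitary_adj_cancel cl[OF T] cl[OF unitary_bounded] cl[OF unitary_adj_bounded]\<close>)
  show "op_conj I (op_adj I u) (op_conj I u T) = T"
    by (rule bounded_op_ext[where I = I])
      (use T in \<open>simp_all add: op_conj_def op_mult_bounded unitary_bounded unitary_adj_bounded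
        unitary_adj_cancel cl[OF T] cl[OF unitary_bounded] cl[OF unitary_adj_bounded]\<close>)
qed

lemma op_conj_add:
  assumes S: "S \<in> bounded_ops I" and T: "T \<in> bounded_ops I"
  shows "op_conj I u (op_add I S T) = op_add I (op_conj I u S) (op_conj I u T)"
  by (rule bounded_op_ext[where I = I])
    (simp_all add: op_conj_bounded op_add_bounded S T op_conj_apply
      bounded_op_closed[OF unitary_adj_bounded] bounded_op_closed[OF S] bounded_op_closed[OF T]
      bounded_op_add[OF unitary_bounded])

lemma op_conj_scale:
  assumes T: "T \<in> bounded_ops I"
  shows "op_conj I u (op_scale I c T) = op_scale I c (op_conj I u T)"
  by (rule bounded_op_ext[where I = I])
    (simp_all add: op_conj_bounded op_scale_bounded T op_conj_apply
      bounded_op_closed[OF unitary_adj_bounded] bounded_op_closed[OF T] bounded_op_scale[OF unitary_bounded])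

lemma op_conj_mult:
  assumes S: "S \<in> bounded_ops I" and T: "T \<in> bounded_ops I"
  shows "op_conj I u (op_mult I S T) = op_mult I (op_conj I u S) (op_conj I u T)"
  by (rule bounded_op_ext[where I = I])
    (simp_all add: op_conj_bounded op_mult_bounded S T op_conj_apply unitary_adj_cancel
      bounded_op_closed[OF unitary_adj_bounded] bounded_op_closed[OF unitary_bounded]
      bounded_op_closed[OF S] bounded_op_closed[OF T])

lemma op_conj_adj:
  assumes T: "T \<in> bounded_ops I"
  shows "op_conj I u (op_adj I T) = op_adj I (op_conj I u T)"
  by (simp add: op_conj_def op_adj_mult op_mult_bounded op_mult_assoc op_adj_bounded T unitary_bounded)

lemma op_conj_positive:
  assumes "positive_op I T"
  shows "positive_op I (op_conj I u T)"
  unfolding positive_op_def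
proof (intro conjI ballI)
  have T: "T \<in> bounded_ops I"
    using assms by (simp add: positive_op_def)
  show "op_conj I u T \<in> bounded_ops I"
    by (rule op_conj_bounded[OF T])
  fix f
  assume f: "f \<in> l2 I"
  have uf: "op_adj I u f \<in> l2 I"
    by (rule bounded_op_closed[OF unitary_adj_bounded f])
  have "l2_inner I (op_conj I u T f) f = l2_inner I (T (op_adj I u f)) (op_adj I u f)"
    using op_adj_inner[OF unitary_bounded bounded_op_closed[OF T uf] f] f by (simp add: op_conj_apply)
  then show "l2_inner I (op_conj I u T f) f \<in> \<real>" "0 \<le> Re (l2_inner I (op_conj I u T f) f)"
    using assms uf by (simp_all add: positive_op_def)
qed

lemma op_conj_closed: "star_subalgebra I M \<Longrightarrow> u \<in> M \<Longrightarrow> T \<in> M \<Longrightarrow> op_conj I u T \<in> M"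
  by (simp add: op_conj_def star_subalgebraD)

end

lemma trace_preserving_expectation_conj:
  assumes E: "trace_preserving_expectation I M tr N E"
    and M: "star_subalgebra I M" and "N \<subseteq> M"
    and u: "unitary_op I u" "u \<in> M"
    and tr: "\<And>T. T \<in> M \<Longrightarrow> tr (op_conj I u T) = tr T"
  shows "trace_preserving_expectation I M tr (op_conj I u ` N)
    (\<lambda>T\<in>M. op_conj I u (E (op_conj I (op_adj I u) T)))"
proof -
  let ?u' = "op_adj I u"
  let ?E = "\<lambda>T\<in>M. op_conj I u (E (op_conj I ?u' T))"
  have u': "unitary_op I ?u'" "?u' \<in> M"
    using u M by (simp_all add: unitary_op_adj star_subalgebraD)
  note Mb = subsetD[OF star_subalgebraD(1)[OF M]]
  note c = op_conj_closed[OF u(1) M u(2)] and c' = op_conj_closed[OF u'(1) M u'(2)]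
  note inv = op_conj_inverse[OF u(1) Mb]
  have EN: "E \<in> M \<rightarrow>\<^sub>E N"
    and E_add: "\<And>S T. S \<in> M \<Longrightarrow> T \<in> M \<Longrightarrow> E (op_add I S T) = op_add I (E S) (E T)"
    and E_scale: "\<And>c T. T \<in> M \<Longrightarrow> E (op_scale I c T) = op_scale I c (E T)"
    and E_pos: "\<And>T. T \<in> M \<Longrightarrow> positive_op I T \<Longrightarrow> positive_op I (E T)"
    and E_id: "\<And>T. T \<in> N \<Longrightarrow> E T = T"
    and E_bimod: "\<And>R S T. R \<in> N \<Longrightarrow> S \<in> N \<Longrightarrow> T \<in> M \<Longrightarrow>
      E (op_mult I R (op_mult I T S)) = op_mult I R (op_mult I (E T) S)"
    and E_tr: "\<And>T. T \<in> M \<Longrightarrow> tr (E T) = tr T"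
    using E by (auto simp: trace_preserving_expectation_def)
  have EN': "E T \<in> N" "E T \<in> M" if "T \<in> M" for T
    using EN that \<open>N \<subseteq> M\<close> by auto
  note NM = subsetD[OF \<open>N \<subseteq> M\<close>]
  show ?thesis
    unfolding trace_preserving_expectation_def
  proof (intro conjI ballI allI impI)
    show "?E \<in> M \<rightarrow>\<^sub>E op_conj I u ` N"
      using EN' c' by auto
    show "?E (op_add I S T) = op_add I (?E S) (?E T)" if "S \<in> M" "T \<in> M" for S T
      using that by (simp add: star_subalgebraD[OF M] op_conj_add[OF u'(1)] op_conj_add[OF u(1)] Mb E_add c' EN')
    show "?E (op_scale I a T) = op_scale I a (?E T)" if "T \<in> M" for a T
      using that by (simp add: star_subalgebraD[OF M] op_conj_scale[OF u'(1)] op_conj_scale[OF u(1)] Mb E_scale c' EN')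
    show "positive_op I (?E T)" if "T \<in> M" "positive_op I T" for T
      using that by (simp add: op_conj_positive[OF u(1)] op_conj_positive[OF u'(1)] E_pos c')
    show "?E T = T" if "T \<in> op_conj I u ` N" for T
      using that NM by (auto simp: c inv E_id)
    show "?E (op_mult I R (op_mult I T S)) = op_mult I R (op_mult I (?E T) S)"
      if RS_in: "R \<in> op_conj I u ` N" "S \<in> op_conj I u ` N" and T: "T \<in> M" for R S T
    proof -
      obtain R0 S0 where RS: "R0 \<in> N" "S0 \<in> N" "R = op_conj I u R0" "S = op_conj I u S0"
        using RS_in by blast
      have "op_conj I ?u' (op_mult I R (op_mult I T S)) = op_mult I R0 (op_mult I (op_conj I ?u' T) S0)"
        using RS NM T by (simp add: op_conj_mult[OF u'(1)] op_mult_bounded Mb c inv)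
      then have "?E (op_mult I R (op_mult I T S)) = op_conj I u (op_mult I R0 (op_mult I (E (op_conj I ?u' T)) S0))"
        using RS NM T by (simp add: star_subalgebraD[OF M] c c' E_bimod)
      then show ?thesis
        using RS NM T by (simp add: op_conj_mult[OF u(1)] op_mult_bounded Mb EN' c')
    qed
    show "tr (?E T) = tr T" if "T \<in> M" for T
      using that tr[OF c'[OF that]] by (simp add: tr EN' c' E_tr inv)
  qed
qed

section \<open>Strong singularity from a combinatorial criterion\<close>

context group
begin

lemma group_trace_conj:
  assumes u: "unitary_op (carrier G) u" "u \<in> VN G (carrier G)" and T: "T \<in> VN G (carrier G)"
  shows "group_trace G (op_conj (carrier G) u T) = group_trace G T"
proof -
  let ?I = "carrier G"
  note M = star_subalgebraD[OF star_subalgebra_VN[OF subgroup_self]]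
  note b = VN_bounded[OF subgroup_self]
  have "group_trace G (op_conj ?I u T) = group_trace G (op_mult ?I (op_mult ?I T (op_adj ?I u)) u)"
    unfolding op_conj_def by (rule group_trace_commute) (use u T M in auto)
  also have "op_mult ?I (op_mult ?I T (op_adj ?I u)) u = T"
    using u T b by (simp add: op_mult_assoc unitary_op_def op_mult_id_right)
  finally show ?thesis .
qed

lemma norm2_conj:
  assumes u: "unitary_op (carrier G) u" "u \<in> VN G (carrier G)" and T: "T \<in> VN G (carrier G)"
  shows "norm2 (carrier G) (group_trace G) (op_conj (carrier G) u T) = norm2 (carrier G) (group_trace G) T"
proof -
  note M = star_subalgebraD[OF star_subalgebra_VN[OF subgroup_self]]
  have Tb: "T \<in> bounded_ops (carrier G)"
    by (rule VN_bounded[OF subgroup_self T])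
  show ?thesis
    unfolding norm2_def op_conj_adj[OF u(1) Tb, symmetric]
      op_conj_mult[OF u(1) op_adj_bounded[OF Tb] Tb, symmetric]
    using group_trace_conj[OF u] M T by simp
qed

text \<open>Conjugation by \<open>u\<close> and by its adjoint transports expectations between \<open>VN G K\<close> and its
  conjugate, so uniqueness for the conjugate follows from uniqueness for \<open>VN G K\<close>.\<close>
lemma cond_expectation_conjugate:
  assumes K: "subgroup K G" and u: "unitary_op (carrier G) u" "u \<in> VN G (carrier G)"
    and T: "T \<in> VN G (carrier G)"
  shows "cond_expectation (carrier G) (VN G (carrier G)) (group_trace G) (conjugate_ops (carrier G) u (VN G K)) T
    = op_conj (carrier G) u (group_expectation K (op_conj (carrier G) (op_adj (carrier G) u) T))"
proof -
  let ?I = "carrier G" and ?M = "VN G (carrier G)" and ?u' = "op_adj (carrier G) u"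
  let ?E = "\<lambda>T\<in>?M. op_conj ?I u (group_expectation K (op_conj ?I ?u' T))"
  note M = star_subalgebra_VN[OF subgroup_self]
  note b = VN_bounded[OF subgroup_self]
  have u': "unitary_op ?I ?u'" "?u' \<in> ?M"
    using u star_subalgebraD[OF M] by (simp_all add: unitary_op_adj)
  have adj2: "op_adj ?I ?u' = u"
    using u(2) b by simp
  have "cond_expectation ?I ?M (group_trace G) (conjugate_ops ?I u (VN G K)) = ?E"
    unfolding cond_expectation_def
  proof (rule the_equality)
    show "trace_preserving_expectation ?I ?M (group_trace G) (conjugate_ops ?I u (VN G K)) ?E"
      unfolding conjugate_ops_eq
      by (rule trace_preserving_expectation_conj[OF trace_preserving_group_expectation[OF K] M VN_subset[OF K] u])
        (rule group_trace_conj[OF u])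
    fix F
    assume F: "trace_preserving_expectation ?I ?M (group_trace G) (conjugate_ops ?I u (VN G K)) F"
    have sub: "op_conj ?I u ` VN G K \<subseteq> ?M"
      using VN_subset[OF K] op_conj_closed[OF u(1) M u(2)] by auto
    have "op_conj ?I ?u' ` op_conj ?I u ` VN G K = VN G K"
      using VN_bounded[OF K] op_conj_inverse(2)[OF u(1)] by (force simp: image_image)
    then have F_eq: "(\<lambda>T\<in>?M. op_conj ?I ?u' (F (op_conj ?I u T))) = group_expectation K"
      using trace_preserving_expectation_conj[OF F[unfolded conjugate_ops_eq] M sub u' group_trace_conj[OF u']]
      by (intro trace_preserving_expectation_unique[OF K]) (simp add: adj2)
    have eq: "op_conj ?I ?u' (F (op_conj ?I u S)) = group_expectation K S" if "S \<in> ?M" for S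
      using fun_cong[OF F_eq, of S] that by simp
    show "F = ?E"
    proof (rule extensionalityI[where A = ?M])
      show "F \<in> extensional ?M" "?E \<in> extensional ?M"
        using F by (auto simp: trace_preserving_expectation_def PiE_def)
      fix S
      assume S: "S \<in> ?M"
      then have S': "op_conj ?I ?u' S \<in> ?M"
        by (rule op_conj_closed[OF u'(1) M u'(2)])
      have "F S \<in> op_conj ?I u ` VN G K"
        using F S by (intro PiE_mem[of F ?M]) (simp_all add: trace_preserving_expectation_def conjugate_ops_eq)
      then have "F S = op_conj ?I u (op_conj ?I ?u' (F S))"
        using op_conj_inverse(1)[OF u(1) b[OF subsetD[OF sub]]] by simp
      then show "F S = ?E S"
        using S eq[OF S'] op_conj_inverse(1)[OF u(1) b[OF S]] by simp
    qed
  qed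
  then show ?thesis
    using T by simp
qed

text \<open>Write \<open>a = u (delta \<one>)\<close>. The part of \<open>a\<close> supported on \<open>K\<close> contributes at most its norm, since
  \<open>op_adj u\<close> and \<open>left_regular G k\<close> are isometries. The part off \<open>K\<close> is nearly supported on a finite set
  \<open>F\<close>, and the coefficients of \<open>op_adj u\<close> are nearly supported on a finite set \<open>H\<close>. The value at \<open>g \<in> K\<close> of
  \<open>op_adj u (delta (k \<otimes> y))\<close> is a coefficient at \<open>z\<close> with \<open>z \<otimes> k \<otimes> y = g \<in> K\<close>; the criterion provides
  \<open>k\<close> for which no such \<open>z\<close> lies in \<open>H\<close>.\<close>
lemma translation_asymptotics:
  assumes K: "subgroup K G"
    and crit: "\<And>X. finite X \<Longrightarrow> X \<subseteq> carrier G - K \<Longrightarrow> \<exists>k\<in>K. \<forall>x\<in>X. \<forall>y\<in>X. x \<otimes> k \<otimes> y \<notin> K"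
    and u: "unitary_op (carrier G) u" "u \<in> VN G (carrier G)" and "0 < e"
  shows "\<exists>k\<in>K. l2_norm (carrier G) (cutoff K (op_adj (carrier G) u (left_regular G k (u (delta \<one>)))))
    \<le> l2_norm (carrier G) (cutoff K (u (delta \<one>))) + e"
proof -
  let ?I = "carrier G" and ?u' = "op_adj (carrier G) u"
  let ?n = "l2_norm ?I"
  define a where "a = u (delta \<one>)"
  define b where "b = (\<lambda>x. a x - cutoff K a x)"
  define c where "c = ?u' (delta \<one>)"
  have u': "unitary_op ?I ?u'" "?u' \<in> VN G (carrier G)"
    using u star_subalgebraD[OF star_subalgebra_VN[OF subgroup_self]] by (simp_all add: unitary_op_adj)
  have ub: "u \<in> bounded_ops ?I" "?u' \<in> bounded_ops ?I"
    using u u' VN_bounded[OF subgroup_self] by auto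
  have a: "a \<in> l2 ?I" and b: "b \<in> l2 ?I" and c: "c \<in> l2 ?I"
    unfolding a_def b_def c_def by (intro l2_diff l2_cutoff bounded_op_closed[OF ub(1)] bounded_op_closed[OF ub(2)] l2_delta one_closed)+
  obtain F where F: "finite F" "F \<subseteq> ?I" "?n (\<lambda>x. b x - cutoff F b x) < e / 2"
    using l2_approx_finite[OF b, of "e / 2"] \<open>0 < e\<close> by auto
  \<comment> \<open>Summed over \<open>F - K\<close> with weights \<open>b y\<close>, errors of size \<open>d\<close> contribute at most \<open>e / 2\<close>; the
    summand \<open>1\<close> avoids a division by zero.\<close>
  define d where "d = e / (2 * (1 + (\<Sum>y\<in>F - K. cmod (b y))))"
  have pos: "0 \<le> (\<Sum>y\<in>F - K. cmod (b y))"
    by (simp add: sum_nonneg)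
  then have "0 < d"
    using \<open>0 < e\<close> by (simp add: d_def)
  then obtain H where H: "finite H" "H \<subseteq> ?I" "?n (\<lambda>x. c x - cutoff H c x) < d"
    using l2_approx_finite[OF c] by blast
  define r where "r = (\<lambda>x. c x - cutoff H c x)"
  have r: "r \<in> l2 ?I"
    unfolding r_def by (intro l2_diff l2_cutoff c)
  obtain k where k: "k \<in> K" and sep: "\<And>x y. x \<in> (F - K) \<union> (H - K) \<Longrightarrow> y \<in> (F - K) \<union> (H - K) \<Longrightarrow> x \<otimes> k \<otimes> y \<notin> K"
  proof -
    have "finite ((F - K) \<union> (H - K))" "(F - K) \<union> (H - K) \<subseteq> ?I - K"
      using F H by auto
    then show ?thesis
      using crit that by metis
  qed
  have kc: "k \<in> ?I"
    by (rule subgroup.mem_carrier[OF K k])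
  have small: "?n (cutoff K (?u' (delta (k \<otimes> y)))) \<le> d" if y: "y \<in> F - K" for y
  proof -
    have yc: "y \<in> ?I" "k \<otimes> y \<in> ?I"
      using y F(2) kc by auto
    have "?n (cutoff K (?u' (delta (k \<otimes> y)))) \<le> ?n (right_regular G (inv (k \<otimes> y)) r)"
    proof (rule l2_dominated(2))
      show "right_regular G (inv (k \<otimes> y)) r \<in> l2 ?I"
        by (rule bounded_op_closed[OF right_regular_bounded r]) (use yc in auto)
      show "cutoff K (?u' (delta (k \<otimes> y))) x = 0" if "x \<notin> ?I" for x
        using that subgroup.subset[OF K] by (auto simp: cutoff_def)
      show "cmod (cutoff K (?u' (delta (k \<otimes> y))) x) \<le> cmod (right_regular G (inv (k \<otimes> y)) r x)" if x: "x \<in> ?I" for x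
      proof (cases "x \<in> K")
        case True
        define z where "z = x \<otimes> inv (k \<otimes> y)"
        have z: "z \<in> ?I" "z \<otimes> k \<otimes> y = x"
          using x yc kc by (simp_all add: z_def m_assoc)
        have "z \<notin> H"
        proof
          assume "z \<in> H"
          have "z \<notin> K"
          proof
            assume "z \<in> K"
            then have "inv (z \<otimes> k) \<otimes> x \<in> K"
              using K k True by (simp add: subgroup.m_closed subgroup.m_inv_closed)
            moreover have "inv (z \<otimes> k) \<otimes> x = y"
              using inv_solve_left'[of y "z \<otimes> k" x] z x yc kc by simp
            ultimately show False
              using y by simp
          qed
          then show False
            using sep[of z y] \<open>z \<in> H\<close> y z(2) True by auto
        qed
        then have "c z = r z"
          by (simp add: r_def cutoff_def)
        moreover have "?u' (delta (k \<otimes> y)) x = c z"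
          using VN_matrix[OF subgroup_self u'(2) x yc(2)] by (simp add: c_def z_def)
        ultimately show ?thesis
          using r x by (simp add: cutoff_def right_regular_apply z_def)
      qed (simp add: cutoff_def)
    qed
    also have "\<dots> = ?n r"
      unfolding right_regular_def by (rule permutation_op_isometric) (use yc r bij_right_mult in auto)
    also have "\<dots> \<le> d"
      using H(3) by (simp add: r_def)
    finally show ?thesis .
  qed
  define W where "W = (\<lambda>f. ?u' (left_regular G k f))"
  have W: "W f \<in> l2 ?I" "?n (W f) = ?n f" if "f \<in> l2 ?I" for f
    using that kc bounded_op_closed[OF left_regular_bounded[OF kc] that] bounded_op_closed[OF ub(2)]
      unitary_op_isometric[OF u'(1)] left_regular_isometric
    by (simp_all add: W_def)
  have W_add: "W (\<lambda>x. f x + g x) = (\<lambda>x. W f x + W g x)" if "f \<in> l2 ?I" "g \<in> l2 ?I" for f g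
    using that kc bounded_op_closed[OF left_regular_bounded[OF kc]]
    by (simp add: W_def bounded_op_add[OF left_regular_bounded[OF kc]] bounded_op_add[OF ub(2)])
  define p where "p = (\<lambda>x. b x - cutoff F b x)"
  define q where "q = cutoff F b"
  have l2s: "cutoff K a \<in> l2 ?I" "p \<in> l2 ?I" "q \<in> l2 ?I"
    unfolding p_def q_def by (intro l2_diff l2_cutoff a b)+
  have split: "a = (\<lambda>x. cutoff K a x + (p x + q x))"
    by (auto simp: p_def q_def b_def)
  have "W a = W (\<lambda>x. cutoff K a x + (p x + q x))"
    by (rule arg_cong[OF split])
  also have "\<dots> = (\<lambda>x. W (cutoff K a) x + (W p x + W q x))"
    by (simp add: W_add l2s l2_add)
  finally have "cutoff K (W a) = (\<lambda>x. cutoff K (W (cutoff K a)) x + (cutoff K (W p) x + cutoff K (W q) x))"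
    by (simp add: cutoff_add)
  then have "?n (cutoff K (W a)) \<le> ?n (cutoff K (W (cutoff K a))) + ?n (\<lambda>x. cutoff K (W p) x + cutoff K (W q) x)"
    using l2_norm_triangle[of "cutoff K (W (cutoff K a))" ?I "\<lambda>x. cutoff K (W p) x + cutoff K (W q) x"]
    by (simp add: W l2s l2_add)
  also have "\<dots> \<le> ?n (cutoff K (W (cutoff K a))) + (?n (cutoff K (W p)) + ?n (cutoff K (W q)))"
    using l2_norm_triangle[of "cutoff K (W p)" ?I "cutoff K (W q)"] by (simp add: W l2s)
  also have "?n (cutoff K (W (cutoff K a))) \<le> ?n (cutoff K a)"
    using l2_norm_cutoff[OF W(1)[OF l2s(1)]] W(2)[OF l2s(1)] by simp
  also have "?n (cutoff K (W p)) \<le> e / 2"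
    using l2_norm_cutoff[OF W(1)[OF l2s(2)], of K] W(2)[OF l2s(2)] F(3) by (simp add: p_def)
  also have "?n (cutoff K (W q)) \<le> e / 2"
  proof -
    have q_sum: "q = (\<lambda>x. \<Sum>y\<in>F - K. b y * delta y x)"
    proof
      fix x
      have "b x = 0" if "x \<in> K"
        using that by (simp add: b_def cutoff_def)
      then show "q x = (\<Sum>y\<in>F - K. b y * delta y x)"
        using F(1) by (auto simp: q_def cutoff_def delta_def if_distrib sum.delta cong: if_cong)
    qed
    have "W q = (\<lambda>x. \<Sum>y\<in>F - K. b y * ?u' (delta (k \<otimes> y)) x)"
    proof -
      let ?V = "op_mult ?I ?u' (left_regular G k)"
      have V: "op_mult ?I ?u' (left_regular G k) \<in> bounded_ops ?I"
        by (rule op_mult_bounded[OF ub(2) left_regular_bounded[OF kc]])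
      have d: "y \<in> ?I" "delta y \<in> l2 ?I" if "y \<in> F - K" for y
        using that F(2) by auto
      have "W q = ?V (\<lambda>x. \<Sum>y\<in>F - K. b y * delta y x)"
        using l2s(3) by (simp add: W_def q_sum[symmetric])
      also have "\<dots> = (\<lambda>x. \<Sum>y\<in>F - K. ?V (\<lambda>x. b y * delta y x) x)"
        by (rule bounded_op_sum[OF V]) (simp add: d l2_scale)
      also have "\<dots> = (\<lambda>x. \<Sum>y\<in>F - K. b y * ?u' (delta (k \<otimes> y)) x)"
      proof (intro ext sum.cong refl)
        fix x y
        assume "y \<in> F - K"
        then show "?V (\<lambda>x. b y * delta y x) x = b y * ?u' (delta (k \<otimes> y)) x"
          using d[of y] kc by (simp only: bounded_op_scale[OF V]) (simp add: left_regular_delta)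
      qed
      finally show ?thesis .
    qed
    then have "cutoff K (W q) = (\<lambda>x. \<Sum>y\<in>F - K. b y * cutoff K (?u' (delta (k \<otimes> y))) x)"
      by (auto simp: cutoff_def)
    then have "?n (cutoff K (W q)) \<le> (\<Sum>y\<in>F - K. ?n (\<lambda>x. b y * cutoff K (?u' (delta (k \<otimes> y))) x))"
      using F(2) kc bounded_op_closed[OF ub(2)] by (auto intro!: l2_norm_sum_le l2_scale)
    also have "\<dots> \<le> (\<Sum>y\<in>F - K. cmod (b y) * d)"
    proof (rule sum_mono)
      fix y
      assume y: "y \<in> F - K"
      then have "cutoff K (?u' (delta (k \<otimes> y))) \<in> l2 ?I"
        using F(2) kc bounded_op_closed[OF ub(2)] by (auto intro!: l2_cutoff)
      then show "?n (\<lambda>x. b y * cutoff K (?u' (delta (k \<otimes> y))) x) \<le> cmod (b y) * d"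
        using mult_left_mono[OF small[OF y], of "cmod (b y)"] by (simp add: l2_norm_scale)
    qed
    also have "\<dots> = (\<Sum>y\<in>F - K. cmod (b y)) * d"
      by (simp add: sum_distrib_right)
    also have "\<dots> \<le> e / 2"
      using pos \<open>0 < e\<close> by (simp add: d_def field_simps)
    finally show ?thesis .
  qed
  finally have "?n (cutoff K (W a)) \<le> ?n (cutoff K a) + (e / 2 + e / 2)"
    by simp
  then show ?thesis
    using k by (auto simp: W_def a_def)
qed

lemma op_norm_left_regular: "k \<in> carrier G \<Longrightarrow> op_norm (carrier G) (left_regular G k) \<le> 1"
  unfolding op_norm_def
  by (rule cSUP_least) (auto simp: left_regular_isometric intro!: exI[of _ "\<lambda>_. 0"])

text \<open>The translations by \<open>K\<close> lie in their own commutant, so their double commutant lies in it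
  as well.\<close>
lemma VN_abelian:
  assumes K: "subgroup K G" and comm: "\<And>x y. x \<in> K \<Longrightarrow> y \<in> K \<Longrightarrow> x \<otimes> y = y \<otimes> x"
  shows "abelian_ops (carrier G) (VN G K)"
proof -
  let ?C = "commutant (carrier G)" and ?L = "left_regular G ` K"
  have c: "x \<in> carrier G" if "x \<in> K" for x
    using subgroup.mem_carrier[OF K that] .
  have "op_mult (carrier G) (left_regular G g) (left_regular G h)
      = op_mult (carrier G) (left_regular G h) (left_regular G g)" if "g \<in> K" "h \<in> K" for g h
    by (rule bounded_op_eq_delta[where I = "carrier G"])
      (use that c comm[OF that] in \<open>simp_all add: op_mult_bounded left_regular_delta m_assoc[symmetric]\<close>)
  then have "?L \<subseteq> ?C ?L"
    using c by (auto simp: commutant_def)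
  then have "?C (?C ?L) \<subseteq> ?C ?L"
    by (rule commutant_antimono)
  then show ?thesis
    unfolding abelian_ops_def VN_double_commutant(1)[OF K] by (meson commutant_commutes subsetD)
qed

text \<open>If \<open>T\<close> commutes with the translations by \<open>K\<close>, then its coefficients are constant on \<open>K\<close>-conjugacy
  classes; as they are square summable, they vanish on infinite classes. By the criterion, applied to
  the inverses of the members of the class together with one member, the classes off \<open>K\<close> are
  infinite.\<close>
lemma relative_commutant_VN:
  assumes K: "subgroup K G"
    and crit: "\<And>X. finite X \<Longrightarrow> X \<subseteq> carrier G - K \<Longrightarrow> \<exists>k\<in>K. \<forall>x\<in>X. \<forall>y\<in>X. x \<otimes> k \<otimes> y \<notin> K"
    and T: "T \<in> VN G (carrier G)"
    and comm: "\<And>k. k \<in> K \<Longrightarrow>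
      op_mult (carrier G) T (left_regular G k) = op_mult (carrier G) (left_regular G k) T"
  shows "T \<in> VN G K"
proof -
  define t where "t = T (delta \<one>)"
  have t: "t \<in> l2 (carrier G)"
    unfolding t_def by (rule bounded_op_closed[OF VN_bounded[OF subgroup_self T]]) simp
  have kc: "k \<in> carrier G" if "k \<in> K" for k
    using subgroup.mem_carrier[OF K that] .
  have conj: "t (k \<otimes> g \<otimes> inv k) = t g" if k: "k \<in> K" and g: "g \<in> carrier G" for k g
  proof -
    have "T (left_regular G k (delta \<one>)) (k \<otimes> g) = left_regular G k (T (delta \<one>)) (k \<otimes> g)"
      using fun_cong[OF comm[OF k], of "delta \<one>"] by simp
    then show ?thesis
      using k g kc t VN_matrix[OF subgroup_self T, of "k \<otimes> g" k]
      by (simp add: left_regular_delta left_regular_apply t_def[symmetric] m_assoc[symmetric])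
  qed
  have "t g = 0" if gK: "g \<notin> K" for g
  proof (rule ccontr)
    assume "t g \<noteq> 0"
    then have g: "g \<in> carrier G"
      using l2_outside[OF t] by blast
    define C where "C = (\<lambda>k. k \<otimes> g \<otimes> inv k) ` K"
    have C: "C \<subseteq> carrier G"
      using kc g by (auto simp: C_def)
    have "finite C"
    proof (rule ccontr)
      assume "infinite C"
      obtain n :: nat where n: "(l2_norm (carrier G) t)\<^sup>2 < real n * (cmod (t g))\<^sup>2"
        using \<open>t g \<noteq> 0\<close> reals_Archimedean3[of "(cmod (t g))\<^sup>2"] by auto
      obtain F where F: "F \<subseteq> C" "finite F" "card F = n"
        using infinite_arbitrarily_large[OF \<open>infinite C\<close>] by blast
      have "real n * (cmod (t g))\<^sup>2 = (\<Sum>x\<in>F. (cmod (t g))\<^sup>2)"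
        using F by simp
      also have "\<dots> = (\<Sum>x\<in>F. (cmod (t x))\<^sup>2)"
        by (rule sum.cong) (use F conj g in \<open>auto simp: C_def\<close>)
      also have "\<dots> \<le> (l2_norm (carrier G) t)\<^sup>2"
        using sum_le_l2_norm[OF t F(2)] F(1) C by auto
      finally show False
        using n by simp
    qed
    have inv_C: "inv x \<notin> K" if "x \<in> C" for x
    proof
      assume inv_x: "inv x \<in> K"
      obtain k where k: "k \<in> K" "x = k \<otimes> g \<otimes> inv k"
        using \<open>x \<in> C\<close> by (auto simp: C_def)
      have "x \<in> K"
        using subgroup.m_inv_closed[OF K inv_x] C \<open>x \<in> C\<close> by auto
      then have "inv k \<otimes> x \<otimes> k \<in> K"
        using k(1) K by (simp add: subgroup.m_closed subgroup.m_inv_closed)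
      moreover have "inv k \<otimes> x \<otimes> k = g"
      proof -
        have "inv k \<otimes> x = g \<otimes> inv k"
          using k kc g by (simp add: m_assoc[symmetric])
        then show ?thesis
          using k(1) kc g by (simp add: m_assoc)
      qed
      ultimately show False
        using gK by simp
    qed
    have "finite (insert g ((\<lambda>x. inv x) ` C))" "insert g ((\<lambda>x. inv x) ` C) \<subseteq> carrier G - K"
      using \<open>finite C\<close> inv_C C g gK by auto
    from crit[OF this] obtain k where k: "k \<in> K" "\<And>x. x \<in> C \<Longrightarrow> inv x \<otimes> k \<otimes> g \<notin> K"
      by blast
    define x where "x = k \<otimes> g \<otimes> inv k"
    have x: "x \<in> C" "x \<in> carrier G"
      using k(1) kc g by (auto simp: C_def x_def)
    have "x \<otimes> k = k \<otimes> g"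
      using k(1) kc g by (simp add: x_def m_assoc)
    then have "inv x \<otimes> k \<otimes> g = k"
      using k(1) kc g x(2) by (simp add: m_assoc inv_solve_left')
    then show False
      using k x by metis
  qed
  then show ?thesis
    using T unfolding VN_iff[OF subgroup_self] VN_iff[OF K] t_def by blast
qed

text \<open>For a unitary \<open>u\<close>, put \<open>w = op_adj u \<cdot> left_regular G k \<cdot> u\<close> with \<open>k \<in> K\<close>. The difference of the two
  expectations is tested at \<open>left_regular G k\<close>: its value there is conjugate to the part of \<open>w\<close>
  off \<open>K\<close>, whose norm is computed by Pythagoras from the part on \<open>K\<close>. For a suitable \<open>k\<close> the
  part on \<open>K\<close> exceeds that of \<open>u\<close> by an arbitrarily small amount.\<close>
theorem strongly_singular_masa_VN:
  assumes K: "subgroup K G" and comm: "\<And>x y. x \<in> K \<Longrightarrow> y \<in> K \<Longrightarrow> x \<otimes> y = y \<otimes> x"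
    and crit: "\<And>X. finite X \<Longrightarrow> X \<subseteq> carrier G - K \<Longrightarrow> \<exists>k\<in>K. \<forall>x\<in>X. \<forall>y\<in>X. x \<otimes> k \<otimes> y \<notin> K"
  shows "masa (carrier G) (VN G (carrier G)) (VN G K)"
    and "strongly_singular (carrier G) (VN G (carrier G)) (group_trace G) (VN G K)"
proof -
  let ?I = "carrier G" and ?M = "VN G (carrier G)" and ?A = "VN G K"
  let ?n = "l2_norm (carrier G)" and ?E = "group_expectation K"
  note M = star_subalgebra_VN[OF subgroup_self]
  note b = VN_bounded[OF subgroup_self]
  show "masa ?I ?M ?A"
    unfolding masa_def
  proof (intro conjI allI impI star_subalgebra_VN[OF K] VN_subset[OF K] VN_abelian[OF K comm])
    fix A'
    assume A': "star_subalgebra ?I A' \<and> abelian_ops ?I A' \<and> A' \<subseteq> ?M \<and> ?A \<subseteq> A'"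
    have "T \<in> ?A" if T: "T \<in> A'" for T
    proof (rule relative_commutant_VN[OF K crit])
      show "T \<in> ?M"
        using A' T by blast
      show "op_mult ?I T (left_regular G k) = op_mult ?I (left_regular G k) T" if "k \<in> K" for k
      proof -
        have "left_regular G k \<in> A'"
          using A' left_regular_VN[OF K that] by blast
        then show ?thesis
          using A' T unfolding abelian_ops_def by blast
      qed
    qed
    then show "A' = ?A"
      using A' by auto
  qed auto
  have "ereal (norm2 ?I (group_trace G) (op_diff ?I u (cond_expectation ?I ?M (group_trace G) ?A u)))
    \<le> norm_inf_2 ?I ?M (group_trace G)
        (\<lambda>x. op_diff ?I (cond_expectation ?I ?M (group_trace G) ?A x)
                       (cond_expectation ?I ?M (group_trace G) (conjugate_ops ?I u ?A) x))" (is "_ \<le> ?L")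
    if u: "unitary_op ?I u" "u \<in> ?M" for u
  proof -
    let ?u' = "op_adj ?I u"
    have u': "unitary_op ?I ?u'" "?u' \<in> ?M"
      using u star_subalgebraD[OF M] by (simp_all add: unitary_op_adj)
    note EM = group_expectation_VN[OF K, THEN subsetD[OF VN_subset[OF K]]]
    have off: "norm2 ?I (group_trace G) (op_diff ?I T (?E T)) = sqrt ((?n (T (delta \<one>)))\<^sup>2 - (?n (cutoff K (T (delta \<one>))))\<^sup>2)"
      if T: "T \<in> ?M" for T
    proof -
      have "norm2 ?I (group_trace G) (op_diff ?I T (?E T)) = ?n (\<lambda>x. T (delta \<one>) x - cutoff K (T (delta \<one>)) x)"
        using star_subalgebra_diff[OF M T EM[OF T]] by (simp add: norm2_group_trace b group_expectation_one[OF K T])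
      moreover have "T (delta \<one>) \<in> l2 ?I"
        by (rule bounded_op_closed[OF b[OF T]]) simp
      ultimately show ?thesis
        using l2_norm_cutoff_split[of "T (delta \<one>)" ?I K] by (simp add: real_sqrt_unique[symmetric])
    qed
    define q where "q = ?n (cutoff K (u (delta \<one>)))"
    have "?n (u (delta \<one>)) = 1"
      using unitary_op_isometric[OF u(1)] by simp
    then have rhs: "norm2 ?I (group_trace G) (op_diff ?I u (?E u)) = sqrt (1 - q\<^sup>2)"
      using off[OF u(2)] by (simp add: q_def)
    have lower: "ereal (sqrt (1 - (q + e)\<^sup>2)) \<le> ?L" if e: "0 < e" for e
    proof -
      obtain k where k: "k \<in> K" and le: "?n (cutoff K (?u' (left_regular G k (u (delta \<one>))))) \<le> q + e"
        using translation_asymptotics[OF K crit u e] by (auto simp: q_def)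
      let ?v = "left_regular G k"
      define w where "w = op_conj ?I ?u' ?v"
      have kc: "k \<in> ?I"
        by (rule subgroup.mem_carrier[OF K k])
      have v: "?v \<in> ?A" "?v \<in> ?M"
        using left_regular_VN[OF K k] VN_subset[OF K] by auto
      have w: "w \<in> ?M"
        unfolding w_def by (rule op_conj_closed[OF u'(1) M u'(2) v(2)])
      have w_one: "w (delta \<one>) = ?u' (?v (u (delta \<one>)))"
        using u b by (simp add: w_def op_conj_apply[OF u'(1)])
      have w_norm: "?n (w (delta \<one>)) = 1"
        unfolding w_one using bounded_op_closed[OF b[OF u(2)]] bounded_op_closed[OF left_regular_bounded[OF kc]]
        by (simp add: unitary_op_isometric[OF u'(1)] unitary_op_isometric[OF u(1)] left_regular_isometric kc)
      have "(?n (cutoff K (w (delta \<one>))))\<^sup>2 \<le> (q + e)\<^sup>2"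
        using le by (intro power_mono) (simp_all add: w_one)
      then have "sqrt (1 - (q + e)\<^sup>2) \<le> norm2 ?I (group_trace G) (op_diff ?I w (?E w))"
        using off[OF w] w_norm by simp
      also have "\<dots> = norm2 ?I (group_trace G) (op_conj ?I u (op_diff ?I w (?E w)))"
        using norm2_conj[OF u star_subalgebra_diff[OF M w EM[OF w]]] by simp
      also have "op_conj ?I u (op_diff ?I w (?E w)) = op_diff ?I ?v (op_conj ?I u (?E w))"
        using op_conj_inverse(1)[OF u(1) b[OF v(2)]] b w EM[OF w]
        by (simp add: op_diff_eq op_conj_add[OF u(1)] op_conj_scale[OF u(1)] op_scale_bounded w_def)
      also have "\<dots> = op_diff ?I (cond_expectation ?I ?M (group_trace G) ?A ?v)
          (cond_expectation ?I ?M (group_trace G) (conjugate_ops ?I u ?A) ?v)"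
        using cond_expectation_conjugate[OF K u v(2)] trace_preserving_group_expectation[OF K] v(1)
        by (simp add: cond_expectation_VN[OF K] w_def trace_preserving_expectation_def)
      finally show ?thesis
        unfolding norm_inf_2_def using v(2) op_norm_left_regular[OF kc]
        by (intro SUP_upper2[of ?v]) auto
    qed
    \<comment> \<open>The bounds hold for every \<open>e > 0\<close> with the same right-hand side, so they pass to the limit.\<close>
    have "(\<lambda>n. sqrt (1 - (q + inverse (real (Suc n)))\<^sup>2)) \<longlonglongrightarrow> sqrt (1 - (q + 0)\<^sup>2)"
      by (intro tendsto_intros LIMSEQ_inverse_real_of_nat)
    then have "(\<lambda>n. ereal (sqrt (1 - (q + inverse (real (Suc n)))\<^sup>2))) \<longlonglongrightarrow> ereal (sqrt (1 - q\<^sup>2))"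
      by simp
    then have "ereal (sqrt (1 - q\<^sup>2)) \<le> ?L"
      by (rule LIMSEQ_le_const2) (use lower in auto)
    then show ?thesis
      using rhs by (simp add: cond_expectation_VN[OF K])
  qed
  then show "strongly_singular ?I ?M (group_trace G) ?A"
    unfolding strongly_singular_def using VN_double_commutant(2)[OF K] VN_subset[OF K] by blast
qed

end

section \<open>Arrangements of hyperplanes\<close>

text \<open>A segment between points with values of opposite sign meets the hyperplane by the intermediate
  value theorem.\<close>
lemma same_side_iff:
  fixes a :: "'e::euclidean_space"
  shows "same_side {z. a \<bullet> z = b} x y \<longleftrightarrow> sgn (a \<bullet> x - b) = sgn (a \<bullet> y - b)"
proof -
  have lt: "closed_segment x y \<subseteq> {z. a \<bullet> z < b}" if "a \<bullet> x < b" "a \<bullet> y < b"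
    using that by (intro closed_segment_subset convex_halfspace_lt) auto
  have gt: "closed_segment x y \<subseteq> {z. a \<bullet> z > b}" if "a \<bullet> x > b" "a \<bullet> y > b"
    using that by (intro closed_segment_subset convex_halfspace_gt) auto
  have meet: "closed_segment x y \<inter> {z. a \<bullet> z = b} \<noteq> {}" if "a \<bullet> x \<le> b \<and> b \<le> a \<bullet> y \<or> a \<bullet> y \<le> b \<and> b \<le> a \<bullet> x"
    using that connected_ivt_hyperplane[of "closed_segment x y" x y a b]
      connected_ivt_hyperplane[of "closed_segment x y" y x a b] connected_segment(1)[of x y] by auto
  show ?thesis
  proof (cases "a \<bullet> x < b \<and> a \<bullet> y < b \<or> a \<bullet> x > b \<and> a \<bullet> y > b")
    case True
    then have "closed_segment x y \<inter> {z. a \<bullet> z = b} = {}"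
      using lt gt by fastforce
    then show ?thesis
      using True by (auto simp: same_side_def sgn_if)
  next
    case False
    then have "a \<bullet> x \<le> b \<and> b \<le> a \<bullet> y \<or> a \<bullet> y \<le> b \<and> b \<le> a \<bullet> x"
      by linarith
    then show ?thesis
      using meet False by (auto simp: same_side_def sgn_if)
  qed
qed

lemma same_side_equiv:
  assumes "hyperplane h"
  shows "same_side h x x" "same_side h x y \<Longrightarrow> same_side h y x"
    "same_side h x y \<Longrightarrow> same_side h y z \<Longrightarrow> same_side h x z"
proof -
  obtain a b where h: "h = {z. a \<bullet> z = b}"
    using assms unfolding hyperplane_def by blast
  show "same_side h x x" "same_side h x y \<Longrightarrow> same_side h y x"
    "same_side h x y \<Longrightarrow> same_side h y z \<Longrightarrow> same_side h x z"
    unfolding h same_side_iff by (rule refl, erule sym, erule trans, assumption)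
qed

lemma open_cell_self: "\<forall>h\<in>H. hyperplane h \<Longrightarrow> x \<in> open_cell H x"
  by (simp add: open_cell_def same_side_equiv(1))

lemma open_cell_eq:
  assumes "\<forall>h\<in>H. hyperplane h" "y \<in> open_cell H x"
  shows "open_cell H y = open_cell H x"
proof -
  have "same_side h y z \<longleftrightarrow> same_side h x z" if "h \<in> H" for h z
  proof -
    have h: "hyperplane h" "same_side h x y"
      using assms that by (auto simp: open_cell_def)
    show ?thesis
      using same_side_equiv(2,3)[OF h(1)] h(2) by blast
  qed
  then show ?thesis
    by (auto simp: open_cell_def)
qed

lemma closed_hyperplane_set: "hyperplane h \<Longrightarrow> closed h"
  by (auto simp: hyperplane_def closed_hyperplane)

text \<open>A ball meets only finitely many walls, so the cells of its points are distinguished by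
  finitely many signs.\<close>
lemma finite_open_cells:
  fixes H :: "'e::euclidean_space set set"
  assumes H: "euclidean_arrangement H"
  shows "finite (open_cell H ` cball c r)"
proof -
  have hyp: "\<forall>h\<in>H. hyperplane h"
    using H by (simp add: euclidean_arrangement_def)
  define H0 where "H0 = {h \<in> H. h \<inter> cball c r \<noteq> {}}"
  have fin: "finite H0"
    using H by (simp add: euclidean_arrangement_def H0_def)
  have "\<exists>f. \<forall>x y. same_side h x y \<longleftrightarrow> (f x :: real) = f y \<and> f x \<in> {-1, 0, 1}" if "h \<in> H" for h
  proof -
    obtain a b where h: "h = {z. a \<bullet> z = b}"
      using hyp \<open>h \<in> H\<close> unfolding hyperplane_def by blast
    show ?thesis
      by (rule exI[of _ "\<lambda>x. sgn (a \<bullet> x - b)"]) (auto simp: h same_side_iff sgn_if)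
  qed
  then obtain f where f: "\<And>h x y. h \<in> H \<Longrightarrow> same_side h x y \<longleftrightarrow> (f h x :: real) = f h y \<and> f h x \<in> {-1, 0, 1}"
    by metis
  define s where "s = (\<lambda>x. \<lambda>h\<in>H0. f h x)"
  have "s x \<in> H0 \<rightarrow>\<^sub>E {-1, 0, 1}" for x
    using f same_side_equiv(1) hyp by (fastforce simp: s_def H0_def)
  then have "s ` cball c r \<subseteq> H0 \<rightarrow>\<^sub>E {-1, 0, 1}"
    by blast
  then have fins: "finite (s ` cball c r)"
    by (rule finite_subset) (intro finite_PiE fin, simp)
  have "open_cell H x = open_cell H y" if xy: "x \<in> cball c r" "y \<in> cball c r" "s x = s y" for x y
  proof -
    have "same_side h y x" if h: "h \<in> H" for h
    proof (cases "h \<in> H0")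
      case True
      then have "f h x = f h y"
        using fun_cong[OF xy(3), of h] by (simp add: s_def)
      then show ?thesis
        using f[OF h, of y x] f[OF h, of y y] same_side_equiv(1) hyp h by auto
    next
      case False
      then have "closed_segment y x \<inter> h = {}"
        using h xy closed_segment_subset[OF xy(2,1) convex_cball] by (auto simp: H0_def)
      then show ?thesis
        by (simp add: same_side_def)
    qed
    then show ?thesis
      by (intro open_cell_eq[OF hyp]) (simp add: open_cell_def)
  qed
  then have "open_cell H x = open_cell H (inv_into (cball c r) s (s x))" if "x \<in> cball c r" for x
    using that by (metis f_inv_into_f imageI inv_into_into)
  then have "open_cell H ` cball c r \<subseteq> (\<lambda>\<sigma>. open_cell H (inv_into (cball c r) s \<sigma>)) ` s ` cball c r"
    by blast
  then show ?thesis
    using fins by (meson finite_imageI finite_subset)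
qed

lemma generic_point_interior:
  assumes H: "euclidean_arrangement H" and x: "x \<notin> \<Union>H"
  obtains e where "0 < e" "ball x e \<subseteq> open_cell H x"
proof -
  have hyp: "\<forall>h\<in>H. hyperplane h"
    using H by (simp add: euclidean_arrangement_def)
  let ?H = "{h \<in> H. h \<inter> cball x 1 \<noteq> {}}"
  have "finite ?H"
    using H by (simp add: euclidean_arrangement_def)
  then have "closed (\<Union>?H)"
    using hyp closed_hyperplane_set by blast
  then have "open (- \<Union>?H)" "x \<in> - \<Union>?H"
    using x by auto
  then obtain d where d: "0 < d" "ball x d \<subseteq> - \<Union>?H"
    using openE by blast
  have "ball x (min d 1) \<subseteq> open_cell H x"
  proof
    fix y
    assume y: "y \<in> ball x (min d 1)"
    have seg: "closed_segment x y \<subseteq> ball x (min d 1)"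
      using y d(1) by (intro closed_segment_subset convex_ball) auto
    have "closed_segment x y \<inter> h = {}" if "h \<in> H" for h
    proof (rule ccontr)
      assume "closed_segment x y \<inter> h \<noteq> {}"
      then obtain z where z: "z \<in> closed_segment x y" "z \<in> h"
        by blast
      then have "z \<in> cball x 1" "z \<in> ball x d"
        using seg by auto
      then show False
        using z(2) d(2) that by blast
    qed
    then show "y \<in> open_cell H x"
      by (simp add: open_cell_def same_side_def)
  qed
  then show thesis
    using that[of "min d 1"] d(1) by simp
qed

lemma generic_points_dense:
  fixes x :: "'e::euclidean_space"
  assumes H: "euclidean_arrangement H" and "0 < e"
  obtains y where "y \<in> ball x e" "y \<notin> \<Union>H"
proof -
  let ?H = "{h \<in> H. h \<inter> cball x e \<noteq> {}}"
  have "negligible (\<Union>?H)"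
    using H by (intro negligible_Union) (auto simp: euclidean_arrangement_def hyperplane_def negligible_hyperplane)
  moreover have "\<not> negligible (ball x e)"
    using \<open>0 < e\<close> by (intro open_not_negligible) auto
  ultimately obtain y where "y \<in> ball x e" "y \<notin> \<Union>?H"
    using negligible_subset by blast
  then show thesis
    using that[of y] by fastforce
qed

section \<open>Vertices far inside a sector\<close>

lemma reflection_hyperplane:
  fixes a :: "'e::euclidean_space"
  assumes "a \<noteq> 0"
  shows "reflection {z. a \<bullet> z = b} x = x - (2 * (a \<bullet> x - b) / (a \<bullet> a)) *\<^sub>R a"
proof -
  define p where "p = x - ((a \<bullet> x - b) / (a \<bullet> a)) *\<^sub>R a"
  have p: "a \<bullet> p = b"
    using assms by (simp add: p_def inner_diff_right)
  have "dist x p \<le> dist x z" if "a \<bullet> z = b" for z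
  proof -
    have "orthogonal (x - p) (p - z)"
    proof -
      have "x - p = ((a \<bullet> x - b) / (a \<bullet> a)) *\<^sub>R a"
        by (simp add: p_def)
      then show ?thesis
        using that p by (simp add: orthogonal_def inner_diff_right)
    qed
    then have "(norm (x - z))\<^sup>2 = (norm (x - p))\<^sup>2 + (norm (p - z))\<^sup>2"
      using norm_add_Pythagorean[of "x - p" "p - z"] by simp
    then show ?thesis
      by (simp add: dist_norm power2_le_imp_le)
  qed
  then have "closest_point {z. a \<bullet> z = b} x = p"
    using p by (intro closest_point_unique[symmetric] convex_hyperplane closed_hyperplane) auto
  then show ?thesis
    by (simp add: reflection_def) (simp add: p_def scaleR_2 scaleR_diff_right scaleR_left_distrib[symmetric] algebra_simps
        del: scaleR_left_distrib)
qed

text \<open>Requiring both signs makes this the group of the translations that permute the walls.\<close>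
definition wall_translations :: "'e::euclidean_space set set \<Rightarrow> 'e set" where
  "wall_translations H = {t. \<forall>h\<in>H. (\<lambda>x. x + t) ` h \<in> H \<and> (\<lambda>x. x - t) ` h \<in> H}"

lemma wall_translations_uminus: "t \<in> wall_translations H \<Longrightarrow> - t \<in> wall_translations H"
  by (simp add: wall_translations_def)

lemma wall_translations_add:
  assumes "s \<in> wall_translations H" "t \<in> wall_translations H"
  shows "s + t \<in> wall_translations H"
proof -
  have "(\<lambda>x. x + (s + t)) ` h = (\<lambda>x. x + s) ` (\<lambda>x. x + t) ` h"
    "(\<lambda>x. x - (s + t)) ` h = (\<lambda>x. x - s) ` (\<lambda>x. x - t) ` h" for h
    by (simp_all add: image_image algebra_simps)
  then show ?thesis
    using assms by (simp add: wall_translations_def)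
qed

lemma wall_translations_zero: "0 \<in> wall_translations H"
  by (simp add: wall_translations_def)

lemma wall_translations_int:
  assumes t: "t \<in> wall_translations H"
  shows "real_of_int n *\<^sub>R t \<in> wall_translations H"
proof -
  have *: "real m *\<^sub>R s \<in> wall_translations H" if "s \<in> wall_translations H" for m :: nat and s
    using that by (induction m) (auto simp: wall_translations_zero algebra_simps wall_translations_add)
  show ?thesis
    using *[OF t, of "nat n"] *[OF wall_translations_uminus[OF t], of "nat (- n)"] by (cases "n \<ge> 0") auto
qed

lemma wall_translations_sum:
  "(\<And>i. i \<in> J \<Longrightarrow> f i \<in> wall_translations H) \<Longrightarrow> sum f J \<in> wall_translations H"
  by (induction J rule: infinite_finite_induct) (auto simp: wall_translations_zero wall_translations_add)

text \<open>The composition of the reflections in two parallel walls is a translation.\<close>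
lemma parallel_walls_translation:
  assumes H: "euclidean_arrangement H" and "a \<noteq> 0"
    and h: "{z. a \<bullet> z = b} \<in> H" and k: "{z. a \<bullet> z = c} \<in> H"
  shows "(2 * (c - b) / (a \<bullet> a)) *\<^sub>R a \<in> wall_translations H"
proof -
  define t where "t = (\<lambda>b c. (2 * (c - b) / (a \<bullet> a)) *\<^sub>R a)"
  have refl: "reflection {z. a \<bullet> z = c} (reflection {z. a \<bullet> z = b} x) = x + t b c" for b c x
  proof -
    define r where "r = (a \<bullet> x - b) / (a \<bullet> a)"
    have "a \<bullet> x = b + r * (a \<bullet> a)"
      using \<open>a \<noteq> 0\<close> by (simp add: r_def)
    then have "2 * (a \<bullet> (x - (2 * r) *\<^sub>R a) - c) / (a \<bullet> a) = 2 * (b - c) / (a \<bullet> a) - 2 * r"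
      using \<open>a \<noteq> 0\<close> by (simp add: inner_diff_right field_simps)
    moreover have "reflection {z. a \<bullet> z = b} x = x - (2 * r) *\<^sub>R a"
      using \<open>a \<noteq> 0\<close> by (simp add: reflection_hyperplane r_def)
    ultimately show ?thesis
      using \<open>a \<noteq> 0\<close>
      by (simp add: reflection_hyperplane t_def scaleR_left_diff_distrib[symmetric] diff_divide_distrib
          right_diff_distrib) (simp add: algebra_simps)
  qed
  have im: "(\<lambda>x. x + t b c) ` m \<in> H"
    if "m \<in> H" "{z. a \<bullet> z = b} \<in> H" "{z. a \<bullet> z = c} \<in> H" for m b c
  proof -
    have "reflection {z. a \<bullet> z = c} ` reflection {z. a \<bullet> z = b} ` m \<in> H"
      using H that by (simp add: euclidean_arrangement_def)
    then show ?thesis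
      by (simp add: image_image refl)
  qed
  have "t b c = - t c b"
    by (simp add: t_def scaleR_minus_left[symmetric] del: scaleR_minus_left) (simp add: minus_divide_left)
  then have "(\<lambda>x. x - t b c) ` m = (\<lambda>x. x + t c b) ` m" for m
    by simp
  then have "t b c \<in> wall_translations H"
    using im[OF _ h k] im[OF _ k h] by (simp add: wall_translations_def)
  then show ?thesis
    by (simp add: t_def)
qed

lemma vertex_iff_open_cell:
  assumes "\<forall>h\<in>H. hyperplane h"
  shows "{w} \<in> coxeter_cells H \<longleftrightarrow> open_cell H w = {w}"
proof
  assume "{w} \<in> coxeter_cells H"
  then obtain z where z: "closure (open_cell H z) = {w}"
    by (auto simp: coxeter_cells_def)
  then have "open_cell H z \<subseteq> {w}"
    using closure_subset by blast
  then show "open_cell H w = {w}"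
    using open_cell_self[OF assms, of z] by auto
next
  assume "open_cell H w = {w}"
  then have "closure (open_cell H w) = {w}"
    by simp
  then show "{w} \<in> coxeter_cells H"
    unfolding coxeter_cells_def by blast
qed

lemma vertex_translation:
  assumes hyp: "\<forall>h\<in>H. hyperplane h" and t: "t \<in> wall_translations H" and w: "{w} \<in> coxeter_cells H"
  shows "{w + t} \<in> coxeter_cells H"
proof -
  have side: "same_side ((\<lambda>x. x + t) ` h) (w + t) y \<longleftrightarrow> same_side h w (y - t)" for h y
  proof -
    have im: "z \<in> (\<lambda>x. x + t) ` A \<longleftrightarrow> z - t \<in> A" for z A
      by (force simp: image_iff)
    have "closed_segment (t + w) (t + (y - t)) = (\<lambda>x. t + x) ` closed_segment w (y - t)"
      by (rule closed_segment_translation)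
    then have "closed_segment (w + t) y = (\<lambda>x. x + t) ` closed_segment w (y - t)"
      by (simp add: add.commute)
    then have "closed_segment (w + t) y \<inter> (\<lambda>x. x + t) ` h = (\<lambda>x. x + t) ` (closed_segment w (y - t) \<inter> h)"
      by (auto simp: im)
    then show ?thesis
      by (simp add: same_side_def im)
  qed
  have "y = w + t" if y: "y \<in> open_cell H (w + t)" for y
  proof -
    have "same_side h w (y - t)" if "h \<in> H" for h
    proof -
      have "(\<lambda>x. x + t) ` h \<in> H"
        using t that by (simp add: wall_translations_def)
      then have "same_side ((\<lambda>x. x + t) ` h) (w + t) y"
        using y unfolding open_cell_def by blast
      then show ?thesis
        by (rule iffD1[OF side])
    qed
    then have "y - t \<in> open_cell H w"
      by (simp add: open_cell_def)
    then have "y - t = w"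
      using iffD1[OF vertex_iff_open_cell[OF hyp] w] by blast
    then show ?thesis
      by (simp add: diff_eq_eq)
  qed
  then have "open_cell H (w + t) \<subseteq> {w + t}"
    by blast
  moreover have "{w + t} \<subseteq> open_cell H (w + t)"
    using open_cell_self[OF hyp, of "w + t"] by simp
  ultimately have "open_cell H (w + t) = {w + t}"
    by (rule equalityI)
  then show ?thesis
    by (rule iffD2[OF vertex_iff_open_cell[OF hyp]])
qed

text \<open>Otherwise some direction \<open>d\<close> is orthogonal to all translations. A wall that is not parallel to \<open>d\<close>
  then has no parallel companion, so it passes through the special vertex \<open>x\<close>; there are finitely many
  such walls, and a generic ray in direction \<open>d\<close> eventually crosses no wall at all. This contradicts
  the boundedness of chambers.\<close>
lemma wall_translations_span:
  fixes H :: "'e::euclidean_space set set"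
  assumes H: "euclidean_arrangement H" and x: "special_vertex H x"
  shows "span (wall_translations H) = UNIV"
proof (rule ccontr)
  assume "span (wall_translations H) \<noteq> UNIV"
  then obtain d where d: "d \<noteq> 0" "\<And>t. t \<in> wall_translations H \<Longrightarrow> d \<bullet> t = 0"
    using span_not_UNIV_orthogonal span_base by metis
  have through: "x \<in> h" if h: "h \<in> H" "h = {z. a \<bullet> z = b}" "a \<bullet> d \<noteq> 0" for h a b
  proof -
    obtain k t where k: "k \<in> H" "x \<in> k" "k = (+) t ` h"
      using x h(1) by (auto simp: special_vertex_def)
    have k_eq: "k = {z. a \<bullet> z = b + a \<bullet> t}"
    proof (intro equalityI subsetI)
      fix z
      assume "z \<in> {z. a \<bullet> z = b + a \<bullet> t}"
      then have "z - t \<in> h"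
        by (simp add: h(2) inner_diff_right)
      then have "t + (z - t) \<in> k"
        unfolding k(3) by (rule imageI)
      then show "z \<in> k"
        by simp
    qed (auto simp: k(3) h(2) inner_add_right)
    have a: "a \<noteq> 0"
      using h(3) by auto
    have "d \<bullet> ((2 * (b + a \<bullet> t - b) / (a \<bullet> a)) *\<^sub>R a) = 0"
      using d(2)[OF parallel_walls_translation[OF H a]] h k(1) k_eq by blast
    then have "a \<bullet> t = 0"
      using h(3) a by (simp add: inner_commute)
    then show ?thesis
      using k(2) k_eq h(2) by simp
  qed
  have fin: "finite {h \<in> H. h \<inter> cball x 0 \<noteq> {}}"
    using H unfolding euclidean_arrangement_def by blast
  obtain y where y: "y \<notin> \<Union>H"
    using generic_points_dense[OF H, of 1 x] by auto
  define S where "S = {s. y + s *\<^sub>R d \<in> \<Union>H}"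
  \<comment> \<open>The line through the generic point \<open>y\<close> meets a wall at most once: it is disjoint from a wall
    that is parallel to it. So the parameters of the crossings are values of \<open>\<sigma>\<close>.\<close>
  define \<sigma> where "\<sigma> = (\<lambda>h. SOME s. y + s *\<^sub>R d \<in> h)"
  have "S \<subseteq> \<sigma> ` {h \<in> H. h \<inter> cball x 0 \<noteq> {}}"
  proof
    fix s
    assume "s \<in> S"
    then obtain h where h: "h \<in> H" "y + s *\<^sub>R d \<in> h"
      by (auto simp: S_def)
    then obtain a b where ab: "h = {z. a \<bullet> z = b}"
      using H unfolding euclidean_arrangement_def hyperplane_def by blast
    have ad: "a \<bullet> d \<noteq> 0"
      using y h ab by (auto simp: inner_add_right)
    have "y + \<sigma> h *\<^sub>R d \<in> h"
      unfolding \<sigma>_def using h(2) by (rule someI)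
    moreover have "y + r *\<^sub>R d \<in> h \<longleftrightarrow> a \<bullet> y + r * (a \<bullet> d) = b" for r
      by (simp add: ab inner_add_right)
    ultimately have "s * (a \<bullet> d) = \<sigma> h * (a \<bullet> d)"
      using h(2) by fastforce
    then have "s = \<sigma> h"
      using ad by simp
    then show "s \<in> \<sigma> ` {h \<in> H. h \<inter> cball x 0 \<noteq> {}}"
      using through[OF h(1) ab ad] h(1) by auto
  qed
  then have "finite S"
    using finite_imageI[OF fin] by (rule finite_subset)
  obtain s0 where s0: "\<And>s. s \<in> S \<Longrightarrow> s < s0"
  proof -
    obtain m where "\<And>s. s \<in> S \<Longrightarrow> s \<le> m"
      using bdd_above_finite[OF \<open>finite S\<close>] by (auto simp: bdd_above_def)
    then show ?thesis
      using that[of "m + 1"] by fastforce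
  qed
  define z where "z = y + s0 *\<^sub>R d"
  have ray: "z + r *\<^sub>R d \<notin> \<Union>H" if "0 \<le> r" for r
  proof
    assume "z + r *\<^sub>R d \<in> \<Union>H"
    then have "s0 + r \<in> S"
      by (simp add: S_def z_def scaleR_left_distrib add.assoc)
    then show False
      using s0 that by fastforce
  qed
  have "z + r *\<^sub>R d \<in> open_cell H z" if r: "0 \<le> r" for r
  proof -
    have "closed_segment z (z + r *\<^sub>R d) \<inter> h = {}" if "h \<in> H" for h
    proof -
      have "w \<notin> h" if w: "w \<in> closed_segment z (z + r *\<^sub>R d)" for w
      proof -
        obtain u where u: "0 \<le> u" "w = (1 - u) *\<^sub>R z + u *\<^sub>R (z + r *\<^sub>R d)"
          using w by (auto simp: closed_segment_def)
        then have "w = z + (u * r) *\<^sub>R d"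
          by (simp add: algebra_simps)
        then show ?thesis
          using ray[of "u * r"] u(1) r \<open>h \<in> H\<close> by auto
      qed
      then show ?thesis
        by blast
    qed
    then show ?thesis
      by (simp add: open_cell_def same_side_def)
  qed
  moreover have "bounded (open_cell H z)"
    using H ray[of 0] by (simp add: euclidean_arrangement_def)
  then obtain C where C: "\<And>w. w \<in> open_cell H z \<Longrightarrow> norm w \<le> C"
    by (auto simp: bounded_iff)
  ultimately have "norm (z + r *\<^sub>R d) \<le> C" if "0 \<le> r" for r
    using that by blast
  moreover have "r * norm d \<le> norm (z + r *\<^sub>R d) + norm z" if "0 \<le> r" for r
    using norm_triangle_ineq4[of "z + r *\<^sub>R d" z] that by simp
  ultimately have bd: "r * norm d \<le> C + norm z" if "0 \<le> r" for r
    using that by fastforce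
  have "0 \<le> C + norm z"
    using bd[of 0] by simp
  then have "(C + norm z + 1) / norm d * norm d \<le> C + norm z"
    by (intro bd) simp
  then show False
    using d(1) by simp
qed

lemma sector_contains_balls:
  assumes H: "euclidean_arrangement H" and y: "\<forall>h\<in>H. x \<in> h \<longrightarrow> y \<notin> h"
  obtains e where "0 < e"
    "\<And>s. 0 < s \<Longrightarrow> ball (x + s *\<^sub>R (y - x)) (s * e) \<subseteq> open_cell {h \<in> H. x \<in> h} y"
proof -
  have hyp: "\<forall>h\<in>H. hyperplane h"
    using H by (simp add: euclidean_arrangement_def)
  have "finite {h \<in> H. h \<inter> cball x 0 \<noteq> {}}"
    using H unfolding euclidean_arrangement_def by blast
  then have "finite {h \<in> H. x \<in> h}"
    by (rule rev_finite_subset) auto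
  then have "closed (\<Union>{h \<in> H. x \<in> h})"
    using hyp closed_hyperplane_set by blast
  then have "open (- \<Union>{h \<in> H. x \<in> h})" "y \<in> - \<Union>{h \<in> H. x \<in> h}"
    using y by auto
  then obtain e where e: "0 < e" "ball y e \<subseteq> - \<Union>{h \<in> H. x \<in> h}"
    using openE by blast
  have "v \<in> open_cell {h \<in> H. x \<in> h} y" if s: "0 < s" and v: "v \<in> ball (x + s *\<^sub>R (y - x)) (s * e)" for s v
  proof -
    define v' where "v' = x + (1 / s) *\<^sub>R (v - x)"
    have "x + s *\<^sub>R (y - x) - v = s *\<^sub>R (y - v')"
      using s by (simp add: v'_def algebra_simps)
    then have "s * norm (y - v') < s * e"
      using v s by (simp add: dist_norm)
    then have "v' \<in> ball y e"
      using s by (simp add: dist_norm)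
    then have seg: "closed_segment y v' \<subseteq> ball y e"
      using e(1) by (intro closed_segment_subset convex_ball) auto
    have "same_side h y v" if h: "h \<in> H" "x \<in> h" for h
    proof -
      obtain a b where ab: "h = {z. a \<bullet> z = b}"
        using hyp h(1) unfolding hyperplane_def by blast
      have "same_side h y v'"
        using seg e(2) h by (auto simp: same_side_def)
      moreover have "a \<bullet> v' - b = (a \<bullet> v - b) / s"
        using h(2) s by (simp add: ab v'_def inner_add_right inner_diff_right field_simps)
      then have "sgn (a \<bullet> v' - b) = sgn (a \<bullet> v - b)"
        using s by (simp add: sgn_if divide_less_0_iff zero_less_divide_iff)
      ultimately show ?thesis
        by (simp add: ab same_side_iff)
    qed
    then show ?thesis
      by (simp add: open_cell_def)
  qed
  then show thesis
    using that e(1) by blast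
qed

text \<open>Rounding the coordinates of a far point on a ray inside the sector with respect to a spanning set
  of translations moves it by a bounded amount.\<close>
lemma deep_vertex:
  fixes H :: "'e::euclidean_space set set"
  assumes H: "euclidean_arrangement H" and K: "model_sector H K"
  obtains w where "{w} \<in> coxeter_cells H" "cball w R \<subseteq> K"
proof -
  have hyp: "\<forall>h\<in>H. hyperplane h"
    using H by (simp add: euclidean_arrangement_def)
  obtain x y where x: "special_vertex H x" and y: "\<forall>h\<in>H. x \<in> h \<longrightarrow> y \<notin> h"
    and K_eq: "K = closure (open_cell {h \<in> H. x \<in> h} y)"
    using K by (auto simp: model_sector_def)
  obtain e where e: "0 < e" "\<And>s. 0 < s \<Longrightarrow> ball (x + s *\<^sub>R (y - x)) (s * e) \<subseteq> open_cell {h \<in> H. x \<in> h} y"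
    using sector_contains_balls[OF H y] by blast
  obtain T where T: "T \<subseteq> wall_translations H" "independent T" "wall_translations H \<subseteq> span T"
    using maximal_independent_subset[of "wall_translations H"] by blast
  have "finite T"
    using T(2) by (rule independent_imp_finite)
  have "span T = UNIV"
    using span_mono[OF T(3)] unfolding wall_translations_span[OF H x] span_span by blast
  then have "y - x \<in> range (\<lambda>c. \<Sum>t\<in>T. c t *\<^sub>R t)"
    unfolding span_finite[OF \<open>finite T\<close>] by simp
  then obtain c where c: "y - x = (\<Sum>t\<in>T. c t *\<^sub>R t)"
    by blast
  define M where "M = (\<Sum>t\<in>T. norm t)"
  define s where "s = (\<bar>R\<bar> + M + 1) / e"
  have M: "0 \<le> M"
    by (simp add: M_def sum_nonneg)
  then have s: "0 < s" "s * e = \<bar>R\<bar> + M + 1"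
    using e(1) by (simp_all add: s_def)
  define w where "w = x + (\<Sum>t\<in>T. of_int \<lfloor>s * c t\<rfloor> *\<^sub>R t)"
  have vert: "{w} \<in> coxeter_cells H"
    unfolding w_def using x T(1)
    by (intro vertex_translation[OF hyp] wall_translations_sum wall_translations_int) (auto simp: special_vertex_def)
  have near: "dist (x + s *\<^sub>R (y - x)) w \<le> M"
  proof -
    have "x + s *\<^sub>R (y - x) - w = (\<Sum>t\<in>T. (s * c t - of_int \<lfloor>s * c t\<rfloor>) *\<^sub>R t)"
      by (simp add: w_def c scaleR_sum_right scaleR_left_diff_distrib sum_subtractf)
    also have "norm \<dots> \<le> (\<Sum>t\<in>T. norm ((s * c t - of_int \<lfloor>s * c t\<rfloor>) *\<^sub>R t))"
      by (rule norm_sum)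
    also have "\<dots> \<le> M"
      unfolding M_def
    proof (rule sum_mono)
      fix t
      have "\<bar>s * c t - of_int \<lfloor>s * c t\<rfloor>\<bar> \<le> 1"
        by linarith
      then show "norm ((s * c t - of_int \<lfloor>s * c t\<rfloor>) *\<^sub>R t) \<le> norm t"
        by (simp add: mult_left_le_one_le)
    qed
    finally show ?thesis
      by (simp add: dist_norm)
  qed
  have "cball w R \<subseteq> ball (x + s *\<^sub>R (y - x)) (s * e)"
  proof
    fix z
    assume "z \<in> cball w R"
    then have "dist (x + s *\<^sub>R (y - x)) z \<le> M + R"
      using near dist_triangle[of "x + s *\<^sub>R (y - x)" z w] by simp
    then show "z \<in> ball (x + s *\<^sub>R (y - x)) (s * e)"
      unfolding s(2) by simp
  qed
  then have "cball w R \<subseteq> K"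
    unfolding K_eq by (rule order_trans[OF _ order_trans[OF e(2)[OF s(1)] closure_subset]])
  with vert show thesis
    by (rule that)
qed

section \<open>Folding a building onto an apartment\<close>

lemma eq_if_equidistant_from_ball:
  fixes z z' :: "'e::euclidean_space"
  assumes "0 < e" and eq: "\<And>w. w \<in> ball a e \<Longrightarrow> dist z w = dist z' w"
  shows "z = z'"
proof (rule ccontr)
  assume "z \<noteq> z'"
  define v where "v = z - z'"
  define s where "s = e / (2 * norm v)"
  have v: "0 < norm v" and s: "0 < s"
    using \<open>z \<noteq> z'\<close> \<open>0 < e\<close> by (auto simp: v_def s_def)
  have sq: "(dist z w)\<^sup>2 - (dist z' w)\<^sup>2 = z \<bullet> z - z' \<bullet> z' - 2 * (w \<bullet> v)" for w
    by (simp add: dist_norm power2_norm_eq_inner v_def inner_diff_left inner_diff_right inner_commute algebra_simps)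
  have "norm (s *\<^sub>R v) = e / 2"
    using v s \<open>0 < e\<close> by (simp add: s_def)
  then have "a + s *\<^sub>R v \<in> ball a e" "a \<in> ball a e"
    using \<open>0 < e\<close> by (auto simp: dist_norm)
  then have "(a + s *\<^sub>R v) \<bullet> v = a \<bullet> v"
    using sq[of a] sq[of "a + s *\<^sub>R v"] eq by simp
  then have "s * (v \<bullet> v) = 0"
    by (simp add: inner_add_left)
  then show False
    using s v by simp
qed

locale euclid_building =
  fixes \<Delta> :: "('p, 'n::finite) building"
  assumes building: "euclidean_building \<Delta>"
begin

abbreviation "H \<equiv> walls \<Delta>"

lemma arrangement: "euclidean_arrangement H"
  using building by (simp add: euclidean_building_def)

lemma walls_hyperplane: "\<forall>h\<in>H. hyperplane h"
  using arrangement by (simp add: euclidean_arrangement_def)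

sublocale Metric_space "points \<Delta>" "bdist \<Delta>"
  using building unfolding euclidean_building_def by (elim conjE)

lemma apartment_points: "F \<in> apartments \<Delta> \<Longrightarrow> F \<subseteq> points \<Delta>"
  using building by (auto simp: euclidean_building_def)

lemma apartment_chart: "F \<in> apartments \<Delta> \<Longrightarrow> \<exists>\<phi>. chart \<Delta> F \<phi>"
  using building by (simp add: euclidean_building_def)

lemma cells_apartment: "A \<in> cells \<Delta> \<Longrightarrow> B \<in> cells \<Delta> \<Longrightarrow> \<exists>F\<in>apartments \<Delta>. A \<union> B \<subseteq> F"
  using building by (simp add: euclidean_building_def)

lemma apartments_iso:
  assumes "F \<in> apartments \<Delta>" "F' \<in> apartments \<Delta>" "A \<in> cells \<Delta>" "A \<subseteq> F" "A \<subseteq> F'"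
  obtains \<psi> where "apartment_iso \<Delta> F F' \<psi>" "\<And>x. x \<in> A \<Longrightarrow> \<psi> x = x"
proof -
  have "\<forall>F\<in>apartments \<Delta>. \<forall>F'\<in>apartments \<Delta>. \<forall>A\<in>cells \<Delta>. \<forall>B\<in>cells \<Delta>.
      A \<union> B \<subseteq> F \<inter> F' \<longrightarrow> (\<exists>\<psi>. apartment_iso \<Delta> F F' \<psi> \<and> (\<forall>x\<in>A \<union> B. \<psi> x = x))"
    using building unfolding euclidean_building_def by (elim conjE)
  from this[rule_format, OF assms(1,2,3,3)] obtain \<psi> where "apartment_iso \<Delta> F F' \<psi>" "\<forall>x\<in>A \<union> A. \<psi> x = x"
    using assms(4,5) by auto
  then show thesis
    using that by simp
qed

lemma cell_points: "A \<in> cells \<Delta> \<Longrightarrow> A \<subseteq> points \<Delta>"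
  using cells_apartment[of A A] apartment_points by blast

lemma chart_range: "chart \<Delta> F \<phi> \<Longrightarrow> range \<phi> = F"
  by (simp add: chart_def)

lemma chart_in: "chart \<Delta> F \<phi> \<Longrightarrow> \<phi> x \<in> F"
  by (auto simp: chart_def)

lemma chart_dist: "chart \<Delta> F \<phi> \<Longrightarrow> bdist \<Delta> (\<phi> x) (\<phi> y) = dist x y"
  by (simp add: chart_def)

lemma chart_cell:
  assumes "chart \<Delta> F \<phi>"
  shows "\<phi> ` closure (open_cell H x) \<in> cells \<Delta>" "\<phi> x \<in> \<phi> ` closure (open_cell H x)"
proof -
  have "closure (open_cell H x) \<in> coxeter_cells H"
    by (auto simp: coxeter_cells_def)
  then have "\<phi> ` closure (open_cell H x) \<in> {A \<in> cells \<Delta>. A \<subseteq> F}"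
    using assms by (simp add: chart_def)
  then show "\<phi> ` closure (open_cell H x) \<in> cells \<Delta>"
    by simp
  show "\<phi> x \<in> \<phi> ` closure (open_cell H x)"
    using open_cell_self[OF walls_hyperplane, of x] closure_subset by blast
qed

lemma point_cell:
  assumes "q \<in> points \<Delta>"
  obtains A where "A \<in> cells \<Delta>" "q \<in> A"
proof -
  have "points \<Delta> = \<Union>(apartments \<Delta>)"
    using building by (simp add: euclidean_building_def)
  then obtain F where F: "F \<in> apartments \<Delta>" "q \<in> F"
    using assms by auto
  obtain \<phi> where \<phi>: "chart \<Delta> F \<phi>"
    using apartment_chart[OF F(1)] by blast
  obtain x where "q = \<phi> x"
    using F(2) chart_range[OF \<phi>] by blast
  then show thesis
    using that chart_cell[OF \<phi>] by blast
qed

lemma points_apartment: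
  assumes "q \<in> points \<Delta>" "q' \<in> points \<Delta>"
  obtains F where "F \<in> apartments \<Delta>" "q \<in> F" "q' \<in> F"
proof -
  obtain A A' where "A \<in> cells \<Delta>" "q \<in> A" "A' \<in> cells \<Delta>" "q' \<in> A'"
    using point_cell assms by metis
  then show thesis
    using that cells_apartment[of A A'] by blast
qed

text \<open>The retraction onto the apartment \<open>F\<close> centred at the chamber \<open>C\<close> around \<open>\<phi> a\<close>, read in the
  chart: the image of a point is the point of \<open>F\<close> that has the same distances to all points of \<open>C\<close>.\<close>
definition fold_onto :: "(real ^ 'n \<Rightarrow> 'p) \<Rightarrow> real ^ 'n \<Rightarrow> 'p \<Rightarrow> real ^ 'n" where
  "fold_onto \<phi> a q = (SOME z. \<forall>w\<in>closure (open_cell H a). bdist \<Delta> (\<phi> z) (\<phi> w) = bdist \<Delta> q (\<phi> w))"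

context
  fixes F :: "'p set" and \<phi> :: "real ^ 'n \<Rightarrow> 'p" and a :: "real ^ 'n"
  assumes F: "F \<in> apartments \<Delta>" and \<phi>: "chart \<Delta> F \<phi>" and a: "a \<notin> \<Union>H"
begin

lemma chamber_coordinates_unique:
  assumes "\<And>w. w \<in> closure (open_cell H a) \<Longrightarrow> dist z w = dist z' w"
  shows "z = z'"
proof -
  obtain e where e: "0 < e" "ball a e \<subseteq> open_cell H a"
    using generic_point_interior[OF arrangement a] by blast
  show ?thesis
  proof (rule eq_if_equidistant_from_ball[OF e(1)])
    fix w
    assume "w \<in> ball a e"
    then show "dist z w = dist z' w"
      using assms e(2) closure_subset by blast
  qed
qed

text \<open>A cell and the chamber lie in a common apartment, which is isometric to \<open>F\<close> by a map that
  fixes the chamber.\<close>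
lemma fold_cell:
  assumes A: "A \<in> cells \<Delta>" and q: "q \<in> A"
  shows "\<And>w. w \<in> closure (open_cell H a) \<Longrightarrow> dist (fold_onto \<phi> a q) w = bdist \<Delta> q (\<phi> w)"
    and "q' \<in> A \<Longrightarrow> dist (fold_onto \<phi> a q) (fold_onto \<phi> a q') = bdist \<Delta> q q'"
proof -
  define C where "C = \<phi> ` closure (open_cell H a)"
  have C: "C \<in> cells \<Delta>" "C \<subseteq> F"
    unfolding C_def using chart_cell(1)[OF \<phi>] chart_in[OF \<phi>] by auto
  obtain F' where F': "F' \<in> apartments \<Delta>" "A \<union> C \<subseteq> F'"
    using cells_apartment[OF A C(1)] by blast
  have "C \<subseteq> F'"
    using F' by blast
  then obtain \<psi> where \<psi>: "apartment_iso \<Delta> F' F \<psi>" "\<And>x. x \<in> C \<Longrightarrow> \<psi> x = x"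
    using apartments_iso[OF F'(1) F C(1) _ C(2)] by blast
  have iso: "bdist \<Delta> (\<psi> x) (\<psi> y) = bdist \<Delta> x y" "\<psi> x \<in> F" if "x \<in> F'" "y \<in> F'" for x y
    using \<psi>(1) that by (auto simp: apartment_iso_def bij_betw_def)
  have fold_eq: "\<phi> (fold_onto \<phi> a p) = \<psi> p" if p: "p \<in> A" for p
  proof -
    have "\<psi> p \<in> F"
      using iso(2) p F'(2) by blast
    then obtain z where z: "\<psi> p = \<phi> z"
      using chart_range[OF \<phi>] by blast
    have zw: "bdist \<Delta> (\<phi> z) (\<phi> w) = bdist \<Delta> p (\<phi> w)" if w: "w \<in> closure (open_cell H a)" for w
    proof -
      have "\<phi> w \<in> C"
        using w by (simp add: C_def)
      then show ?thesis
        using iso(1)[of p "\<phi> w"] \<psi>(2) p F'(2) z by auto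
    qed
    then have fold: "bdist \<Delta> (\<phi> (fold_onto \<phi> a p)) (\<phi> w) = bdist \<Delta> p (\<phi> w)" if "w \<in> closure (open_cell H a)" for w
      unfolding fold_onto_def using someI[of "\<lambda>z. \<forall>w\<in>closure (open_cell H a). bdist \<Delta> (\<phi> z) (\<phi> w) = bdist \<Delta> p (\<phi> w)" z] that
      by blast
    have "fold_onto \<phi> a p = z"
    proof (rule chamber_coordinates_unique)
      fix w
      assume "w \<in> closure (open_cell H a)"
      then show "dist (fold_onto \<phi> a p) w = dist z w"
        using zw fold by (simp add: chart_dist[OF \<phi>])
    qed
    then show ?thesis
      using z by simp
  qed
  show "dist (fold_onto \<phi> a q) (fold_onto \<phi> a q') = bdist \<Delta> q q'" if "q' \<in> A"
    using iso(1)[of q q'] fold_eq q that F'(2) chart_dist[OF \<phi>, of "fold_onto \<phi> a q" "fold_onto \<phi> a q'"] by auto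
  show "dist (fold_onto \<phi> a q) w = bdist \<Delta> q (\<phi> w)" if "w \<in> closure (open_cell H a)" for w
  proof -
    have "\<phi> w \<in> C"
      using that by (simp add: C_def)
    then show ?thesis
      using iso(1)[of q "\<phi> w"] \<psi>(2) fold_eq[OF q] q F'(2) chart_dist[OF \<phi>, of "fold_onto \<phi> a q" w] by auto
  qed
qed

lemma fold_centre:
  assumes "q \<in> points \<Delta>"
  shows "dist (fold_onto \<phi> a q) a = bdist \<Delta> q (\<phi> a)"
proof -
  obtain A where "A \<in> cells \<Delta>" "q \<in> A"
    using point_cell[OF assms] .
  moreover have "a \<in> closure (open_cell H a)"
    using open_cell_self[OF walls_hyperplane, of a] closure_subset by blast
  ultimately show ?thesis
    using fold_cell(1) by blast
qed

lemma fold_chart: "fold_onto \<phi> a (\<phi> x) = x"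
proof (rule chamber_coordinates_unique)
  fix w
  assume "w \<in> closure (open_cell H a)"
  then show "dist (fold_onto \<phi> a (\<phi> x)) w = dist x w"
    using fold_cell(1)[OF chart_cell[OF \<phi>, of x]] by (simp add: chart_dist[OF \<phi>])
qed

text \<open>A segment in an apartment is covered by finitely many cells, and folding is isometric on each
  of them.\<close>
lemma fold_lipschitz:
  assumes q: "q \<in> points \<Delta>" and q': "q' \<in> points \<Delta>"
  shows "dist (fold_onto \<phi> a q) (fold_onto \<phi> a q') \<le> bdist \<Delta> q q'"
proof -
  obtain F' where F': "F' \<in> apartments \<Delta>" "q \<in> F'" "q' \<in> F'"
    using points_apartment[OF q q'] .
  obtain \<theta> where \<theta>: "chart \<Delta> F' \<theta>"
    using apartment_chart[OF F'(1)] by blast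
  obtain x y where xy: "q = \<theta> x" "q' = \<theta> y"
    using F' chart_range[OF \<theta>] by blast
  define \<gamma> where "\<gamma> = (\<lambda>t::real. x + t *\<^sub>R (y - x))"
  define I where "I = open_cell H ` cball x (dist x y)"
  define U where "U = (\<lambda>c. \<gamma> -` closure c)"
  have \<gamma>: "continuous_on UNIV \<gamma>"
    unfolding \<gamma>_def by (intro continuous_intros)
  have "(dist x y)-lipschitz_on {0..1} (\<lambda>t. fold_onto \<phi> a (\<theta> (\<gamma> t)))"
  proof (rule lipschitz_on_closed_Union[where I = I and U = U])
    show "finite I"
      unfolding I_def by (rule finite_open_cells[OF arrangement])
    show "{0..1} \<subseteq> (\<Union>c\<in>I. U c)"
    proof
      fix t :: real
      assume t: "t \<in> {0..1}"
      have "dist x (\<gamma> t) = t * dist x y"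
        using t by (simp add: \<gamma>_def dist_norm norm_minus_commute)
      also have "\<dots> \<le> dist x y"
        using t by (intro mult_left_le_one_le) auto
      finally have "open_cell H (\<gamma> t) \<in> I"
        by (simp add: I_def)
      moreover have "\<gamma> t \<in> closure (open_cell H (\<gamma> t))"
        using open_cell_self[OF walls_hyperplane, of "\<gamma> t"] closure_subset by blast
      then have "t \<in> U (open_cell H (\<gamma> t))"
        by (simp add: U_def)
      ultimately show "t \<in> (\<Union>c\<in>I. U c)"
        by blast
    qed
    fix c
    assume "c \<in> I"
    then obtain z where z: "c = open_cell H z"
      by (auto simp: I_def)
    show "closed (U c)"
      unfolding U_def by (rule continuous_closed_vimage[OF closed_closure]) (use \<gamma> in \<open>simp add: continuous_on_eq_continuous_at\<close>)
    show "(dist x y)-lipschitz_on (U c) (\<lambda>t. fold_onto \<phi> a (\<theta> (\<gamma> t)))"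
    proof (rule lipschitz_onI)
      fix s t
      assume "s \<in> U c" "t \<in> U c"
      then have "\<theta> (\<gamma> s) \<in> \<theta> ` closure (open_cell H z)" "\<theta> (\<gamma> t) \<in> \<theta> ` closure (open_cell H z)"
        by (auto simp: U_def z)
      then have "dist (fold_onto \<phi> a (\<theta> (\<gamma> s))) (fold_onto \<phi> a (\<theta> (\<gamma> t))) = dist (\<gamma> s) (\<gamma> t)"
        using fold_cell(2)[OF chart_cell(1)[OF \<theta>]] chart_dist[OF \<theta>] by metis
      also have "\<dots> = dist x y * dist s t"
      proof -
        have "\<gamma> s - \<gamma> t = (s - t) *\<^sub>R (y - x)"
          by (simp add: \<gamma>_def algebra_simps)
        then show ?thesis
          by (simp add: dist_norm norm_minus_commute)
      qed
      finally show "dist (fold_onto \<phi> a (\<theta> (\<gamma> s))) (fold_onto \<phi> a (\<theta> (\<gamma> t))) \<le> dist x y * dist s t"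
        by simp
    qed simp
  qed simp
  then have "dist (fold_onto \<phi> a (\<theta> (\<gamma> 0))) (fold_onto \<phi> a (\<theta> (\<gamma> 1))) \<le> dist x y * dist (0::real) 1"
    by (rule lipschitz_onD) auto
  then show ?thesis
    by (simp add: \<gamma>_def xy chart_dist[OF \<theta>])
qed

section \<open>Apartments that stay close to each other\<close>

text \<open>Averaging nearby points of \<open>F'\<close> gives a continuous map \<open>h\<close> from a ball of \<open>F\<close> to \<open>F'\<close>
  that moves points by at most \<open>3 * D + 3\<close>; so does its composition with the folding. By Brouwer's theorem
  the composition hits the centre. As folding preserves the distance to the centre, the
  centre lies in \<open>F'\<close>.\<close>
lemma generic_centre_in_close_apartment:
  assumes F': "F' \<in> apartments \<Delta>" and "0 \<le> D"
    and near: "\<And>x. x \<in> cball a (3 * D + 3) \<Longrightarrow> \<exists>q\<in>F'. bdist \<Delta> (\<phi> x) q \<le> D"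
  shows "\<phi> a \<in> F'"
proof -
  define R where "R = 3 * D + 3"
  have R: "0 < R"
    using \<open>0 \<le> D\<close> by (simp add: R_def)
  obtain \<theta> where \<theta>: "chart \<Delta> F' \<theta>"
    using apartment_chart[OF F'] by blast
  have pt: "\<phi> x \<in> points \<Delta>" "\<theta> x \<in> points \<Delta>" for x
    using chart_in[OF \<phi>] chart_in[OF \<theta>] apartment_points[OF F] apartment_points[OF F'] by auto
  have "\<exists>y. bdist \<Delta> (\<phi> x) (\<theta> y) \<le> D" if "x \<in> cball a R" for x
    using near[of x] that chart_range[OF \<theta>] by (auto simp: R_def)
  then obtain y where y: "\<And>x. x \<in> cball a R \<Longrightarrow> bdist \<Delta> (\<phi> x) (\<theta> (y x)) \<le> D"
    by metis
  obtain T where T: "T \<subseteq> cball a R" "finite T" "cball a R \<subseteq> (\<Union>x\<in>T. ball x 1)"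
    by (rule compactE_image[OF compact_cball, of "cball a R" "\<lambda>x. ball x 1" a R]) auto
  define w where "w = (\<lambda>(x :: real ^ 'n) t. max 0 (1 - dist t x))"
  define W where "W = (\<lambda>t. \<Sum>x\<in>T. w x t)"
  define h where "h = (\<lambda>t. (1 / W t) *\<^sub>R (\<Sum>x\<in>T. w x t *\<^sub>R y x))"
  have w0: "0 \<le> w x t" for x t
    by (simp add: w_def)
  have W: "0 < W t" and ex: "\<exists>x\<in>T. 0 < w x t" if t: "t \<in> cball a R" for t
  proof -
    obtain x where x: "x \<in> T" "t \<in> ball x 1"
      using T(3) t by blast
    then have "0 < w x t"
      by (simp add: w_def dist_commute)
    then show "\<exists>x\<in>T. 0 < w x t" "0 < W t"
      using x(1) w0 T(2) by (auto simp: W_def intro!: sum_pos2)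
  qed
  have h_cont: "continuous_on (cball a R) h"
    unfolding h_def W_def w_def
    by (intro continuous_intros) (use W in \<open>force simp: W_def w_def\<close>)
  \<comment> \<open>The points averaged by \<open>h t\<close> have distance at most \<open>D + 1\<close> to \<open>\<phi> t\<close>, hence at most
    \<open>2 * D + 2\<close> to each other; this is also a bound for their distance to the average.\<close>
  have h_near: "bdist \<Delta> (\<theta> (h t)) (\<phi> t) \<le> R" if t: "t \<in> cball a R" for t
  proof -
    have yt: "bdist \<Delta> (\<theta> (y x)) (\<phi> t) \<le> D + 1" if x: "x \<in> T" "0 < w x t" for x
    proof -
      have "dist x t < 1"
        using x(2) by (simp add: w_def max_def dist_commute split: if_splits)
      then have "bdist \<Delta> (\<phi> x) (\<phi> t) \<le> 1"
        by (simp add: chart_dist[OF \<phi>])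
      moreover have "bdist \<Delta> (\<theta> (y x)) (\<phi> x) \<le> D"
        using y[of x] x(1) T(1) by (auto simp: commute)
      ultimately show ?thesis
        using triangle[of "\<theta> (y x)" "\<phi> x" "\<phi> t", OF pt(2) pt(1) pt(1)] by simp
    qed
    obtain x0 where x0: "x0 \<in> T" "0 < w x0 t"
      using ex[OF t] by blast
    have yx: "norm (y x - y x0) \<le> 2 * D + 2" if x: "x \<in> T" "0 < w x t" for x
    proof -
      have "dist (y x) (y x0) \<le> bdist \<Delta> (\<theta> (y x)) (\<phi> t) + bdist \<Delta> (\<phi> t) (\<theta> (y x0))"
        using triangle[of "\<theta> (y x)" "\<phi> t" "\<theta> (y x0)", OF pt(2) pt(1) pt(2)] by (simp add: chart_dist[OF \<theta>])
      then show ?thesis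
        using yt[OF x] yt[OF x0] by (simp add: commute[of "\<phi> t"] dist_norm)
    qed
    have "h t - y x0 = (1 / W t) *\<^sub>R (\<Sum>x\<in>T. w x t *\<^sub>R (y x - y x0))"
    proof -
      have "(\<Sum>x\<in>T. w x t *\<^sub>R (y x - y x0)) = (\<Sum>x\<in>T. w x t *\<^sub>R y x) - W t *\<^sub>R y x0"
        by (simp add: W_def scaleR_diff_right sum_subtractf scaleR_left.sum)
      then show ?thesis
        using W[OF t] by (simp add: h_def scaleR_diff_right)
    qed
    then have "norm (h t - y x0) = (1 / W t) * norm (\<Sum>x\<in>T. w x t *\<^sub>R (y x - y x0))"
      using W[OF t] by simp
    also have "\<dots> \<le> (1 / W t) * (\<Sum>x\<in>T. w x t * (2 * D + 2))"
    proof (rule mult_left_mono)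
      show "norm (\<Sum>x\<in>T. w x t *\<^sub>R (y x - y x0)) \<le> (\<Sum>x\<in>T. w x t * (2 * D + 2))"
      proof (rule sum_norm_le)
        fix x
        assume "x \<in> T"
        then show "norm (w x t *\<^sub>R (y x - y x0)) \<le> w x t * (2 * D + 2)"
          using w0[of x t] yx[of x] by (cases "w x t = 0") (auto intro: mult_left_mono)
      qed
    qed (use W[OF t] in simp)
    also have "\<dots> = 2 * D + 2"
      using W[OF t] by (simp add: W_def sum_distrib_right[symmetric])
    finally have "bdist \<Delta> (\<theta> (h t)) (\<theta> (y x0)) \<le> 2 * D + 2"
      by (simp add: chart_dist[OF \<theta>] dist_norm)
    then show ?thesis
      using triangle[of "\<theta> (h t)" "\<theta> (y x0)" "\<phi> t", OF pt(2) pt(2) pt(1)] yt[OF x0] by (simp add: R_def)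
  qed
  define f where "f = (\<lambda>t. fold_onto \<phi> a (\<theta> (h t)))"
  have "1-lipschitz_on UNIV (\<lambda>z. fold_onto \<phi> a (\<theta> z))"
    by (rule lipschitz_onI) (use fold_lipschitz[OF pt(2) pt(2)] in \<open>auto simp: chart_dist[OF \<theta>]\<close>)
  then have "continuous_on UNIV (\<lambda>z. fold_onto \<phi> a (\<theta> z))"
    by (rule lipschitz_on_continuous_on)
  then have "continuous_on (cball a R) f"
    unfolding f_def using h_cont by (rule continuous_on_compose2) auto
  moreover have "a + (t - f t) \<in> cball a R" if t: "t \<in> cball a R" for t
  proof -
    have "dist (f t) t \<le> R"
      using fold_lipschitz[OF pt(2) pt(1), of "h t" t] h_near[OF t] by (simp add: f_def fold_chart)
    then show ?thesis
      by (simp add: dist_norm norm_minus_commute)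
  qed
  ultimately obtain t where t: "t \<in> cball a R" "f t = a"
    using brouwer_surjective_cball[of a R f a "{a}"] R by auto
  have "bdist \<Delta> (\<theta> (h t)) (\<phi> a) = 0"
    using fold_centre[OF pt(2), of "h t"] t(2) by (simp add: f_def)
  then have "\<theta> (h t) = \<phi> a"
    using zero[OF pt(2) pt(1)] by blast
  then show ?thesis
    using chart_in[OF \<theta>] by metis
qed

end

text \<open>Generic points are dense, and the intersection of two apartments is closed. The additional unit in
  the radius leaves room for passing to a generic centre.\<close>
lemma centre_in_close_apartment:
  assumes F: "F \<in> apartments \<Delta>" and \<phi>: "chart \<Delta> F \<phi>" and F': "F' \<in> apartments \<Delta>" and "0 \<le> D"
    and near: "\<And>x. x \<in> cball a (3 * D + 4) \<Longrightarrow> \<exists>q\<in>F'. bdist \<Delta> (\<phi> x) q \<le> D"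
  shows "\<phi> a \<in> F'"
proof -
  obtain \<theta> where \<theta>: "chart \<Delta> F' \<theta>"
    using apartment_chart[OF F'] by blast
  have pt: "\<phi> x \<in> points \<Delta>" "\<theta> x \<in> points \<Delta>" for x
    using chart_in[OF \<phi>] chart_in[OF \<theta>] apartment_points[OF F] apartment_points[OF F'] by auto
  have "\<exists>b z. dist a b < inverse (real (Suc n)) \<and> \<phi> b = \<theta> z" for n
  proof -
    obtain b where b: "b \<in> ball a (inverse (real (Suc n)))" "b \<notin> \<Union>H"
      using generic_points_dense[OF arrangement, of "inverse (real (Suc n))" a] by auto
    have "inverse (real (Suc n)) \<le> 1"
      by (simp add: field_simps)
    then have "dist a b \<le> 1"
      using b(1) by simp
    then have "cball b (3 * D + 3) \<subseteq> cball a (3 * D + 4)"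
      by (simp add: subset_iff) (smt (verit) dist_triangle)
    then have "\<phi> b \<in> F'"
      using near by (intro generic_centre_in_close_apartment[OF F \<phi> b(2) F' \<open>0 \<le> D\<close>]) auto
    then show ?thesis
      using b(1) chart_range[OF \<theta>] by auto
  qed
  then obtain b z where b: "\<And>n. dist a (b n) < inverse (real (Suc n))" and z: "\<And>n. \<phi> (b n) = \<theta> (z n)"
    by metis
  have "b \<longlonglongrightarrow> a"
  proof (rule metric_LIMSEQ_I)
    fix r :: real
    assume "0 < r"
    then obtain N where N: "inverse (real (Suc N)) < r"
      using reals_Archimedean[OF \<open>0 < r\<close>] by blast
    have "dist (b n) a < r" if "N \<le> n" for n
    proof -
      have "inverse (real (Suc n)) \<le> inverse (real (Suc N))"
        using that by (intro le_imp_inverse_le) auto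
      then show ?thesis
        using b[of n] N unfolding dist_commute[of "b n"] by linarith
    qed
    then show "\<exists>N. \<forall>n\<ge>N. dist (b n) a < r"
      by blast
  qed
  moreover have zb: "dist (z m) (z n) = dist (b m) (b n)" for m n
    using chart_dist[OF \<theta>, of "z m" "z n"] chart_dist[OF \<phi>, of "b m" "b n"] z by simp
  ultimately have "Cauchy z"
    using LIMSEQ_imp_Cauchy[of b a] by (simp add: Cauchy_def)
  then obtain y where y: "z \<longlonglongrightarrow> y"
    using Cauchy_convergent convergent_def by blast
  have "bdist \<Delta> (\<phi> a) (\<theta> y) \<le> dist (b n) a + dist (z n) y" for n
    using triangle[of "\<phi> a" "\<phi> (b n)" "\<theta> y", OF pt(1) pt(1) pt(2)] chart_dist[OF \<phi>, of a "b n"] chart_dist[OF \<theta>, of "z n" y] z[of n]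
    by (simp add: dist_commute)
  moreover have "(\<lambda>n. dist (b n) a + dist (z n) y) \<longlonglongrightarrow> dist a a + dist y y"
    by (intro tendsto_intros \<open>b \<longlonglongrightarrow> a\<close> y)
  ultimately have "bdist \<Delta> (\<phi> a) (\<theta> y) \<le> dist a a + dist y y"
    by (intro LIMSEQ_le_const[where X = "\<lambda>n. dist (b n) a + dist (z n) y"]) auto
  then have "\<phi> a = \<theta> y"
    using zero[of "\<phi> a" "\<theta> y", OF pt(1) pt(2)] nonneg[of "\<phi> a" "\<theta> y"] by (simp del: nonneg zero)
  then show ?thesis
    using chart_in[OF \<theta>] by simp
qed

text \<open>An isometric embedding of a Euclidean space into itself is onto.\<close>
lemma apartment_subset_eq:
  assumes F: "F \<in> apartments \<Delta>" and F': "F' \<in> apartments \<Delta>" and sub: "F \<subseteq> F'"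
  shows "F = F'"
proof -
  obtain \<phi> \<theta> where \<phi>: "chart \<Delta> F \<phi>" and \<theta>: "chart \<Delta> F' \<theta>"
    using apartment_chart F F' by metis
  have "\<exists>y. \<phi> x = \<theta> y" for x
    using sub chart_in[OF \<phi>, of x] chart_range[OF \<theta>] by blast
  then obtain j where j: "\<And>x. \<phi> x = \<theta> (j x)"
    by metis
  have "dist (j x) (j y) = dist x y" for x y
    using chart_dist[OF \<theta>, of "j x" "j y"] chart_dist[OF \<phi>, of x y] j by simp
  then have "orthogonal_transformation (\<lambda>x. j x - j 0)"
    unfolding orthogonal_transformation_isometry by (simp add: dist_norm)
  then have "surj (\<lambda>x. j x - j 0)"
    by (rule orthogonal_transformation_surj)
  then have "\<exists>x. j x = y" for y
    by (metis (no_types, lifting) surjD diff_add_cancel add_diff_cancel)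
  then show ?thesis
    using sub chart_range[OF \<theta>] chart_in[OF \<phi>] j by (metis imageE subsetI subset_antisym)
qed

end

section \<open>Groups fixing a boundary point\<close>

context euclid_building
begin

text \<open>Finite Hausdorff distance gives one constant \<open>D\<close> for all points of the sector, and a point whose
  ball of radius \<open>3 * D + 4\<close> lies in the sector satisfies the assumption on close apartments.\<close>
lemma deep_points_in_apartment:
  assumes F: "F \<in> apartments \<Delta>" and \<phi>: "chart \<Delta> F \<phi>" and F': "F' \<in> apartments \<Delta>" and "T \<subseteq> F'"
    and fin: "hausdorff_distance \<Delta> (\<phi> ` K) T < \<infinity>"
  shows "\<exists>\<rho>. \<forall>w. cball w \<rho> \<subseteq> K \<longrightarrow> \<phi> w \<in> F'"
proof -
  define s where "s = (SUP x\<in>\<phi> ` K. INF y\<in>T. ennreal (bdist \<Delta> x y))"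
  have "s < \<infinity>"
    using fin by (simp add: hausdorff_distance_def s_def)
  define D where "D = enn2real s + 1"
  have "0 \<le> D"
    by (simp add: D_def)
  have "s < ennreal D"
    using \<open>s < \<infinity>\<close> by (cases s) (auto simp: D_def ennreal_less_iff)
  have close: "\<exists>q\<in>F'. bdist \<Delta> (\<phi> x) q \<le> D" if "x \<in> K" for x
  proof -
    have "(INF y\<in>T. ennreal (bdist \<Delta> (\<phi> x) y)) \<le> s"
      unfolding s_def using that by (intro SUP_upper) simp
    then have "(INF y\<in>T. ennreal (bdist \<Delta> (\<phi> x) y)) < ennreal D"
      using \<open>s < ennreal D\<close> by (rule le_less_trans)
    then obtain q where "q \<in> T" "ennreal (bdist \<Delta> (\<phi> x) q) < ennreal D"
      by (auto simp: INF_less_iff)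
    then show ?thesis
      using \<open>T \<subseteq> F'\<close> by (auto simp: ennreal_less_iff intro!: bexI[of _ q])
  qed
  have "\<phi> w \<in> F'" if "cball w (3 * D + 4) \<subseteq> K" for w
    using close that by (intro centre_in_close_apartment[OF F \<phi> F' \<open>0 \<le> D\<close>]) blast
  then show ?thesis
    by blast
qed

text \<open>Every \<open>y \<in> X\<close> moves the apartment, so there is a point \<open>p y\<close> of \<open>F\<close> outside \<open>y ` F\<close>. All
  apartments \<open>x' ` F\<close>, with \<open>x'\<close> inverse to some \<open>x \<in> X\<close>, contain the deep part of the sector. Every
  vertex of \<open>F\<close> is the image under \<open>\<Lambda>\<close> of one of finitely many vertices. So some \<open>k\<close> maps
  one of them to a vertex far inside the sector, and then it maps the points \<open>p y\<close>, which are at bounded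
  distance from these vertices, into the deep part. If \<open>x \<circ> k \<circ> y\<close> preserved \<open>F\<close>, then
  \<open>k ` y ` F = x' ` F\<close> would contain \<open>k (p y)\<close>, that is, \<open>y ` F\<close> would contain \<open>p y\<close>.\<close>
lemma separating_element:
  fixes \<Gamma> \<Lambda> :: "('p \<Rightarrow> 'p) set"
  assumes F: "F \<in> apartments \<Delta>" and \<phi>: "chart \<Delta> F \<phi>" and K: "model_sector H K"
    and maps: "\<And>g p. g \<in> \<Gamma> \<Longrightarrow> p \<in> points \<Delta> \<Longrightarrow> g p \<in> points \<Delta>"
    and iso: "\<And>g p q. g \<in> \<Gamma> \<Longrightarrow> p \<in> points \<Delta> \<Longrightarrow> q \<in> points \<Delta> \<Longrightarrow> bdist \<Delta> (g p) (g q) = bdist \<Delta> p q"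
    and inverse: "\<And>g. g \<in> \<Gamma> \<Longrightarrow> \<exists>g'\<in>\<Gamma>. \<forall>p\<in>points \<Delta>. g' (g p) = p \<and> g (g' p) = p"
    and apt: "\<And>g. g \<in> \<Gamma> \<Longrightarrow> g ` F \<in> apartments \<Delta>"
    and boundary: "\<And>g. g \<in> \<Gamma> \<Longrightarrow> hausdorff_distance \<Delta> (\<phi> ` K) (g ` \<phi> ` K) < \<infinity>"
    and \<Lambda>: "\<Lambda> = {g \<in> \<Gamma>. g ` F = F}"
    and identity: "e \<in> \<Lambda>" "\<And>p. p \<in> points \<Delta> \<Longrightarrow> e p = p"
    and orbits: "finite {{g v |g. g \<in> \<Lambda>} |v. v \<in> vertices \<Delta> \<inter> F}"
    and X: "finite X" "X \<subseteq> \<Gamma> - \<Lambda>"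
  shows "\<exists>k\<in>\<Lambda>. \<forall>x\<in>X. \<forall>y\<in>X. (\<lambda>p. x (k (y p))) ` F \<noteq> F"
proof -
  have FP: "p \<in> points \<Delta>" if "p \<in> F" for p
    using apartment_points[OF F] that by blast
  obtain i where i: "\<And>g. g \<in> \<Gamma> \<Longrightarrow> i g \<in> \<Gamma>" "\<And>g p. g \<in> \<Gamma> \<Longrightarrow> p \<in> points \<Delta> \<Longrightarrow> i g (g p) = p"
    using inverse by metis
  have "\<exists>p. p \<in> F \<and> p \<notin> y ` F" if "y \<in> X" for y
  proof -
    have "y \<in> \<Gamma>" "y ` F \<noteq> F"
      using that X(2) by (auto simp: \<Lambda>)
    then show ?thesis
      using apartment_subset_eq[OF F apt, of y] by blast
  qed
  then obtain p where p: "\<And>y. y \<in> X \<Longrightarrow> p y \<in> F" "\<And>y. y \<in> X \<Longrightarrow> p y \<notin> y ` F"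
    by metis
  have "\<exists>\<rho>. \<forall>w. cball w \<rho> \<subseteq> K \<longrightarrow> \<phi> w \<in> g ` F" if "g \<in> \<Gamma>" for g
    using deep_points_in_apartment[OF F \<phi> apt[OF that] _ boundary[OF that]] chart_in[OF \<phi>] by blast
  then obtain \<rho> where \<rho>: "\<And>g w. g \<in> \<Gamma> \<Longrightarrow> cball w (\<rho> g) \<subseteq> K \<Longrightarrow> \<phi> w \<in> g ` F"
    by metis
  define P where "P = Max (insert 0 ((\<lambda>x. \<rho> (i x)) ` X))"
  have P: "\<rho> (i x) \<le> P" if "x \<in> X" for x
    unfolding P_def using X(1) that by (intro Max_ge) auto
  define orb where "orb = (\<lambda>v. {g v |g. g \<in> \<Lambda>})"
  define V where "V = vertices \<Delta> \<inter> F"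
  have "finite (orb ` V)"
    using orbits by (rule rev_finite_subset) (auto simp: orb_def V_def)
  then obtain V0 where V0: "finite V0" "V0 \<subseteq> V" "orb ` V = orb ` V0"
    by (metis finite_subset_image order_refl)
  define R where "R = Max (insert 0 ((\<lambda>(y, v). bdist \<Delta> (p y) v) ` (X \<times> V0)))"
  have R: "bdist \<Delta> (p y) v \<le> R" if "y \<in> X" "v \<in> V0" for y v
    unfolding R_def using X(1) V0(1) that by (intro Max_ge) auto
  obtain w where w: "{w} \<in> coxeter_cells H" "cball w (R + P) \<subseteq> K"
    using deep_vertex[OF arrangement K] by blast
  have "\<phi> ` {w} \<in> {A \<in> cells \<Delta>. A \<subseteq> F}"
    using \<phi> w(1) unfolding chart_def by blast
  then have wV: "\<phi> w \<in> V"
    using chart_in[OF \<phi>] by (auto simp: V_def vertices_def)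
  then have "e (\<phi> w) = \<phi> w"
    using identity(2)[OF FP] by (simp add: V_def)
  then have "\<phi> w \<in> orb (\<phi> w)"
    unfolding orb_def using identity(1) by (intro CollectI exI[of _ e]) simp
  moreover have "orb (\<phi> w) \<in> orb ` V0"
    unfolding V0(3)[symmetric] by (rule imageI[OF wV])
  then obtain v where "orb (\<phi> w) = orb v" and vV0: "v \<in> V0"
    by (rule imageE)
  ultimately have v: "v \<in> V0" "\<phi> w \<in> orb v"
    by simp_all
  then obtain k where k: "k \<in> \<Lambda>" "\<phi> w = k v"
    by (auto simp: orb_def)
  have kG: "k \<in> \<Gamma>" "k ` F = F"
    using k(1) by (auto simp: \<Lambda>)
  have deep: "k (p y) \<in> i x ` F" if x: "x \<in> X" and y: "y \<in> X" for x y
  proof -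
    have "k (p y) \<in> F"
      using kG(2) p(1)[OF y] by blast
    then obtain b where b: "k (p y) = \<phi> b"
      using chart_range[OF \<phi>] by blast
    have "v \<in> F"
      using v(1) V0(2) by (auto simp: V_def)
    then have "dist b w = bdist \<Delta> (p y) v"
      using chart_dist[OF \<phi>, of b w] iso[OF kG(1) FP FP, of "p y" v] p(1)[OF y] b k(2) by simp
    then have "dist b w \<le> R"
      using R[OF y v(1)] by simp
    then have "cball b (\<rho> (i x)) \<subseteq> cball w (R + P)"
      using P[OF x] by (intro subsetI) (simp, smt (verit) dist_commute dist_triangle)
    then show ?thesis
      using \<rho>[of "i x" b] i(1) X(2) x w(2) b by auto
  qed
  have "(\<lambda>p. x (k (y p))) ` F \<noteq> F" if x: "x \<in> X" and y: "y \<in> X" for x y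
  proof
    assume eq: "(\<lambda>p. x (k (y p))) ` F = F"
    have xy: "x \<in> \<Gamma>" "y \<in> \<Gamma>"
      using x y X(2) by auto
    obtain f where f: "f \<in> F" "k (p y) = i x f"
      using deep[OF x y] by blast
    obtain f' where f': "f' \<in> F" "f = x (k (y f'))"
      using eq f(1) by blast
    have yf: "y f' \<in> points \<Delta>"
      using apartment_points[OF apt[OF xy(2)]] f'(1) by blast
    have kyf: "k (y f') \<in> points \<Delta>"
      by (rule maps[OF kG(1) yf])
    have "k (p y) = k (y f')"
      using f(2) unfolding f'(2) i(2)[OF xy(1) kyf] .
    then have "p y = y f'"
      using i(2)[OF kG(1) FP[OF p(1)[OF y]]] i(2)[OF kG(1) yf] by metis
    then show False
      using p(2)[OF y] f'(1) by blast
  qed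
  then show ?thesis
    using k(1) by blast
qed

section \<open>The automorphism group\<close>

lemma Aut_carrier:
  "carrier (Aut \<Delta>) = {g \<in> Bij (points \<Delta>).
     (\<forall>x\<in>points \<Delta>. \<forall>y\<in>points \<Delta>. bdist \<Delta> (g x) (g y) = bdist \<Delta> x y) \<and> (`) g ` cells \<Delta> = cells \<Delta>}"
  by (simp add: Aut_def)

lemma Aut_mult: "g \<in> Bij (points \<Delta>) \<Longrightarrow> h \<in> Bij (points \<Delta>) \<Longrightarrow> g \<otimes>\<^bsub>Aut \<Delta>\<^esub> h = compose (points \<Delta>) g h"
  by (simp add: Aut_def BijGroup_def)

lemma Aut_one: "\<one>\<^bsub>Aut \<Delta>\<^esub> = (\<lambda>x\<in>points \<Delta>. x)"
  by (simp add: Aut_def BijGroup_def)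

lemma Aut_group: "group (Aut \<Delta>)"
proof -
  let ?P = "points \<Delta>"
  interpret Bij: group "BijGroup ?P"
    by (rule group_BijGroup)
  have "subgroup (carrier (Aut \<Delta>)) (BijGroup ?P)"
  proof (rule Bij.subgroupI)
    show "carrier (Aut \<Delta>) \<subseteq> carrier (BijGroup ?P)"
      by (auto simp: Aut_carrier BijGroup_def)
    have "(\<lambda>x\<in>?P. x) ` A = A" if "A \<in> cells \<Delta>" for A
      using cell_points[OF that] by (auto simp: image_iff)
    then have "(`) (\<lambda>x\<in>?P. x) ` cells \<Delta> = cells \<Delta>"
      by (simp cong: image_cong)
    then have "(\<lambda>x\<in>?P. x) \<in> carrier (Aut \<Delta>)"
      by (simp add: Aut_carrier id_Bij)
    then show "carrier (Aut \<Delta>) \<noteq> {}"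
      by blast
  next
    fix g
    assume g: "g \<in> carrier (Aut \<Delta>)"
    define g' where "g' = (\<lambda>x\<in>?P. inv_into ?P g x)"
    have gB: "g \<in> Bij ?P" and iso: "\<And>x y. x \<in> ?P \<Longrightarrow> y \<in> ?P \<Longrightarrow> bdist \<Delta> (g x) (g y) = bdist \<Delta> x y"
      and cells: "(`) g ` cells \<Delta> = cells \<Delta>"
      using g by (simp_all add: Aut_carrier)
    have bij: "bij_betw g ?P ?P"
      using gB by (simp add: Bij_def)
    have g'g: "g' (g x) = x" "g x \<in> ?P" if "x \<in> ?P" for x
      using that bij by (auto simp: g'_def bij_betw_def)
    have gg': "g (g' x) = x" "g' x \<in> ?P" if "x \<in> ?P" for x
      using that bij by (auto simp: g'_def bij_betw_inv_into_right bij_betw_def inv_into_into)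
    have im: "g' ` g ` A = A" if "A \<in> cells \<Delta>" for A
      using cell_points[OF that] g'g by (force simp: image_image)
    have "(`) g' ` cells \<Delta> = (`) g' ` (`) g ` cells \<Delta>"
      by (simp add: cells)
    also have "\<dots> = cells \<Delta>"
      unfolding image_image[of "(`) g'"] using im by (simp cong: image_cong)
    finally have "(`) g' ` cells \<Delta> = cells \<Delta>" .
    moreover have "bdist \<Delta> (g' x) (g' y) = bdist \<Delta> x y" if "x \<in> ?P" "y \<in> ?P" for x y
      using iso[of "g' x" "g' y"] gg' that by simp
    moreover have "g' \<in> Bij ?P"
      unfolding g'_def by (rule restrict_inv_into_Bij[OF gB])
    ultimately have "g' \<in> carrier (Aut \<Delta>)"
      by (simp add: Aut_carrier)
    then show "inv\<^bsub>BijGroup ?P\<^esub> g \<in> carrier (Aut \<Delta>)"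
      by (simp add: inv_BijGroup[OF gB] g'_def)
  next
    fix g h
    assume g: "g \<in> carrier (Aut \<Delta>)" and h: "h \<in> carrier (Aut \<Delta>)"
    then have B: "g \<in> Bij ?P" "h \<in> Bij ?P"
      by (simp_all add: Aut_carrier)
    have hP: "h x \<in> ?P" if "x \<in> ?P" for x
      using Bij_imp_funcset[OF B(2)] that by blast
    have "compose ?P g h ` A = g ` h ` A" if "A \<in> cells \<Delta>" for A
      using cell_points[OF that] by (force simp: compose_def image_image)
    then have "(`) (compose ?P g h) ` cells \<Delta> = (`) g ` (`) h ` cells \<Delta>"
      unfolding image_image[of "(`) g"] by (rule image_cong[OF refl])
    also have "\<dots> = cells \<Delta>"
      using g h by (simp add: Aut_carrier)
    finally have "compose ?P g h \<in> carrier (Aut \<Delta>)"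
      using g h hP compose_Bij[OF B] by (simp add: Aut_carrier compose_def)
    then show "g \<otimes>\<^bsub>BijGroup ?P\<^esub> h \<in> carrier (Aut \<Delta>)"
      using B by (simp add: BijGroup_def)
  qed
  then have "group (BijGroup ?P\<lparr>carrier := carrier (Aut \<Delta>)\<rparr>)"
    by (rule subgroup.subgroup_is_group[OF _ Bij.is_group])
  moreover have "BijGroup ?P\<lparr>carrier := carrier (Aut \<Delta>)\<rparr> = Aut \<Delta>"
    by (simp add: Aut_def)
  ultimately show ?thesis
    by simp
qed

lemma hausdorff_distance_self:
  assumes "S \<subseteq> points \<Delta>"
  shows "hausdorff_distance \<Delta> S S < \<infinity>"
proof -
  have "(INF y\<in>S. ennreal (bdist \<Delta> x y)) \<le> 0" if "x \<in> S" for x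
    using INF_lower[of x S "\<lambda>y. ennreal (bdist \<Delta> x y)"] that assms by (auto simp: subset_iff)
  moreover have "(INF x\<in>S. ennreal (bdist \<Delta> x y)) \<le> 0" if "y \<in> S" for y
    using INF_lower[of y S "\<lambda>x. ennreal (bdist \<Delta> x y)"] that assms by (auto simp: subset_iff)
  ultimately have "hausdorff_distance \<Delta> S S \<le> 0"
    unfolding hausdorff_distance_def by (intro max.boundedI SUP_least)
  then show ?thesis
    by (simp add: le_less_trans)
qed

end

theorem theorem6p2:
  fixes \<Delta> :: "('p, 'n::finite) building"
    and G B N \<Gamma> \<Gamma>\<^sub>0 :: "('p \<Rightarrow> 'p) set"
    and F\<^sub>0 S\<^sub>0 :: "'p set"
    and \<omega>\<^sub>0 :: "'p set set"
  assumes building: "euclidean_building \<Delta>"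
    and G: "subgroup G (Aut \<Delta>)" "strongly_transitive \<Delta> G" "type_preserving \<Delta> G"
    and F\<^sub>0: "F\<^sub>0 \<in> apartments \<Delta>"
    and S\<^sub>0: "sector_in \<Delta> F\<^sub>0 S\<^sub>0"
    and \<omega>\<^sub>0: "\<omega>\<^sub>0 = boundary_point \<Delta> S\<^sub>0"
    and B: "B = {g \<in> G. boundary_act g \<omega>\<^sub>0 = \<omega>\<^sub>0}"
    and N: "N = {g \<in> G. g ` F\<^sub>0 = F\<^sub>0}"
    and \<Gamma>: "subgroup \<Gamma> (Aut \<Delta>)" "\<Gamma> \<subseteq> B" "icc (Aut \<Delta>\<lparr>carrier := \<Gamma>\<rparr>)"
    and \<Gamma>\<^sub>0: "\<Gamma>\<^sub>0 = \<Gamma> \<inter> N" "comm_group (Aut \<Delta>\<lparr>carrier := \<Gamma>\<^sub>0\<rparr>)"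
    and finite_quotient: "finite {{g v |g. g \<in> \<Gamma>\<^sub>0} |v. v \<in> vertices \<Delta> \<inter> F\<^sub>0}"
  shows "masa \<Gamma> (VN (Aut \<Delta>\<lparr>carrier := \<Gamma>\<rparr>) \<Gamma>) (VN (Aut \<Delta>\<lparr>carrier := \<Gamma>\<rparr>) \<Gamma>\<^sub>0)
    \<and> strongly_singular \<Gamma> (VN (Aut \<Delta>\<lparr>carrier := \<Gamma>\<rparr>) \<Gamma>) (group_trace (Aut \<Delta>\<lparr>carrier := \<Gamma>\<rparr>))
        (VN (Aut \<Delta>\<lparr>carrier := \<Gamma>\<rparr>) \<Gamma>\<^sub>0)"
proof -
  interpret euclid_building \<Delta>
    by (rule euclid_building.intro[OF building])
  let ?P = "points \<Delta>"
  define A where "A = Aut \<Delta>\<lparr>carrier := \<Gamma>\<rparr>"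
  interpret A: group A
    unfolding A_def by (rule subgroup.subgroup_is_group[OF \<Gamma>(1) Aut_group])
  have carrier_A: "carrier A = \<Gamma>"
    by (simp add: A_def)
  have \<Gamma>_Aut: "g \<in> carrier (Aut \<Delta>)" if "g \<in> \<Gamma>" for g
    using subgroup.mem_carrier[OF \<Gamma>(1) that] .
  then have \<Gamma>_Bij: "g \<in> Bij ?P" if "g \<in> \<Gamma>" for g
    using that by (simp add: Aut_carrier)
  have \<Gamma>_maps: "g p \<in> ?P" if "g \<in> \<Gamma>" "p \<in> ?P" for g p
    using Bij_imp_funcset[OF \<Gamma>_Bij[OF that(1)]] that(2) by blast
  have \<Gamma>_iso: "bdist \<Delta> (g p) (g q) = bdist \<Delta> p q" if "g \<in> \<Gamma>" "p \<in> ?P" "q \<in> ?P" for g p q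
    using \<Gamma>_Aut[OF that(1)] that(2,3) by (simp add: Aut_carrier)
  have mult: "(g \<otimes>\<^bsub>A\<^esub> h) p = g (h p)" if "g \<in> \<Gamma>" "h \<in> \<Gamma>" "p \<in> ?P" for g h p
    using Aut_mult[OF \<Gamma>_Bij[OF that(1)] \<Gamma>_Bij[OF that(2)]] that(3) by (simp add: A_def compose_def)
  have one: "\<one>\<^bsub>A\<^esub> p = p" if "p \<in> ?P" for p
    using that by (simp add: A_def Aut_one)
  have inverse: "\<exists>g'\<in>\<Gamma>. \<forall>p\<in>?P. g' (g p) = p \<and> g (g' p) = p" if g: "g \<in> \<Gamma>" for g
  proof (rule bexI[of _ "inv\<^bsub>A\<^esub> g"])
    show inv: "inv\<^bsub>A\<^esub> g \<in> \<Gamma>"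
      using A.inv_closed[of g] g by (simp add: carrier_A)
    show "\<forall>p\<in>?P. (inv\<^bsub>A\<^esub> g) (g p) = p \<and> g ((inv\<^bsub>A\<^esub> g) p) = p"
      using mult[OF inv g] mult[OF g inv] one A.l_inv[of g] A.r_inv[of g] g by (simp add: carrier_A)
  qed
  have \<Gamma>_G: "g \<in> G" and \<Gamma>_\<omega>: "boundary_act g \<omega>\<^sub>0 = \<omega>\<^sub>0" if "g \<in> \<Gamma>" for g
    using that \<Gamma>(2) B by auto
  have apt: "g ` F\<^sub>0 \<in> apartments \<Delta>" if "g \<in> \<Gamma>" for g
    using G(2) \<Gamma>_G[OF that] F\<^sub>0 by (simp add: strongly_transitive_def)
  have \<Gamma>0_eq: "\<Gamma>\<^sub>0 = {g \<in> \<Gamma>. g ` F\<^sub>0 = F\<^sub>0}"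
    using \<Gamma>\<^sub>0(1) N \<Gamma>_G by auto
  have "group (Aut \<Delta>\<lparr>carrier := \<Gamma>\<^sub>0\<rparr>)"
    using \<Gamma>\<^sub>0(2) by (simp add: comm_group.axioms)
  then have sub: "subgroup \<Gamma>\<^sub>0 A"
    using A.group_incl_imp_subgroup[of \<Gamma>\<^sub>0] by (simp add: A_def \<Gamma>0_eq)
  have comm: "x \<otimes>\<^bsub>A\<^esub> y = y \<otimes>\<^bsub>A\<^esub> x" if "x \<in> \<Gamma>\<^sub>0" "y \<in> \<Gamma>\<^sub>0" for x y
    using comm_monoid.m_comm[OF comm_group.axioms(1)[OF \<Gamma>\<^sub>0(2)], of x y] that by (simp add: A_def)
  obtain \<phi> K where \<phi>: "chart \<Delta> F\<^sub>0 \<phi>" and K: "model_sector H K" and S0_eq: "S\<^sub>0 = \<phi> ` K"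
    using S\<^sub>0 by (auto simp: sector_in_def)
  have "S\<^sub>0 \<subseteq> ?P"
    using apartment_points[OF F\<^sub>0] chart_in[OF \<phi>] by (auto simp: S0_eq)
  \<comment> \<open>As \<open>S\<^sub>0\<close> represents the boundary point, so does every \<open>g ` S\<^sub>0\<close>.\<close>
  then have "S\<^sub>0 \<in> \<omega>\<^sub>0"
    using hausdorff_distance_self F\<^sub>0 S\<^sub>0 by (auto simp: \<omega>\<^sub>0 boundary_point_def sectors_def)
  then have "g ` S\<^sub>0 \<in> \<omega>\<^sub>0" if "g \<in> \<Gamma>" for g
    using \<Gamma>_\<omega>[OF that] by (auto simp: boundary_act_def)
  then have boundary: "hausdorff_distance \<Delta> (\<phi> ` K) (g ` \<phi> ` K) < \<infinity>" if "g \<in> \<Gamma>" for g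
    using that by (simp add: \<omega>\<^sub>0 boundary_point_def S0_eq)
  have crit: "\<exists>k\<in>\<Gamma>\<^sub>0. \<forall>x\<in>X. \<forall>y\<in>X. x \<otimes>\<^bsub>A\<^esub> k \<otimes>\<^bsub>A\<^esub> y \<notin> \<Gamma>\<^sub>0" if X: "finite X" "X \<subseteq> carrier A - \<Gamma>\<^sub>0" for X
  proof -
    have XG: "X \<subseteq> \<Gamma> - \<Gamma>\<^sub>0"
      using X(2) by (simp add: carrier_A)
    have "\<exists>k\<in>\<Gamma>\<^sub>0. \<forall>x\<in>X. \<forall>y\<in>X. (\<lambda>p. x (k (y p))) ` F\<^sub>0 \<noteq> F\<^sub>0"
      by (rule separating_element[where \<Gamma> = \<Gamma> and \<Lambda> = \<Gamma>\<^sub>0 and e = "\<one>\<^bsub>A\<^esub>" and \<phi> = \<phi> and K = K])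
        (fact F\<^sub>0 \<phi> K \<Gamma>_maps \<Gamma>_iso inverse apt boundary \<Gamma>0_eq subgroup.one_closed[OF sub] one finite_quotient X(1) XG)+
    then obtain k where k: "k \<in> \<Gamma>\<^sub>0" "\<And>x y. x \<in> X \<Longrightarrow> y \<in> X \<Longrightarrow> (\<lambda>p. x (k (y p))) ` F\<^sub>0 \<noteq> F\<^sub>0"
      by blast
    have "x \<otimes>\<^bsub>A\<^esub> k \<otimes>\<^bsub>A\<^esub> y \<notin> \<Gamma>\<^sub>0" if x: "x \<in> X" and y: "y \<in> X" for x y
    proof
      have xyk: "x \<in> \<Gamma>" "y \<in> \<Gamma>" "k \<in> \<Gamma>" "x \<otimes>\<^bsub>A\<^esub> k \<in> \<Gamma>"
        using x y k(1) XG A.m_closed[of x k] by (auto simp: carrier_A \<Gamma>0_eq)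
      have "(x \<otimes>\<^bsub>A\<^esub> k \<otimes>\<^bsub>A\<^esub> y) p = x (k (y p))" if "p \<in> F\<^sub>0" for p
        using apartment_points[OF F\<^sub>0] that xyk \<Gamma>_maps[OF xyk(2)] by (simp add: mult subset_iff)
      then have "(\<lambda>p. x (k (y p))) ` F\<^sub>0 = (x \<otimes>\<^bsub>A\<^esub> k \<otimes>\<^bsub>A\<^esub> y) ` F\<^sub>0"
        by (simp cong: image_cong)
      moreover assume "x \<otimes>\<^bsub>A\<^esub> k \<otimes>\<^bsub>A\<^esub> y \<in> \<Gamma>\<^sub>0"
      ultimately show False
        using k(2)[OF x y] by (simp add: \<Gamma>0_eq)
    qed
    then show ?thesis
      using k(1) by blast
  qed
  show ?thesis
    using A.strongly_singular_masa_VN[OF sub comm crit] by (simp add: carrier_A flip: A_def)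
qed

end
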